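(* Let $d\ge 2$ be an integer and let $0<r<1/2$ be fixed. Let $(\mu_M)_{M\ge 1}$ be a sequence of (Borel) probability measures on $\mathbb{T}^d$ such that, for every positive integer $M$, the measure $\mu_M$ has support in a ball of radius $\varepsilon_M$ in $\mathbb{T}^d$, where $\varepsilon_M=\mathcal{O}(M^{-1})$ (i.e. there is a constant $C>0$ with $\varepsilon_M\le C/M$ for all $M$). Then there exists a constant $c>0$, independent of $M$, such that for every positive integer $M$, with $N=M^d$, $$D_{\mu_M}^2(N)\le cN^{1-1/d}.$$
   Context: The torus $\mathbb{T}^d=\mathbb{R}^d/\mathbb{Z}^d$ is identified with the cube $Q=[-1/2,1/2)^d$; $B=\{t\in\mathbb{R}^d:|t|\le 1\}$ is the Euclidean unit ball, $|B|$ its volume, and $0<r<1/2$ is a fixed radius. For $t\in\mathbb{T}^d$, the set $rB-t$ is regarded as a subset of $\mathbb{T}^d$ (so $\chi_{rB-t}(v)=1$ if $v+t\in rB$ modulo $\mathbb{Z}^d$, and $0$ otherwise). A ball of radius $\varepsilon$ in $\mathbb{T}^d$ is the image of a Euclidean ball of radius $\varepsilon$ in $\mathbb{R}^d$. For a positive integer $M$ put $N=M^d$ and let $T_N=\{t_j\}_{j=1}^N=\frac1M\mathbb{Z}^d\cap Q$. Given a probability measure $\mu$ on $\mathbb{T}^d$, let $\mu_j$ ($j=1,\dots,N$) be the translated measure defined by $\int_{\mathbb{T}^d} g(t)\,d\mu_j(t)=\int_{\mathbb{T}^d} g(t-t_j)\,d\mu(t)$ for every continuous $g$ on $\mathbb{T}^d$.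 For points $V_N=\{v_1,\dots,v_N\}$ in $\mathbb{T}^d$ (repetitions counted) define the discrepancy function $$D_{V_N}(t)=\sum_{j=1}^N\chi_{rB-t}(v_j)-Nr^d|B|,\qquad t\in\mathbb{T}^d,$$ and define the generalized discrepancy $$D_\mu(N)=\left\{\int_{\mathbb{T}^d}\cdots\int_{\mathbb{T}^d}\int_{\mathbb{T}^d}D_{V_N}^2(t)\,dt\,d\mu_1(v_1)\cdots d\mu_N(v_N)\right\}^{1/2}.$$ In $D_{\mu_M}(N)$ this definition is applied with $\mu$ equal to the $M$-th measure of the sequence and $N=M^d$ (the subscript $M$ indexes the sequence and does not denote a translate). *)

theory Defs
  imports "HOL-Probability.Probability"
begin

(* The torus R^d/Z^d is represented by its fundamental cube Q; d = CARD('d). The projection of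
   R^d onto the torus becomes the reduction map torus_red onto Q. Its restriction to Q is a Borel
   isomorphism onto the quotient, so that Borel sets and Haar measure of the torus are those of Q,
   whereas the topology of the torus is not the subspace topology of Q. *)

definition int_lattice :: "(real ^ 'd) set" where
  "int_lattice = {k. \<forall>i. k $ i \<in> \<int>}"

definition torus_cube :: "(real ^ 'd) set" where
  "torus_cube = {x. \<forall>i. - 1 / 2 \<le> x $ i \<and> x $ i < 1 / 2}"

definition torus_red :: "real ^ 'd \<Rightarrow> real ^ 'd" where
  "torus_red x = (\<chi> i. x $ i - of_int \<lfloor>x $ i + 1 / 2\<rfloor>)"

definition torus_borel :: "(real ^ 'd) measure" where
  "torus_borel = restrict_space borel torus_cube"

definition torus_haar :: "(real ^ 'd) measure" where
  "torus_haar = restrict_space lborel torus_cube"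

(* Images of open Euclidean balls form a neighbourhood base of the quotient topology. *)
definition torus_support :: "(real ^ 'd) measure \<Rightarrow> (real ^ 'd) set" where
  "torus_support \<mu> = {x \<in> torus_cube. \<forall>e>0. measure \<mu> (torus_red ` ball x e) > 0}"

definition torus_grid :: "nat \<Rightarrow> (real ^ 'd) set" where
  "torus_grid M = (\<lambda>k. (1 / real M) *\<^sub>R k) ` int_lattice \<inter> torus_cube"

definition torus_translate :: "(real ^ 'd) measure \<Rightarrow> real ^ 'd \<Rightarrow> (real ^ 'd) measure" where
  "torus_translate \<mu> s = distr \<mu> torus_borel (\<lambda>t. torus_red (t - s))"

(* The set rB - t, viewed in the torus. *)
definition torus_shifted_ball :: "real \<Rightarrow> real ^ 'd \<Rightarrow> (real ^ 'd) set" where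
  "torus_shifted_ball r t =
     {v \<in> torus_cube. \<exists>k\<in>int_lattice. v + t - k \<in> (\<lambda>x. r *\<^sub>R x) ` cball 0 1}"

(* The points form a family over a finite index set J, with N = card J. *)
definition discrepancy :: "real \<Rightarrow> 'j set \<Rightarrow> ('j \<Rightarrow> real ^ 'd) \<Rightarrow> real ^ 'd \<Rightarrow> real" where
  "discrepancy r J v t =
     (\<Sum>j\<in>J. indicat_real (torus_shifted_ball r t) (v j))
       - real (card J) * r ^ CARD('d) * measure lborel (cball (0 :: real ^ 'd) 1)"

(* The grid points themselves serve as indices: the point with index s is distributed according
   to the translate of the measure by s. See card_torus_grid for N = M ^ d. *)
definition gen_discrepancy :: "real \<Rightarrow> (real ^ 'd) measure \<Rightarrow> nat \<Rightarrow> real" where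
  "gen_discrepancy r \<mu> M =
     sqrt (\<integral>v. (\<integral>t. (discrepancy r (torus_grid M) v t)\<^sup>2 \<partial>torus_haar)
             \<partial>(PiM (torus_grid M) (torus_translate \<mu>)))"


lemma torus_red_in_cube [simp]: "torus_red x \<in> torus_cube"
  unfolding torus_red_def torus_cube_def by simp linarith

lemma torus_red_id:
  assumes "x \<in> torus_cube"
  shows "torus_red x = x"
proof -
  have "\<lfloor>x $ i + 1 / 2\<rfloor> = 0" for i
  proof (rule floor_unique)
    have "- 1 / 2 \<le> x $ i" "x $ i < 1 / 2" using assms by (auto simp: torus_cube_def)
    then show "of_int 0 \<le> x $ i + 1 / 2" "x $ i + 1 / 2 < of_int 0 + 1" by linarith+
  qed
  then show ?thesis by (simp add: torus_red_def vec_eq_iff)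
qed

lemma diff_torus_red_in_int_lattice: "x - torus_red x \<in> int_lattice"
  by (simp add: torus_red_def int_lattice_def)

lemma torus_red_add_int_lattice:
  assumes "k \<in> int_lattice"
  shows "torus_red (x + k) = torus_red x"
proof -
  have "(x + k) $ i - of_int \<lfloor>(x + k) $ i + 1/2\<rfloor> = x $ i - of_int \<lfloor>x $ i + 1/2\<rfloor>" for i
  proof -
    obtain z where "k $ i = of_int z" using assms by (auto simp: int_lattice_def Ints_def)
    moreover have "\<lfloor>x $ i + of_int z + 1/2\<rfloor> = \<lfloor>x $ i + 1/2\<rfloor> + z"
      by (metis add.assoc add.commute floor_add_int)
    ultimately show ?thesis by simp
  qed
  then show ?thesis by (simp add: torus_red_def vec_eq_iff)
qed

lemma card_torus_grid:
  assumes "M > 0"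
  shows "card (torus_grid M :: (real ^ 'd) set) = M ^ CARD('d)"
proof -
  define S where "S = {\<lceil>- real M / 2\<rceil> ..< \<lceil>real M / 2\<rceil>}"
  have S: "z \<in> S \<longleftrightarrow> - 1/2 \<le> of_int z / real M \<and> of_int z / real M < 1/2" for z
    using assms by (auto simp: S_def ceiling_le_iff less_ceiling_iff field_simps)
  have "\<lceil>real M / 2\<rceil> - \<lceil>- real M / 2\<rceil> = int M"
  proof (cases "even M")
    case True
    then obtain k where k: "M = 2 * k" by blast
    have "\<lceil>real M / 2\<rceil> = int k" "\<lceil>- real M / 2\<rceil> = - int k"
      by (auto simp: k ceiling_eq_iff)
    then show ?thesis using k by simp
  next
    case False
    then obtain k where k: "M = 2 * k + 1" by (rule oddE)
    have "\<lceil>real M / 2\<rceil> = int k + 1" "\<lceil>- real M / 2\<rceil> = - int k"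
      by (auto simp: k ceiling_eq_iff field_simps)
    then show ?thesis using k by simp
  qed
  then have cardS: "card S = M" by (simp add: S_def)
  have fin: "finite S" by (simp add: S_def)
  define f :: "('d \<Rightarrow> int) \<Rightarrow> real ^ 'd" where "f = (\<lambda>z. \<chi> i. of_int (z i) / real M)"
  have "torus_grid M = f ` (PiE UNIV (\<lambda>_. S))"
  proof (intro equalityI subsetI)
    fix x :: "real ^ 'd" assume "x \<in> torus_grid M"
    then obtain k where k: "k \<in> int_lattice" "x = (1 / real M) *\<^sub>R k" "x \<in> torus_cube"
      by (auto simp: torus_grid_def)
    define z where "z i = \<lfloor>k $ i\<rfloor>" for i
    have z: "k $ i = of_int (z i)" for i
    proof -
      have "k $ i \<in> \<int>" using k(1) by (simp add: int_lattice_def)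
      then show ?thesis unfolding z_def by (elim Ints_cases) simp
    qed
    have "x = f z" using k z by (simp add: f_def vec_eq_iff)
    moreover have "z \<in> PiE UNIV (\<lambda>_. S)"
      using k z by (auto simp: S torus_cube_def)
    ultimately show "x \<in> f ` (PiE UNIV (\<lambda>_. S))" by blast
  next
    fix x assume "x \<in> f ` (PiE UNIV (\<lambda>_. S))"
    then obtain z where z: "x = f z" "\<And>i. z i \<in> S" by auto
    have "x = (1 / real M) *\<^sub>R (\<chi> i. of_int (z i))" using z by (simp add: f_def vec_eq_iff)
    moreover have "(\<chi> i. of_int (z i)) \<in> (int_lattice :: (real ^ 'd) set)"
      by (simp add: int_lattice_def)
    moreover have "x \<in> torus_cube" using z S by (simp add: f_def torus_cube_def)
    ultimately show "x \<in> torus_grid M" unfolding torus_grid_def by blast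
  qed
  moreover have "inj f" using assms by (auto simp: inj_on_def f_def vec_eq_iff fun_eq_iff)
  ultimately have "card (torus_grid M :: (real ^ 'd) set) = card (PiE (UNIV :: 'd set) (\<lambda>_. S))"
    by (simp add: card_image inj_on_subset)
  also have "\<dots> = M ^ CARD('d)" by (simp add: card_PiE cardS)
  finally show ?thesis .
qed

lemma space_torus_borel [simp]: "space torus_borel = torus_cube"
  by (simp add: torus_borel_def space_restrict_space)

lemma torus_cube_borel [measurable]: "torus_cube \<in> sets borel"
  unfolding torus_cube_def by measurable

lemma torus_red_borel [measurable]: "torus_red \<in> borel \<rightarrow>\<^sub>M borel"
proof (rule borel_measurable_euclidean_space[THEN iffD2], safe)
  fix b :: "real ^ 'a" assume "b \<in> Basis"
  then obtain i where b: "b = axis i 1" by (auto simp: Basis_vec_def)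
  show "(\<lambda>x. torus_red x \<bullet> b) \<in> borel_measurable borel"
    by (simp add: b inner_axis torus_red_def)
qed

lemma torus_red_measurable [measurable]: "torus_red \<in> borel \<rightarrow>\<^sub>M torus_borel"
  unfolding torus_borel_def by (rule measurable_restrict_space2) auto

lemma torus_translate_measurable:
  assumes "sets \<mu> = sets torus_borel"
  shows "(\<lambda>t. torus_red (t - s)) \<in> \<mu> \<rightarrow>\<^sub>M torus_borel"
proof -
  have "(\<lambda>t. torus_red (t - s)) \<in> torus_borel \<rightarrow>\<^sub>M torus_borel"
    unfolding torus_borel_def
    by (intro measurable_restrict_space1 measurable_restrict_space2) auto
  then show ?thesis using assms measurable_cong_sets by blast
qed

(* The defining property of the translates; continuous functions on the torus are the periodic
   continuous functions on R^d. *)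
lemma integral_torus_translate:
  fixes g :: "real ^ 'd \<Rightarrow> real"
  assumes "sets \<mu> = sets torus_borel" and "continuous_on UNIV g"
    and per: "\<And>x k. k \<in> int_lattice \<Longrightarrow> g (x + k) = g x"
  shows "(\<integral>t. g t \<partial>torus_translate \<mu> s) = (\<integral>t. g (t - s) \<partial>\<mu>)"
proof -
  have "g \<in> borel_measurable borel" by (rule borel_measurable_continuous_onI) fact
  then have "g \<in> borel_measurable torus_borel"
    unfolding torus_borel_def by (rule measurable_restrict_space1)
  then have "(\<integral>t. g t \<partial>torus_translate \<mu> s) = (\<integral>t. g (torus_red (t - s)) \<partial>\<mu>)"
    unfolding torus_translate_def
    by (intro integral_distr torus_translate_measurable assms)
  moreover have "g (torus_red x) = g x" for x
    using per[OF diff_torus_red_in_int_lattice, of "torus_red x" x] by simp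
  ultimately show ?thesis by simp
qed

lemma torus_red_image_eq:
  "torus_red ` A = {y \<in> torus_cube. \<exists>k\<in>int_lattice. y + k \<in> A}"
proof (intro equalityI subsetI)
  fix y assume "y \<in> torus_red ` A"
  then obtain x where x: "x \<in> A" "y = torus_red x" by blast
  have "\<exists>k\<in>int_lattice. torus_red x + k \<in> A"
    by (rule bexI[OF _ diff_torus_red_in_int_lattice[of x]]) (simp add: x(1))
  then show "y \<in> {y \<in> torus_cube. \<exists>k\<in>int_lattice. y + k \<in> A}"
    by (simp add: x(2))
next
  fix y assume "y \<in> {y \<in> torus_cube. \<exists>k\<in>int_lattice. y + k \<in> A}"
  then obtain k where k: "y \<in> torus_cube" "k \<in> int_lattice" "y + k \<in> A" by blast
  have "y = torus_red (y + k)"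
    by (simp only: torus_red_add_int_lattice[OF k(2)] torus_red_id[OF k(1)])
  with k(3) show "y \<in> torus_red ` A" by (rule rev_image_eqI)
qed

lemma countable_int_lattice: "countable (int_lattice :: (real ^ 'd) set)"
proof -
  have "int_lattice \<subseteq> (\<lambda>z. \<chi> i. of_int (z i)) ` (PiE (UNIV :: 'd set) (\<lambda>_. UNIV :: int set))"
  proof
    fix k :: "real ^ 'd" assume "k \<in> int_lattice"
    then have "k = (\<chi> i. of_int \<lfloor>k $ i\<rfloor>)" by (simp add: int_lattice_def vec_eq_iff)
    then show "k \<in> (\<lambda>z. \<chi> i. of_int (z i)) ` (PiE (UNIV :: 'd set) (\<lambda>_. UNIV :: int set))"
      by (intro image_eqI[where x = "\<lambda>i. \<lfloor>k $ i\<rfloor>"]) auto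
  qed
  then show ?thesis
    by (rule countable_subset) (intro countable_image countable_PiE, auto)
qed

lemma torus_red_image_sets:
  assumes [measurable]: "A \<in> sets borel"
  shows "torus_red ` A \<in> sets torus_borel"
proof -
  have "{y. \<exists>k\<in>int_lattice. y + k \<in> A} = (\<Union>k\<in>int_lattice. (\<lambda>y. y + k) -` A \<inter> space borel)"
    by auto
  also have "\<dots> \<in> sets borel"
  proof (rule sets.countable_UN''[OF countable_int_lattice])
    show "(\<lambda>y. y + k) -` A \<inter> space borel \<in> sets borel" for k
      by (rule measurable_sets[OF _ assms]) simp
  qed
  finally have "torus_cube \<inter> {y. \<exists>k\<in>int_lattice. y + k \<in> A} \<in> sets borel" by auto
  moreover have "torus_red ` A = torus_cube \<inter> {y. \<exists>k\<in>int_lattice. y + k \<in> A}"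
    by (auto simp: torus_red_image_eq)
  ultimately show ?thesis
    unfolding torus_borel_def by (subst sets_restrict_space_iff) auto
qed

lemma prob_space_torus_haar: "prob_space (torus_haar :: (real ^ 'd) measure)"
proof -
  define a b :: "real ^ 'd" where "a = (\<chi> i. - 1 / 2)" and "b = (\<chi> i. 1 / 2)"
  have ab: "a \<bullet> i \<le> b \<bullet> i" "(b - a) \<bullet> i = 1" if "i \<in> Basis" for i
    using that by (auto simp: a_def b_def Basis_vec_def inner_axis)
  have "emeasure lborel (cbox a b) = 1" "emeasure lborel (box a b) = 1"
    using ab by (simp_all add: emeasure_lborel_cbox emeasure_lborel_box)
  moreover have "box a b \<subseteq> torus_cube" "torus_cube \<subseteq> cbox a b"
    by (auto simp: a_def b_def torus_cube_def mem_box_cart less_imp_le)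
  ultimately have "emeasure lborel (torus_cube :: (real ^ 'd) set) = 1"
    using emeasure_mono[of "box a b" torus_cube lborel] emeasure_mono[of torus_cube "cbox a b" lborel]
    by (simp add: antisym)
  then show ?thesis
    unfolding torus_haar_def
    by (intro prob_spaceI) (simp add: space_restrict_space emeasure_restrict_space)
qed

(* The Bochner integrals defining the generalized discrepancy are not degenerate. *)
lemma discrepancy_integrable:
  fixes \<mu> :: "(real ^ 'd) measure"
  assumes "prob_space \<mu>" and sets_\<mu>: "sets \<mu> = sets torus_borel" and "finite J" and "r > 0"
  shows "v \<in> space (PiM J (torus_translate \<mu>)) \<Longrightarrow>
           integrable torus_haar (\<lambda>t. (discrepancy r J v t)\<^sup>2)"
    and "integrable (PiM J (torus_translate \<mu>)) (\<lambda>v. \<integral>t. (discrepancy r J v t)\<^sup>2 \<partial>torus_haar)"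
proof -
  let ?P = "PiM J (torus_translate \<mu>)"
  interpret H: prob_space "torus_haar :: (real ^ 'd) measure" by (rule prob_space_torus_haar)
  interpret \<mu>: prob_space \<mu> by fact
  have "prob_space (torus_translate \<mu> s)" for s
    unfolding torus_translate_def
    by (rule \<mu>.prob_space_distr) (rule torus_translate_measurable[OF sets_\<mu>])
  then interpret P: prob_space ?P by (intro prob_space_PiM)
  define U where "U = (\<Union>k\<in>int_lattice. (\<lambda>x. x - k) -` cball (0 :: real ^ 'd) r \<inter> space borel)"
  have U: "U \<in> sets borel"
    unfolding U_def
  proof (rule sets.countable_UN''[OF countable_int_lattice])
    show "(\<lambda>x. x - k) -` cball 0 r \<inter> space borel \<in> sets borel" for k :: "real ^ 'd"
      by (rule measurable_sets[where A = borel]) simp_all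
  qed
  have scale: "(\<lambda>x. r *\<^sub>R x) ` cball 0 1 = cball (0 :: real ^ 'd) r"
    using cball_scale[of r "0 :: real ^ 'd" 1] \<open>r > 0\<close> by simp
  have ind: "indicat_real (torus_shifted_ball r t) w = indicat_real U (w + t)"
    if "w \<in> torus_cube" for w t
  proof -
    have "w \<in> torus_shifted_ball r t \<longleftrightarrow> w + t \<in> U"
      unfolding torus_shifted_ball_def U_def scale
      by (simp only: that mem_Collect_eq UN_iff space_borel Int_UNIV_right vimage_eq simp_thms)
    then show ?thesis by (simp only: indicator_def)
  qed
  have cube: "v j \<in> torus_cube" if "v \<in> space ?P" "j \<in> J" for v j
    using that by (auto simp: space_PiM torus_translate_def PiE_iff)
  have id: "(\<lambda>x. x) \<in> torus_borel \<rightarrow>\<^sub>M borel" "(\<lambda>x. x) \<in> torus_haar \<rightarrow>\<^sub>M borel"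
    unfolding torus_borel_def torus_haar_def by (auto intro!: measurable_restrict_space1)
  have coord: "(\<lambda>x. fst x j) \<in> (?P \<Otimes>\<^sub>M torus_haar) \<rightarrow>\<^sub>M borel" if "j \<in> J" for j
  proof -
    have "(\<lambda>v. v j) \<in> ?P \<rightarrow>\<^sub>M torus_translate \<mu> j" using that by (rule measurable_component_singleton)
    then have "(\<lambda>v. v j) \<in> ?P \<rightarrow>\<^sub>M torus_borel" by (simp add: torus_translate_def)
    from measurable_compose[OF this id(1)] have "(\<lambda>v. v j) \<in> ?P \<rightarrow>\<^sub>M borel" .
    then show ?thesis by (rule measurable_compose[OF measurable_fst])
  qed
  have tm: "snd \<in> (?P \<Otimes>\<^sub>M torus_haar) \<rightarrow>\<^sub>M borel"
    by (rule measurable_compose[OF measurable_snd id(2)])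
  have meas: "(\<lambda>(v, t). (discrepancy r J v t)\<^sup>2) \<in> borel_measurable (?P \<Otimes>\<^sub>M torus_haar)"
  proof -
    have "(\<lambda>x. indicat_real U (fst x j + snd x)) \<in> borel_measurable (?P \<Otimes>\<^sub>M torus_haar)"
      if "j \<in> J" for j
      by (rule measurable_compose[OF borel_measurable_add[OF coord[OF that] tm]
            borel_measurable_indicator[OF U]])
    then have "(\<lambda>x. ((\<Sum>j\<in>J. indicat_real U (fst x j + snd x))
            - real (card J) * r ^ CARD('d) * measure lborel (cball (0 :: real ^ 'd) 1))\<^sup>2)
          \<in> borel_measurable (?P \<Otimes>\<^sub>M torus_haar)"
      by (intro borel_measurable_power borel_measurable_diff borel_measurable_sum
          borel_measurable_const)
    moreover have "(\<Sum>j\<in>J. indicat_real U (fst x j + snd x))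
        = (\<Sum>j\<in>J. indicat_real (torus_shifted_ball r (snd x)) (fst x j))"
      if "x \<in> space (?P \<Otimes>\<^sub>M torus_haar)" for x
    proof (rule sum.cong[OF refl])
      fix j assume "j \<in> J"
      moreover have "fst x \<in> space ?P"
        using that unfolding space_pair_measure by (rule mem_Times_iff[THEN iffD1, THEN conjunct1])
      ultimately show "indicat_real U (fst x j + snd x) =
          indicat_real (torus_shifted_ball r (snd x)) (fst x j)"
        by (intro ind[symmetric] cube)
    qed
    ultimately show ?thesis
      unfolding discrepancy_def split_beta by (simp only: cong: measurable_cong)
  qed
  define K where
    "K = (real (card J) + real (card J) * r ^ CARD('d) * measure lborel (cball (0 :: real ^ 'd) 1))\<^sup>2"
  have bound: "(discrepancy r J v t)\<^sup>2 \<le> K" for v and t :: "real ^ 'd"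
  proof -
    have "(\<Sum>j\<in>J. indicat_real (torus_shifted_ball r t) (v j)) \<le> (\<Sum>j\<in>J. 1)"
      by (intro sum_mono) (auto simp: indicator_def)
    moreover have "0 \<le> (\<Sum>j\<in>J. indicat_real (torus_shifted_ball r t) (v j))"
      by (intro sum_nonneg) auto
    moreover have "0 \<le> real (card J) * r ^ CARD('d) * measure lborel (cball (0 :: real ^ 'd) 1)"
      using \<open>r > 0\<close> by simp
    ultimately have "\<bar>discrepancy r J v t\<bar>
      \<le> real (card J) + real (card J) * r ^ CARD('d) * measure lborel (cball (0 :: real ^ 'd) 1)"
      unfolding discrepancy_def by simp
    from power_mono[OF this abs_ge_zero, of 2] show ?thesis by (simp only: K_def power2_abs)
  qed
  show int: "integrable torus_haar (\<lambda>t. (discrepancy r J v t)\<^sup>2)" if "v \<in> space ?P" for v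
  proof (rule H.integrable_const_bound[where B = K])
    show "AE t in torus_haar. norm ((discrepancy r J v t)\<^sup>2) \<le> K"
      by (rule AE_I2) (simp only: real_norm_def abs_power2 bound)
    show "(\<lambda>t. (discrepancy r J v t)\<^sup>2) \<in> borel_measurable torus_haar"
      using measurable_Pair2[OF meas that] by (simp only: prod.case)
  qed
  show "integrable ?P (\<lambda>v. \<integral>t. (discrepancy r J v t)\<^sup>2 \<partial>torus_haar)"
  proof (rule P.integrable_const_bound[where B = K])
    show "AE v in ?P. norm (\<integral>t. (discrepancy r J v t)\<^sup>2 \<partial>torus_haar) \<le> K"
    proof (rule AE_I2)
      fix v assume v: "v \<in> space ?P"
      have "0 \<le> (\<integral>t. (discrepancy r J v t)\<^sup>2 \<partial>torus_haar)"
        by (rule integral_nonneg_AE) (rule AE_I2, rule zero_le_power2)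
      moreover have "(\<integral>t. (discrepancy r J v t)\<^sup>2 \<partial>torus_haar) \<le> K"
        by (rule H.integral_le_const[OF int[OF v]]) (rule AE_I2, rule bound)
      ultimately show "norm (\<integral>t. (discrepancy r J v t)\<^sup>2 \<partial>torus_haar) \<le> K"
        by (simp only: real_norm_def abs_of_nonneg)
    qed
    show "(\<lambda>v. \<integral>t. (discrepancy r J v t)\<^sup>2 \<partial>torus_haar) \<in> borel_measurable ?P"
      by (rule H.borel_measurable_lebesgue_integral) (rule meas)
  qed
qed

end

theory Submission
  imports Defs
begin

text \<open>
Let $f$ be the periodic indicator function of the ball of radius $r$, let $\beta$ be its mean and
$A$ the autocorrelation of $f - \beta$. Integrating $D^2$ over $t$ and expanding the square gives
the double sum of $A(v_{s'} - v_s)$ over all pairs of grid points $s, s'$. For $s \neq s'$ the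
points $v_s, v_{s'}$ are independent, so the expectation of such a term is the average of
$A(y - s' - (x - s))$ over independent $x, y$ distributed according to $\mu$. For $s = s'$ the term
is $A(0)$ instead of the average of $A(y - x)$. Hence the expectation of $D^2$ splits in two:

  \<^item> Replacing the diagonal terms costs $N$ times the average of $A(0) - A(y - x)$. This
    difference is half the measure of the symmetric difference of the ball and its translate by
    $y - x$, which is at most a multiple of $|y - x| = O(\varepsilon_M)$. So the cost is
    $O(N / M) = O(M^{d-1})$.
  \<^item> The completed double sum is an average of values of the autocorrelation of
    $G(x) = \sum_s (f(x - s) - \beta)$, the discrepancy of the unperturbed grid, and is therefore
    at most $\int G^2$.

Both facts together are the lemma gen_discrepancy_square_le.

It remains to prove $\int G^2 = O(M^{d-1})$, which is grid_discrepancy_L2. The Fourier coefficients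
of $G$ vanish outside $M \mathbb{Z}^d$ (and at $0$), and equal $N \hat f(k)$ at the other points of
$M \mathbb{Z}^d$. Since $|\hat f(k)|^2 = O(|k|^{-d-1})$, Parseval bounds $\int G^2$ by
$N^2 \sum_{m \neq 0} C |M m|^{-d-1} = O(N^2 M^{-d-1}) = O(M^{d-1})$.

The decay of $\hat f$ rests on the curvature of the sphere. It is derived from an
ordinary differential equation rather than from asymptotics of Bessel functions: for a unit vector
$\theta$, the function $u(t) = \int_{|x| \le r} \cos(t \theta \cdot x + \psi) \, dx$ satisfies
$u'' + \frac{d+1}{t} u' + r^2 u = 0$ (ball_plane_wave_bessel). This follows by integrating
directional derivatives of functions $(r^2 - |x|^2)_+ \, g(x)$, which integrate to zero. An energy
estimate for the equation then yields $u(t)^2 = O(t^{-d-1})$, uniformly in $\theta$ and $\psi$.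

Parseval's relation is needed only as an upper bound for $\int G^2$ (parseval_inequality). Testing
the autocorrelation against Fejer kernels reduces it to the orthogonality of the characters and to
the continuity of translation in $L^2$, which for $G$ comes from the same estimate of symmetric
differences.
\<close>

section \<open>Integrals of directional derivatives\<close>

lemma AE_lborel_off_sphere:
  "AE x in (lborel :: 'a::euclidean_space measure). norm x \<noteq> r"
proof -
  have "sphere 0 r \<in> null_sets (lborel :: 'a measure)"
    using negligible_sphere[of "0 :: 'a" r]
    by (auto simp: null_sets_completion_iff negligible_iff_null_sets)
  then show ?thesis
    by (auto simp: AE_iff_null_sets[symmetric] elim!: AE_mp[rotated] dest!: AE_not_in)
qed

lemma integral_lborel_translate:
  fixes f :: "'a::euclidean_space \<Rightarrow> real"
  assumes [measurable]: "f \<in> borel_measurable borel"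
  shows "(\<integral>x. f (x + c) \<partial>lborel) = (\<integral>x. f x \<partial>lborel)"
proof -
  have "(\<integral>x. f x \<partial>lborel) = (\<integral>x. f x \<partial>distr lborel borel ((+) c))"
    by (simp add: lborel_distr_plus)
  also have "\<dots> = (\<integral>x. f (x + c) \<partial>lborel)"
    by (subst integral_distr) (simp_all add: add.commute)
  finally show ?thesis by simp
qed

text \<open>
By translation invariance every difference quotient of $f$ in direction $v$ has integral zero. The
Lipschitz bound dominates these quotients, so the integral of the limit is zero as well.
\<close>

lemma integral_directional_derivative_zero:
  fixes f D :: "'a::euclidean_space \<Rightarrow> real"
  assumes lip: "\<And>x y. norm y \<le> norm v \<Longrightarrow> \<bar>f (x + y) - f x\<bar> \<le> L * norm y"
    and cont: "continuous_on UNIV f"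
    and supp: "\<And>x. norm x > R \<Longrightarrow> f x = 0"
    and [measurable]: "D \<in> borel_measurable borel"
    and der: "AE x in lborel. ((\<lambda>t. f (x + t *\<^sub>R v)) has_real_derivative D x) (at 0)"
  shows "(\<integral>x. D x \<partial>lborel) = 0"
proof -
  define q where "q n x = (f (x + (1 / real (Suc n)) *\<^sub>R v) - f x) * real (Suc n)" for n x
  have [measurable]: "f \<in> borel_measurable borel"
    by (rule borel_measurable_continuous_onI[OF cont])
  have intf: "integrable lborel f"
  proof -
    have "integrable lborel (\<lambda>x. indicator (cball 0 R) x *\<^sub>R f x)"
      by (rule borel_integrable_compact) (auto intro: continuous_on_subset[OF cont])
    also have "(\<lambda>x. indicator (cball 0 R) x *\<^sub>R f x) = f"
      using supp by (auto simp: indicator_def fun_eq_iff)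
    finally show ?thesis .
  qed
  have zero: "(\<integral>x. q n x \<partial>lborel) = 0" for n
  proof -
    have "integrable (distr lborel borel ((+) ((1 / real (Suc n)) *\<^sub>R v))) f"
      using intf by (simp add: lborel_distr_plus)
    then have "integrable lborel (\<lambda>x. f (x + (1 / real (Suc n)) *\<^sub>R v))"
      by (subst (asm) integrable_distr_eq) (simp_all add: add.commute)
    then show ?thesis
      unfolding q_def using intf integral_lborel_translate[of f "(1 / real (Suc n)) *\<^sub>R v"] by simp
  qed
  have "(\<lambda>n. \<integral>x. q n x \<partial>lborel) \<longlonglongrightarrow> (\<integral>x. D x \<partial>lborel)"
  proof (rule integral_dominated_convergence[where w = "\<lambda>x. indicator (cball 0 (R + norm v)) x *\<^sub>R (\<bar>L\<bar> * norm v)"])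
    show "integrable lborel (\<lambda>x :: 'a. indicator (cball 0 (R + norm v)) x *\<^sub>R (\<bar>L\<bar> * norm v))"
      by (rule borel_integrable_compact) auto
    show "q n \<in> borel_measurable lborel" for n unfolding q_def by measurable
    show "AE x in lborel. norm (q n x) \<le> indicator (cball 0 (R + norm v)) x *\<^sub>R (\<bar>L\<bar> * norm v)" for n
    proof (rule AE_I2)
      fix x
      define y where "y = (1 / real (Suc n)) *\<^sub>R v"
      have y: "norm y = norm v / real (Suc n)" by (simp add: y_def)
      have le: "norm v / real (Suc n) \<le> norm v" by (simp add: field_simps)
      show "norm (q n x) \<le> indicator (cball 0 (R + norm v)) x *\<^sub>R (\<bar>L\<bar> * norm v)"
      proof (cases "norm x \<le> R + norm v")
        case True
        have "\<bar>f (x + y) - f x\<bar> \<le> L * norm y" by (rule lip) (simp only: y le)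
        also have "\<dots> \<le> \<bar>L\<bar> * (norm v / real (Suc n))" unfolding y
          by (intro mult_right_mono) auto
        finally have "\<bar>f (x + y) - f x\<bar> * real (Suc n) \<le> \<bar>L\<bar> * (norm v / real (Suc n)) * real (Suc n)"
          by (intro mult_right_mono) auto
        then show ?thesis using True by (simp add: q_def y_def abs_mult indicator_def)
      next
        case False
        have "norm x \<le> norm (x + y) + norm y" using norm_triangle_ineq4[of "x + y" y] by simp
        then have "norm (x + y) > R" "norm x > R"
          using False y le norm_ge_zero[of v] by linarith+
        then have "q n x = 0" unfolding q_def y_def[symmetric] by (simp add: supp)
        then show ?thesis using False by simp
      qed
    qed
    have h0: "filterlim (\<lambda>n. 1 / real (Suc n)) (at 0) sequentially"
      unfolding filterlim_at using LIMSEQ_Suc[OF lim_1_over_n] by (auto intro!: eventuallyI)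
    show "AE x in lborel. (\<lambda>n. q n x) \<longlonglongrightarrow> D x"
      using der
    proof (eventually_elim)
      case (elim x)
      then have "(\<lambda>h. (f (x + (0 + h) *\<^sub>R v) - f (x + 0 *\<^sub>R v)) / h) \<midarrow>0\<rightarrow> D x"
        by (simp only: DERIV_def)
      from filterlim_compose[OF this h0] show ?case
        by (simp add: q_def)
    qed
  qed measurable
  then show ?thesis using zero by (simp add: LIMSEQ_const_iff)
qed

text \<open>
The weight $r^2 - |x|^2$ vanishes on the sphere, so $(r^2 - |x|^2)_+ \, g(x)$ is Lipschitz although
it is cut off at the sphere. The lemma is thus the divergence theorem on a ball without a boundary
term.
\<close>

lemma integral_ball_weighted_derivative:
  fixes g g' :: "'a::euclidean_space \<Rightarrow> real"
  assumes lip: "\<And>x y. norm x \<le> r + norm v \<Longrightarrow> norm y \<le> r + norm v \<Longrightarrow> \<bar>g x - g y\<bar> \<le> K * norm (x - y)"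
    and cont: "continuous_on UNIV g"
    and r: "r > 0"
    and [measurable]: "g' \<in> borel_measurable borel"
    and der: "\<And>x. ((\<lambda>t. g (x + t *\<^sub>R v)) has_real_derivative g' x) (at 0)"
  shows "(\<integral>x. (r\<^sup>2 - (norm x)\<^sup>2) * g' x - 2 * (x \<bullet> v) * g x \<partial>restrict_space lborel (cball 0 r)) = 0"
proof -
  define u where "u x = max 0 (r\<^sup>2 - (norm x)\<^sup>2)" for x :: 'a
  define D where "D x = indicator (cball 0 r) x *\<^sub>R ((r\<^sup>2 - (norm x)\<^sup>2) * g' x - 2 * (x \<bullet> v) * g x)" for x
  define R where "R = r + norm v"
  define A where "A = \<bar>g 0\<bar> + \<bar>K\<bar> * R"
  have [measurable]: "g \<in> borel_measurable borel"
    by (rule borel_measurable_continuous_onI[OF cont])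
  have R: "R > 0" using r by (simp add: R_def add_pos_nonneg)
  have A: "\<bar>g x\<bar> \<le> A" if "norm x \<le> R" for x
  proof -
    have "\<bar>g x - g 0\<bar> \<le> K * norm (x - 0)" using that R by (intro lip) (auto simp: R_def)
    also have "\<dots> \<le> \<bar>K\<bar> * R" using that by (intro mult_mono) auto
    finally show ?thesis unfolding A_def by linarith
  qed
  have u0: "u x = 0" if "norm x \<ge> r" for x
    using power_mono[OF that, of 2] r by (simp add: u_def)
  have ule: "\<bar>u x\<bar> \<le> r\<^sup>2" for x by (simp add: u_def)
  have ulip: "\<bar>u x - u y\<bar> \<le> 2 * R * norm (x - y)" if "norm x \<le> R" "norm y \<le> R" for x y
  proof -
    have "\<bar>u x - u y\<bar> \<le> \<bar>(norm x)\<^sup>2 - (norm y)\<^sup>2\<bar>" by (simp add: u_def)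
    also have "\<dots> = (norm x + norm y) * \<bar>norm x - norm y\<bar>"
      by (simp add: power2_eq_square square_diff_square_factored abs_mult)
    also have "\<dots> \<le> (2 * R) * norm (x - y)"
      using that R by (intro mult_mono norm_triangle_ineq3) auto
    finally show ?thesis .
  qed
  have "(\<integral>x. D x \<partial>lborel) = 0"
  proof (rule integral_directional_derivative_zero[where f = "\<lambda>x. u x * g x" and R = r and L = "2 * R * A + r\<^sup>2 * \<bar>K\<bar>" and v = v])
    show "\<bar>u (x + y) * g (x + y) - u x * g x\<bar> \<le> (2 * R * A + r\<^sup>2 * \<bar>K\<bar>) * norm y"
      if y: "norm y \<le> norm v" for x y
    proof (cases "norm x \<le> R \<and> norm (x + y) \<le> R")
      case True
      have "u (x + y) * g (x + y) - u x * g x = (u (x + y) - u x) * g (x + y) + u x * (g (x + y) - g x)"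
        by (simp add: algebra_simps)
      also have "\<bar>\<dots>\<bar> \<le> \<bar>u (x + y) - u x\<bar> * \<bar>g (x + y)\<bar> + \<bar>u x\<bar> * \<bar>g (x + y) - g x\<bar>"
        by (metis abs_mult abs_triangle_ineq)
      also have "\<dots> \<le> (2 * R * norm (x + y - x)) * A + r\<^sup>2 * (\<bar>K\<bar> * norm (x + y - x))"
      proof (intro add_mono mult_mono ulip A ule)
        have "\<bar>g (x + y) - g x\<bar> \<le> K * norm (x + y - x)" using True by (intro lip) (auto simp: R_def)
        also have "\<dots> \<le> \<bar>K\<bar> * norm (x + y - x)" by (intro mult_right_mono) auto
        finally show "\<bar>g (x + y) - g x\<bar> \<le> \<bar>K\<bar> * norm (x + y - x)" .
      qed (use True R in auto)
      finally show ?thesis by (simp add: algebra_simps)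
    next
      case False
      have "norm x \<le> norm (x + y) + norm y" "norm (x + y) \<le> norm x + norm y"
        using norm_triangle_ineq4[of "x + y" y] norm_triangle_ineq[of x y] by simp_all
      then have "norm x \<ge> r" "norm (x + y) \<ge> r"
        using False y norm_ge_zero[of v] unfolding R_def by linarith+
      then have "u x = 0" "u (x + y) = 0" by (simp_all add: u0)
      moreover have "A \<ge> 0" using R by (simp add: A_def)
      ultimately show ?thesis using R by simp
    qed
    show "continuous_on UNIV (\<lambda>x. u x * g x)"
      unfolding u_def by (intro continuous_intros cont)
    show "u x * g x = 0" if "norm x > r" for x using u0[of x] that by simp
    have [measurable]: "cball (0 :: 'a) r \<in> sets borel" by (rule borel_closed) simp
    have [measurable]: "(\<lambda>x. x \<bullet> v) \<in> borel_measurable borel" "(\<lambda>x :: 'a. norm x) \<in> borel_measurable borel"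
      by (intro borel_measurable_continuous_onI continuous_intros)+
    show "D \<in> borel_measurable borel" unfolding D_def by measurable
    have small: "eventually (\<lambda>t. norm (x + t *\<^sub>R v) < r) (nhds 0)" if "norm x < r" for x
    proof -
      have "((\<lambda>t. norm (x + t *\<^sub>R v)) \<longlongrightarrow> norm (x + 0 *\<^sub>R v)) (nhds 0)"
        by (intro tendsto_intros filterlim_ident)
      then show ?thesis using that by (auto dest: order_tendstoD(2))
    qed
    have large: "eventually (\<lambda>t. norm (x + t *\<^sub>R v) > r) (nhds 0)" if "norm x > r" for x
    proof -
      have "((\<lambda>t. norm (x + t *\<^sub>R v)) \<longlongrightarrow> norm (x + 0 *\<^sub>R v)) (nhds 0)"
        by (intro tendsto_intros filterlim_ident)
      then show ?thesis using that by (auto dest: order_tendstoD(1))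
    qed
    show "AE x in lborel. ((\<lambda>t. u (x + t *\<^sub>R v) * g (x + t *\<^sub>R v)) has_real_derivative D x) (at 0)"
      using AE_lborel_off_sphere[of r]
    proof (eventually_elim)
      case (elim x)
      consider "norm x < r" | "norm x > r" using elim by linarith
      then show ?case
      proof cases
        case 1
        have sq: "(norm (x + t *\<^sub>R v))\<^sup>2 = (norm x)\<^sup>2 + 2 * t * (x \<bullet> v) + t\<^sup>2 * (norm v)\<^sup>2" for t
          unfolding power2_norm_eq_inner by (simp add: inner_simps power2_eq_square inner_commute)
        have "((\<lambda>t. (r\<^sup>2 - (norm (x + t *\<^sub>R v))\<^sup>2) * g (x + t *\<^sub>R v)) has_real_derivative
                 (- 2 * (x \<bullet> v)) * g (x + 0 *\<^sub>R v) + g' x * (r\<^sup>2 - (norm (x + 0 *\<^sub>R v))\<^sup>2)) (at 0)"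
          by (rule DERIV_mult[OF _ der]) (auto simp: sq intro!: derivative_eq_intros)
        moreover have "(- 2 * (x \<bullet> v)) * g (x + 0 *\<^sub>R v) + g' x * (r\<^sup>2 - (norm (x + 0 *\<^sub>R v))\<^sup>2) = D x"
          using 1 by (simp add: D_def algebra_simps)
        moreover have "eventually (\<lambda>t. u (x + t *\<^sub>R v) * g (x + t *\<^sub>R v) =
            (r\<^sup>2 - (norm (x + t *\<^sub>R v))\<^sup>2) * g (x + t *\<^sub>R v)) (nhds 0)"
          using small[OF 1]
        proof eventually_elim
          case (elim t)
          then have "(norm (x + t *\<^sub>R v))\<^sup>2 \<le> r\<^sup>2" by (intro power_mono) auto
          then show ?case by (simp add: u_def)
        qed
        ultimately show ?thesis by (subst DERIV_cong_ev) auto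
      next
        case 2
        have "((\<lambda>t. 0) has_real_derivative D x) (at 0)" using 2 by (simp add: D_def)
        moreover have "eventually (\<lambda>t. u (x + t *\<^sub>R v) * g (x + t *\<^sub>R v) = 0) (nhds 0)"
          using large[OF 2] by eventually_elim (simp add: u0)
        ultimately show ?thesis by (subst DERIV_cong_ev) auto
      qed
    qed
  qed
  then show ?thesis unfolding D_def by (subst integral_restrict_space) auto
qed

section \<open>Decay of solutions of a Bessel type equation\<close>

text \<open>
The equation is that of an oscillator with friction coefficient $n / t$, which makes the amplitude
decay like $t^{-n/2}$. The energy $t^n (a^2 u^2 + u'^2)$ itself is not monotone, because
the friction acts on $u'$ only. Adding the term $n t^{n-1} u u'$ averages its effect over
a period: the derivative of the corrected energy $E$ is only of order $t^{-2} E$, so that $E(t)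
e^{t_0/t}$ decreases once $t \ge t_0 = n / a$.
\<close>

lemma energy_decay:
  fixes u u' :: "real \<Rightarrow> real"
  assumes a: "a > 0" and n: "n > 0"
    and u: "\<And>t. t > 0 \<Longrightarrow> (u has_real_derivative u' t) (at t)"
    and u': "\<And>t. t > 0 \<Longrightarrow> (u' has_real_derivative - a\<^sup>2 * u t - (real n / t) * u' t) (at t)"
    and t: "t \<ge> real n / a"
  shows "(u t)\<^sup>2 * t ^ n \<le> 4 * exp 1 / a\<^sup>2 * ((real n / a) ^ n * ((a * u (real n / a))\<^sup>2 + (u' (real n / a))\<^sup>2))"
proof -
  define t0 where "t0 = real n / a"
  have t0: "t0 > 0" using a n by (simp add: t0_def)
  define Q where "Q s = (a * u s)\<^sup>2 + (u' s)\<^sup>2" for s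
  \<comment> \<open>The cross term cancels all terms of order $s^{n-1}$ in the derivative of $E$.\<close>
  define E where "E s = s ^ n * (Q s + real n * u s * u' s / s)" for s
  have uu': "\<bar>u s * u' s\<bar> \<le> Q s / (2 * a)" for s
  proof -
    have "2 * \<bar>(a * u s) * u' s\<bar> \<le> Q s"
      using zero_le_power2[of "\<bar>a * u s\<bar> - \<bar>u' s\<bar>"]
      by (simp add: Q_def power2_diff abs_mult power_mult_distrib)
    then show ?thesis using a by (simp add: abs_mult field_simps)
  qed
  have Q: "Q s \<ge> 0" for s by (simp add: Q_def)
  have cross: "\<bar>real n * u s * u' s / s\<bar> \<le> Q s / 2" if "s \<ge> t0" for s
  proof -
    have s: "s > 0" using that t0 by simp
    have "\<bar>real n * u s * u' s / s\<bar> = (real n / s) * \<bar>u s * u' s\<bar>" using s by (simp add: abs_mult)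
    also have "\<dots> \<le> a * (Q s / (2 * a))"
      using that s a n by (intro mult_mono uu') (auto simp: t0_def field_simps)
    finally show ?thesis using a by simp
  qed
  have E_lower: "s ^ n * Q s \<le> 2 * E s" and E_upper: "E s \<le> 2 * (s ^ n * Q s)" if "s \<ge> t0" for s
  proof -
    have s: "s > 0" using that t0 by simp
    have "Q s / 2 \<le> Q s + real n * u s * u' s / s" "Q s + real n * u s * u' s / s \<le> 2 * Q s"
      using cross[OF that] Q[of s] unfolding abs_le_iff by linarith+
    then have "s ^ n * (Q s / 2) \<le> E s" "E s \<le> s ^ n * (2 * Q s)"
      unfolding E_def using s by (auto intro!: mult_left_mono)
    then show "s ^ n * Q s \<le> 2 * E s" "E s \<le> 2 * (s ^ n * Q s)" by auto
  qed
  have E': "(E has_real_derivative - real n * (s ^ n / s\<^sup>2) * (u s * u' s)) (at s)" if "s > 0" for s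
  proof -
    obtain m where m: "n = Suc m" using n by (cases n) auto
    have "(E has_real_derivative
       real n * s ^ (n - 1) * (Q s + real n * u s * u' s / s) +
       s ^ n * ((2 * (a * u s) * (a * u' s) + 2 * u' s * (- a\<^sup>2 * u s - (real n / s) * u' s)) +
        ((real n * u' s * u' s + real n * u s * (- a\<^sup>2 * u s - (real n / s) * u' s)) * s - real n * u s * u' s) / (s * s))) (at s)"
      unfolding E_def Q_def using that
      by (auto intro!: derivative_eq_intros u u')
    moreover have "real n * s ^ (n - 1) * (Q s + real n * u s * u' s / s) +
       s ^ n * ((2 * (a * u s) * (a * u' s) + 2 * u' s * (- a\<^sup>2 * u s - (real n / s) * u' s)) +
        ((real n * u' s * u' s + real n * u s * (- a\<^sup>2 * u s - (real n / s) * u' s)) * s - real n * u s * u' s) / (s * s))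
       = - real n * (s ^ n / s\<^sup>2) * (u s * u' s)"
      using that unfolding Q_def m by (simp add: field_simps power2_eq_square)
    ultimately show ?thesis by simp
  qed
  have "E t * exp (t0 / t) \<le> E t0 * exp (t0 / t0)"
  proof (rule DERIV_nonpos_imp_nonincreasing[where f = "\<lambda>s. E s * exp (t0 / s)"])
    show "t0 \<le> t" using t by (simp add: t0_def)
    fix s assume s: "t0 \<le> s" "s \<le> t"
    then have s0: "s > 0" using t0 by simp
    have "((\<lambda>s. E s * exp (t0 / s)) has_real_derivative
        (- real n * (s ^ n / s\<^sup>2) * (u s * u' s)) * exp (t0 / s) + exp (t0 / s) * (- t0 / s\<^sup>2) * E s) (at s)"
      using s0 by (auto intro!: derivative_eq_intros E' simp: power2_eq_square)
    moreover have "(- real n * (s ^ n / s\<^sup>2) * (u s * u' s)) * exp (t0 / s) + exp (t0 / s) * (- t0 / s\<^sup>2) * E s \<le> 0"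
    proof -
      have "- (u s * u' s) \<le> Q s / (2 * a)" using uu'[of s] by (simp add: abs_le_iff)
      then have "real n * s ^ n * (- (u s * u' s)) \<le> real n * s ^ n * (Q s / (2 * a))"
        using s0 by (intro mult_left_mono) auto
      also have "\<dots> = t0 * (s ^ n * Q s / 2)" by (simp add: t0_def)
      also have "\<dots> \<le> t0 * E s" using E_lower[OF s(1)] t0 by (intro mult_left_mono) auto
      finally have "exp (t0 / s) / s\<^sup>2 * (real n * s ^ n * (- (u s * u' s)) - t0 * E s) \<le> 0"
        by (intro mult_nonneg_nonpos) auto
      then show ?thesis by (simp add: algebra_simps diff_divide_distrib)
    qed
    ultimately show "\<exists>y. ((\<lambda>s. E s * exp (t0 / s)) has_real_derivative y) (at s) \<and> y \<le> 0" by blast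
  qed
  then have Et: "E t * exp (t0 / t) \<le> exp 1 * E t0" using t0 by (simp add: mult.commute)
  have t': "t \<ge> t0" "t > 0" using t t0 by (auto simp: t0_def)
  have "(a * u t)\<^sup>2 * t ^ n \<le> t ^ n * Q t" using t' by (simp add: Q_def algebra_simps)
  also have "\<dots> \<le> 2 * E t" by (rule E_lower[OF t'(1)])
  also have "\<dots> \<le> 2 * (E t * exp (t0 / t))"
  proof -
    have "E t \<ge> 0" using E_lower[OF t'(1)] Q[of t] t'
      by (meson mult_nonneg_nonneg order_less_imp_le zero_le_power zero_le_mult_iff order_trans not_numeral_le_zero)
    then have "E t * 1 \<le> E t * exp (t0 / t)" using t0 t' by (intro mult_left_mono) auto
    then show ?thesis by simp
  qed
  also have "\<dots> \<le> 2 * (exp 1 * E t0)" using Et by simp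
  also have "\<dots> \<le> 2 * (exp 1 * (2 * (t0 ^ n * Q t0)))"
    by (intro mult_left_mono E_upper) auto
  finally have "a\<^sup>2 * ((u t)\<^sup>2 * t ^ n) \<le> 4 * exp 1 * (t0 ^ n * Q t0)"
    by (simp add: algebra_simps power_mult_distrib)
  then have "(u t)\<^sup>2 * t ^ n \<le> (4 * exp 1 * (t0 ^ n * Q t0)) / a\<^sup>2"
    using a by (simp add: field_simps)
  then show ?thesis by (simp add: t0_def Q_def)
qed

section \<open>The Fourier transform of a ball\<close>

lemma abs_sin_diff_le: "\<bar>sin x - sin y\<bar> \<le> \<bar>x - y\<bar>" for x y :: real
proof -
  have "\<bar>sin x - sin y\<bar> = 2 * \<bar>sin ((x - y) / 2)\<bar> * \<bar>cos ((x + y) / 2)\<bar>"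
    by (simp add: sin_diff_sin abs_mult)
  also have "\<dots> \<le> 2 * \<bar>(x - y) / 2\<bar> * 1"
    by (intro mult_mono abs_sin_x_le_abs_x abs_cos_le_one) auto
  finally show ?thesis by simp
qed

lemma abs_cos_diff_le: "\<bar>cos x - cos y\<bar> \<le> \<bar>x - y\<bar>" for x y :: real
  using abs_sin_diff_le[of "x + pi / 2" "y + pi / 2"] by (simp add: sin_add)

lemma cos_Taylor1_bound: "\<bar>cos (y + h) - cos y + h * sin y\<bar> \<le> h\<^sup>2" for y h :: real
proof -
  have "norm ((cos (y + h) + h * sin y) - (cos (y + 0) + 0 * sin y)) \<le> \<bar>h\<bar> * norm (h - 0)"
  proof (rule field_differentiable_bound[where S = "{-\<bar>h\<bar>..\<bar>h\<bar>}" and f = "\<lambda>h. cos (y + h) + h * sin y"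
        and f' = "\<lambda>s. - sin (y + s) + sin y"])
    show "((\<lambda>h. cos (y + h) + h * sin y) has_field_derivative - sin (y + s) + sin y) (at s within {-\<bar>h\<bar>..\<bar>h\<bar>})" for s
      by (auto intro!: derivative_eq_intros)
    show "norm (- sin (y + s) + sin y) \<le> \<bar>h\<bar>" if "s \<in> {-\<bar>h\<bar>..\<bar>h\<bar>}" for s
    proof -
      have "norm (- sin (y + s) + sin y) = \<bar>sin (y + s) - sin y\<bar>" by simp
      also have "\<dots> \<le> \<bar>s\<bar>" using abs_sin_diff_le[of "y + s" y] by simp
      also have "\<bar>s\<bar> \<le> \<bar>h\<bar>" using that by auto
      finally show ?thesis .
    qed
  qed auto
  then show ?thesis by (simp add: power2_eq_square)
qed

lemma has_real_derivative_integral_cos: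
  fixes X w :: "'a \<Rightarrow> real"
  assumes "finite_measure M"
    and [measurable]: "X \<in> borel_measurable M" "w \<in> borel_measurable M"
    and w: "\<And>x. x \<in> space M \<Longrightarrow> \<bar>w x\<bar> \<le> W" and X: "\<And>x. x \<in> space M \<Longrightarrow> \<bar>X x\<bar> \<le> B"
  shows "((\<lambda>t. \<integral>x. w x * cos (t * X x + \<psi>) \<partial>M) has_real_derivative
            (\<integral>x. - (w x * X x) * sin (t * X x + \<psi>) \<partial>M)) (at t)"
proof -
  interpret finite_measure M by fact
  have i1: "integrable M (\<lambda>x. w x * cos (t * X x + \<psi>))" for t
  proof (rule integrable_const_bound[where B = W])
    show "AE x in M. norm (w x * cos (t * X x + \<psi>)) \<le> W"
    proof (rule AE_I2)
      fix x assume x: "x \<in> space M"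
      have "\<bar>w x\<bar> * \<bar>cos (t * X x + \<psi>)\<bar> \<le> W * 1"
        using w[OF x] by (intro mult_mono) auto
      then show "norm (w x * cos (t * X x + \<psi>)) \<le> W" by (simp add: abs_mult)
    qed
  qed measurable
  have i2: "integrable M (\<lambda>x. - (w x * X x) * sin (t * X x + \<psi>))"
  proof (rule integrable_const_bound[where B = "W * B * 1"])
    show "AE x in M. norm (- (w x * X x) * sin (t * X x + \<psi>)) \<le> W * B * 1"
    proof (rule AE_I2)
      fix x assume x: "x \<in> space M"
      have "\<bar>w x\<bar> * \<bar>X x\<bar> * \<bar>sin (t * X x + \<psi>)\<bar> \<le> W * B * 1"
        using w[OF x] X[OF x] by (intro mult_mono) auto
      then show "norm (- (w x * X x) * sin (t * X x + \<psi>)) \<le> W * B * 1" by (simp add: abs_mult)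
    qed
  qed measurable
  define F where "F = (\<lambda>t. \<integral>x. w x * cos (t * X x + \<psi>) \<partial>M)"
  define F' where "F' = (\<integral>x. - (w x * X x) * sin (t * X x + \<psi>) \<partial>M)"
  define K where "K = W * B\<^sup>2 * measure M (space M)"
  have bound: "\<bar>F (t + h) - F t - h * F'\<bar> \<le> K * h\<^sup>2" for h
  proof -
    define e where "e x = w x * cos ((t + h) * X x + \<psi>) - w x * cos (t * X x + \<psi>)
            - h * (- (w x * X x) * sin (t * X x + \<psi>))" for x
    have ei: "integrable M e"
      unfolding e_def by (intro Bochner_Integration.integrable_diff integrable_mult_right i1 i2)
    have eq: "F (t + h) - F t - h * F' = (\<integral>x. e x \<partial>M)"
      unfolding F_def F'_def e_def
      by (simp only: Bochner_Integration.integral_diff[OF Bochner_Integration.integrable_diff[OF i1 i1] integrable_mult_right[OF i2]]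
          Bochner_Integration.integral_diff[OF i1 i1] integral_mult_right_zero)
    have "\<bar>\<integral>x. e x \<partial>M\<bar> \<le> (\<integral>x. \<bar>e x\<bar> \<partial>M)"
      by (rule integral_abs_bound)
    also have "\<dots> \<le> (\<integral>x. W * B\<^sup>2 * h\<^sup>2 \<partial>M)"
    proof (rule integral_mono)
      show "integrable M (\<lambda>x. \<bar>e x\<bar>)" using ei by simp
      fix x assume x: "x \<in> space M"
      have ex: "e x = w x * (cos ((t * X x + \<psi>) + h * X x) - cos (t * X x + \<psi>) + (h * X x) * sin (t * X x + \<psi>))"
        by (simp add: e_def algebra_simps)
      have "\<bar>e x\<bar> \<le> W * (h * X x)\<^sup>2"
        unfolding ex abs_mult using w[OF x] by (intro mult_mono cos_Taylor1_bound) auto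
      also have "\<dots> \<le> W * (B\<^sup>2 * h\<^sup>2)"
      proof (rule mult_left_mono)
        have "(X x)\<^sup>2 \<le> B\<^sup>2" using power_mono[OF X[OF x], of 2] by simp
        then show "(h * X x)\<^sup>2 \<le> B\<^sup>2 * h\<^sup>2" 
          by (simp add: power_mult_distrib mult.commute[of "B\<^sup>2"] mult_left_mono)
        show "W \<ge> 0" using w[OF x] by linarith
      qed
      finally show "\<bar>e x\<bar> \<le> W * B\<^sup>2 * h\<^sup>2" by simp
    qed auto
    finally show ?thesis unfolding eq by (simp add: K_def algebra_simps)
  qed
  have "(\<lambda>h. (F (t + h) - F t) / h) \<midarrow>0\<rightarrow> F'"
  proof (rule LIM_zero_cancel, rule Lim_null_comparison)
    show "eventually (\<lambda>h. norm ((F (t + h) - F t) / h - F') \<le> K * \<bar>h\<bar>) (at 0)"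
    proof (rule eventually_at_filter[THEN iffD2], rule always_eventually, safe)
      fix h :: real assume h: "h \<noteq> 0"
      have "(F (t + h) - F t) / h - F' = (F (t + h) - F t - h * F') / h" using h by (simp add: field_simps)
      then have "norm ((F (t + h) - F t) / h - F') = \<bar>F (t + h) - F t - h * F'\<bar> / \<bar>h\<bar>" by simp
      also have "\<dots> \<le> K * h\<^sup>2 / \<bar>h\<bar>" by (intro divide_right_mono bound) auto
      also have "\<dots> = K * \<bar>h\<bar>" using h by (simp add: power2_eq_square abs_if)
      finally show "norm ((F (t + h) - F t) / h - F') \<le> K * \<bar>h\<bar>" .
    qed
    show "((\<lambda>h. K * \<bar>h\<bar>) \<longlongrightarrow> 0) (at 0)"
      by (intro tendsto_mult_right_zero tendsto_rabs_zero tendsto_ident_at)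
  qed
  then show ?thesis unfolding F_def F'_def DERIV_def by simp
qed

definition ball_lebesgue :: "real \<Rightarrow> 'a::euclidean_space measure" where
  "ball_lebesgue r = restrict_space lborel (cball 0 r)"

lemma space_ball_lebesgue [simp]: "space (ball_lebesgue r) = cball 0 r"
  by (simp add: ball_lebesgue_def space_restrict_space)

lemma finite_measure_ball_lebesgue: "finite_measure (ball_lebesgue r :: 'a::euclidean_space measure)"
proof (rule finite_measureI)
  have "emeasure (ball_lebesgue r) (space (ball_lebesgue r :: 'a measure)) = emeasure lborel (cball (0 :: 'a) r)"
    by (simp add: ball_lebesgue_def space_restrict_space emeasure_restrict_space)
  then show "emeasure (ball_lebesgue r) (space (ball_lebesgue r :: 'a measure)) \<noteq> \<infinity>"
    using emeasure_bounded_finite[of "cball (0 :: 'a) r"] by simp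
qed

lemma borel_measurable_ball_lebesgue:
  "continuous_on UNIV f \<Longrightarrow> f \<in> borel_measurable (ball_lebesgue r)"
  for f :: "'a::euclidean_space \<Rightarrow> real"
  unfolding ball_lebesgue_def
  by (intro measurable_restrict_space1) (simp add: borel_measurable_continuous_onI)

lemma integrable_ball_lebesgue:
  fixes f :: "'a::euclidean_space \<Rightarrow> real"
  assumes "continuous_on UNIV f"
  shows "integrable (ball_lebesgue r) f"
proof -
  have "integrable lborel (\<lambda>x. indicator (cball 0 r) x *\<^sub>R f x)"
    by (rule borel_integrable_compact) (auto intro: continuous_on_subset[OF assms])
  then show ?thesis
    unfolding ball_lebesgue_def by (subst integrable_restrict_space) auto
qed

text \<open>
This is integral_ball_weighted_derivative for $g(x) = \sin(t \theta \cdot x + \psi)$ in direction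
$\theta$.
\<close>

lemma ball_plane_wave_first_order:
  fixes \<theta> :: "'a::euclidean_space"
  assumes "r > 0" and \<theta>: "norm \<theta> = 1"
  shows "t * (\<integral>x. (r\<^sup>2 - (norm x)\<^sup>2) * cos (t * (\<theta> \<bullet> x) + \<psi>) \<partial>ball_lebesgue r)
       = 2 * (\<integral>x. (\<theta> \<bullet> x) * sin (t * (\<theta> \<bullet> x) + \<psi>) \<partial>ball_lebesgue r)"
proof -
  have \<theta>\<theta>: "\<theta> \<bullet> \<theta> = 1" using \<theta> by (simp add: norm_eq_1)
  have "(\<integral>x. (r\<^sup>2 - (norm x)\<^sup>2) * (t * cos (t * (\<theta> \<bullet> x) + \<psi>)) - 2 * (x \<bullet> \<theta>) * sin (t * (\<theta> \<bullet> x) + \<psi>)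
          \<partial>restrict_space lborel (cball 0 r)) = 0"
  proof (rule integral_ball_weighted_derivative[where K = "\<bar>t\<bar>"])
    fix x y :: 'a
    have "\<bar>sin (t * (\<theta> \<bullet> x) + \<psi>) - sin (t * (\<theta> \<bullet> y) + \<psi>)\<bar> \<le> \<bar>t * (\<theta> \<bullet> (x - y))\<bar>"
      using abs_sin_diff_le[of "t * (\<theta> \<bullet> x) + \<psi>" "t * (\<theta> \<bullet> y) + \<psi>"] by (simp add: inner_diff_right algebra_simps)
    also have "\<dots> \<le> \<bar>t\<bar> * norm (x - y)"
      using Cauchy_Schwarz_ineq2[of \<theta> "x - y"] \<theta> by (simp add: abs_mult mult_left_mono)
    finally show "\<bar>sin (t * (\<theta> \<bullet> x) + \<psi>) - sin (t * (\<theta> \<bullet> y) + \<psi>)\<bar> \<le> \<bar>t\<bar> * norm (x - y)" .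
  next
    fix x :: 'a
    show "((\<lambda>s. sin (t * (\<theta> \<bullet> (x + s *\<^sub>R \<theta>)) + \<psi>)) has_real_derivative t * cos (t * (\<theta> \<bullet> x) + \<psi>)) (at 0)"
      unfolding inner_add_right inner_scaleR_right \<theta>\<theta>
      by (auto intro!: derivative_eq_intros)
  qed (use assms in \<open>auto intro!: continuous_intros borel_measurable_continuous_onI\<close>)
  also have "(\<integral>x. (r\<^sup>2 - (norm x)\<^sup>2) * (t * cos (t * (\<theta> \<bullet> x) + \<psi>)) - 2 * (x \<bullet> \<theta>) * sin (t * (\<theta> \<bullet> x) + \<psi>)
          \<partial>restrict_space lborel (cball 0 r))
       = (\<integral>x. t * ((r\<^sup>2 - (norm x)\<^sup>2) * cos (t * (\<theta> \<bullet> x) + \<psi>)) - 2 * ((\<theta> \<bullet> x) * sin (t * (\<theta> \<bullet> x) + \<psi>)) \<partial>ball_lebesgue r)"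
    unfolding ball_lebesgue_def by (intro Bochner_Integration.integral_cong refl) (simp add: algebra_simps inner_commute)
  also have "\<dots> = (\<integral>x. t * ((r\<^sup>2 - (norm x)\<^sup>2) * cos (t * (\<theta> \<bullet> x) + \<psi>)) \<partial>ball_lebesgue r)
       - (\<integral>x. 2 * ((\<theta> \<bullet> x) * sin (t * (\<theta> \<bullet> x) + \<psi>)) \<partial>ball_lebesgue r)"
    by (intro Bochner_Integration.integral_diff integrable_ball_lebesgue continuous_intros)
  finally show ?thesis by simp
qed

text \<open>
This is integral_ball_weighted_derivative for $g(x) = (x \cdot v) \cos(t \theta \cdot x + \psi)$ in
direction $v$.
\<close>

lemma ball_plane_wave_second_order:
  fixes \<theta> v :: "'a::euclidean_space"
  assumes r: "r > 0" and \<theta>: "norm \<theta> = 1" and v: "norm v = 1"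
  shows "(\<integral>x. (r\<^sup>2 - (norm x)\<^sup>2) * cos (t * (\<theta> \<bullet> x) + \<psi>)
             - (r\<^sup>2 - (norm x)\<^sup>2) * t * ((x \<bullet> v) * (\<theta> \<bullet> v)) * sin (t * (\<theta> \<bullet> x) + \<psi>)
             - 2 * (x \<bullet> v)\<^sup>2 * cos (t * (\<theta> \<bullet> x) + \<psi>) \<partial>ball_lebesgue r) = 0"
proof -
  have vv: "v \<bullet> v = 1" using v by (simp add: norm_eq_1)
  define g where "g x = (x \<bullet> v) * cos (t * (\<theta> \<bullet> x) + \<psi>)" for x
  define g' where "g' x = cos (t * (\<theta> \<bullet> x) + \<psi>) - t * ((x \<bullet> v) * (\<theta> \<bullet> v)) * sin (t * (\<theta> \<bullet> x) + \<psi>)" for x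
  have "(\<integral>x. (r\<^sup>2 - (norm x)\<^sup>2) * g' x - 2 * (x \<bullet> v) * g x \<partial>restrict_space lborel (cball 0 r)) = 0"
  proof (rule integral_ball_weighted_derivative[where K = "1 + (r + 1) * \<bar>t\<bar>"])
    fix x y :: 'a
    assume x: "norm x \<le> r + norm v" and y: "norm y \<le> r + norm v"
    have "\<bar>cos (t * (\<theta> \<bullet> x) + \<psi>) - cos (t * (\<theta> \<bullet> y) + \<psi>)\<bar> \<le> \<bar>t * (\<theta> \<bullet> (x - y))\<bar>"
      using abs_cos_diff_le[of "t * (\<theta> \<bullet> x) + \<psi>" "t * (\<theta> \<bullet> y) + \<psi>"] by (simp add: inner_diff_right algebra_simps)
    also have "\<dots> \<le> \<bar>t\<bar> * norm (x - y)"
      using Cauchy_Schwarz_ineq2[of \<theta> "x - y"] \<theta> by (simp add: abs_mult mult_left_mono)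
    finally have c: "\<bar>cos (t * (\<theta> \<bullet> x) + \<psi>) - cos (t * (\<theta> \<bullet> y) + \<psi>)\<bar> \<le> \<bar>t\<bar> * norm (x - y)" .
    have yv: "\<bar>y \<bullet> v\<bar> \<le> r + 1" using Cauchy_Schwarz_ineq2[of y v] y v by simp
    have xyv: "\<bar>(x - y) \<bullet> v\<bar> \<le> norm (x - y)" using Cauchy_Schwarz_ineq2[of "x - y" v] v by simp
    have "g x - g y = ((x - y) \<bullet> v) * cos (t * (\<theta> \<bullet> x) + \<psi>)
        + (y \<bullet> v) * (cos (t * (\<theta> \<bullet> x) + \<psi>) - cos (t * (\<theta> \<bullet> y) + \<psi>))"
      by (simp add: g_def algebra_simps inner_diff_left)
    also have "\<bar>\<dots>\<bar> \<le> \<bar>(x - y) \<bullet> v\<bar> * \<bar>cos (t * (\<theta> \<bullet> x) + \<psi>)\<bar>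
        + \<bar>y \<bullet> v\<bar> * \<bar>cos (t * (\<theta> \<bullet> x) + \<psi>) - cos (t * (\<theta> \<bullet> y) + \<psi>)\<bar>"
      by (metis abs_mult abs_triangle_ineq)
    also have "\<dots> \<le> norm (x - y) * 1 + (r + 1) * (\<bar>t\<bar> * norm (x - y))"
      using r by (intro add_mono mult_mono xyv yv c abs_cos_le_one) auto
    finally show "\<bar>g x - g y\<bar> \<le> (1 + (r + 1) * \<bar>t\<bar>) * norm (x - y)"
      by (simp add: algebra_simps)
  next
    fix x :: 'a
    show "((\<lambda>s. g (x + s *\<^sub>R v)) has_real_derivative g' x) (at 0)"
      unfolding g_def g'_def inner_add_left inner_add_right inner_scaleR_right inner_scaleR_left vv
      by (auto intro!: derivative_eq_intros) (simp add: algebra_simps)?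
  next
    show "continuous_on UNIV g" unfolding g_def by (intro continuous_intros)
    show "g' \<in> borel_measurable borel"
      unfolding g'_def by (intro borel_measurable_continuous_onI continuous_intros)
  qed fact
  then show ?thesis
    unfolding g_def g'_def ball_lebesgue_def
    by (simp add: algebra_simps power2_eq_square)
qed

text \<open>
For $v$ orthogonal to $\theta$ the middle term of ball_plane_wave_second_order disappears. Summing
over an orthonormal basis of the hyperplane orthogonal to $\theta$ would give the claim. Summing
over the standard basis and subtracting the case $v = \theta$ has the same effect, and avoids the
choice of such a basis.
\<close>

lemma ball_plane_wave_transversal:
  fixes \<theta> :: "'a::euclidean_space"
  assumes r: "r > 0" and \<theta>: "norm \<theta> = 1"
  shows "(real DIM('a) - 1) * (\<integral>x. (r\<^sup>2 - (norm x)\<^sup>2) * cos (t * (\<theta> \<bullet> x) + \<psi>) \<partial>ball_lebesgue r)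
       = 2 * (\<integral>x. ((norm x)\<^sup>2 - (\<theta> \<bullet> x)\<^sup>2) * cos (t * (\<theta> \<bullet> x) + \<psi>) \<partial>ball_lebesgue r)"
proof -
  define h where "h v x = (r\<^sup>2 - (norm x)\<^sup>2) * cos (t * (\<theta> \<bullet> x) + \<psi>)
             - (r\<^sup>2 - (norm x)\<^sup>2) * t * ((x \<bullet> v) * (\<theta> \<bullet> v)) * sin (t * (\<theta> \<bullet> x) + \<psi>)
             - 2 * (x \<bullet> v)\<^sup>2 * cos (t * (\<theta> \<bullet> x) + \<psi>)" for v x :: 'a
  have h0: "(\<integral>x. h v x \<partial>ball_lebesgue r) = 0" if "norm v = 1" for v
    unfolding h_def by (rule ball_plane_wave_second_order[OF r \<theta> that])
  have hi: "integrable (ball_lebesgue r) (h v)" for v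
    unfolding h_def by (intro integrable_ball_lebesgue continuous_intros)
  have "(\<Sum>v\<in>Basis. h v x) - h \<theta> x = (real DIM('a) - 1) * ((r\<^sup>2 - (norm x)\<^sup>2) * cos (t * (\<theta> \<bullet> x) + \<psi>))
          - 2 * (((norm x)\<^sup>2 - (\<theta> \<bullet> x)\<^sup>2) * cos (t * (\<theta> \<bullet> x) + \<psi>))" for x
  proof -
    have 1: "(\<Sum>v\<in>Basis. (x \<bullet> v) * (\<theta> \<bullet> v)) = \<theta> \<bullet> x"
      by (subst (3) inner_commute) (rule euclidean_inner[symmetric])
    have 2: "(\<Sum>v\<in>Basis. (x \<bullet> v)\<^sup>2) = (norm x)\<^sup>2"
      unfolding power2_norm_eq_inner euclidean_inner[of x x] by (simp add: power2_eq_square)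
    have 3: "(x \<bullet> \<theta>) * (\<theta> \<bullet> \<theta>) = \<theta> \<bullet> x" using \<theta> by (simp add: norm_eq_1 inner_commute)
    have "(\<Sum>v\<in>Basis. h v x) = real DIM('a) * ((r\<^sup>2 - (norm x)\<^sup>2) * cos (t * (\<theta> \<bullet> x) + \<psi>))
        - (r\<^sup>2 - (norm x)\<^sup>2) * t * (\<Sum>v\<in>Basis. (x \<bullet> v) * (\<theta> \<bullet> v)) * sin (t * (\<theta> \<bullet> x) + \<psi>)
        - 2 * (\<Sum>v\<in>Basis. (x \<bullet> v)\<^sup>2) * cos (t * (\<theta> \<bullet> x) + \<psi>)"
      unfolding h_def by (simp add: sum_subtractf sum_distrib_left sum_distrib_right)
    then show ?thesis unfolding 1 2 h_def 3 by (simp add: algebra_simps inner_commute)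
  qed
  moreover have "(\<integral>x. (\<Sum>v\<in>Basis. h v x) - h \<theta> x \<partial>ball_lebesgue r) = 0"
    using hi h0 \<theta> by (simp add: Bochner_Integration.integral_diff Bochner_Integration.integral_sum)
  moreover have "(\<integral>x. (real DIM('a) - 1) * ((r\<^sup>2 - (norm x)\<^sup>2) * cos (t * (\<theta> \<bullet> x) + \<psi>))
          - 2 * (((norm x)\<^sup>2 - (\<theta> \<bullet> x)\<^sup>2) * cos (t * (\<theta> \<bullet> x) + \<psi>)) \<partial>ball_lebesgue r)
      = (\<integral>x. (real DIM('a) - 1) * ((r\<^sup>2 - (norm x)\<^sup>2) * cos (t * (\<theta> \<bullet> x) + \<psi>)) \<partial>ball_lebesgue r)
        - (\<integral>x. 2 * (((norm x)\<^sup>2 - (\<theta> \<bullet> x)\<^sup>2) * cos (t * (\<theta> \<bullet> x) + \<psi>)) \<partial>ball_lebesgue r)"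
    by (intro Bochner_Integration.integral_diff integrable_ball_lebesgue continuous_intros)
  ultimately show ?thesis by simp
qed

text \<open>
The second derivative of $u$ is $-\int (\theta \cdot x)^2 \cos(t \theta \cdot x + \psi)$. The
transversal identity expresses it through $u$ and $P = \int (r^2 - |x|^2) \cos(t \theta \cdot x +
\psi)$, and the first-order identity says that $t P = - 2 u'$.
\<close>

lemma ball_plane_wave_bessel:
  fixes \<theta> :: "'a::euclidean_space" and \<psi> :: real
  assumes r: "r > 0" and \<theta>: "norm \<theta> = 1"
  defines "u \<equiv> \<lambda>t. \<integral>x. cos (t * (\<theta> \<bullet> x) + \<psi>) \<partial>ball_lebesgue r"
    and "u' \<equiv> \<lambda>t. \<integral>x. - ((\<theta> \<bullet> x) * sin (t * (\<theta> \<bullet> x) + \<psi>)) \<partial>ball_lebesgue r"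
  shows "(u has_real_derivative u' t) (at t)"
    and "t > 0 \<Longrightarrow> (u' has_real_derivative - r\<^sup>2 * u t - (real (Suc DIM('a)) / t) * u' t) (at t)"
proof -
  let ?M = "ball_lebesgue r :: 'a measure"
  let ?X = "\<lambda>x. \<theta> \<bullet> x"
  have X: "\<bar>?X x\<bar> \<le> r" if "x \<in> space ?M" for x
    using Cauchy_Schwarz_ineq2[of \<theta> x] \<theta> that by simp
  have meas: "?X \<in> borel_measurable ?M"
    by (intro borel_measurable_ball_lebesgue continuous_intros)
  show "(u has_real_derivative u' t) (at t)"
    using has_real_derivative_integral_cos[OF finite_measure_ball_lebesgue meas,
        where w = "\<lambda>_. 1" and W = 1 and B = r and \<psi> = \<psi> and t = t] X
    by (simp add: u_def u'_def)
  assume t: "t > 0"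
  define v where "v = (\<integral>x. (?X x)\<^sup>2 * cos (t * ?X x + \<psi>) \<partial>?M)"
  define P where "P = (\<integral>x. (r\<^sup>2 - (norm x)\<^sup>2) * cos (t * ?X x + \<psi>) \<partial>?M)"
  have shift: "cos (y + (\<psi> + pi / 2)) = - sin (y + \<psi>)" "sin (y + (\<psi> + pi / 2)) = cos (y + \<psi>)" for y
    using cos_add[of "y + \<psi>" "pi / 2"] sin_add[of "y + \<psi>" "pi / 2"] by (simp_all add: add.assoc)
  have "((\<lambda>s. \<integral>x. ?X x * cos (s * ?X x + (\<psi> + pi / 2)) \<partial>?M) has_real_derivative
          (\<integral>x. - (?X x * ?X x) * sin (t * ?X x + (\<psi> + pi / 2)) \<partial>?M)) (at t)"
    by (rule has_real_derivative_integral_cos[OF finite_measure_ball_lebesgue meas meas X X])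
  then have 1: "(u' has_real_derivative - v) (at t)"
    by (simp add: u'_def v_def shift power2_eq_square)
  have 2: "t * P = - 2 * u' t"
    using ball_plane_wave_first_order[OF r \<theta>, of t \<psi>] by (simp add: P_def u'_def)
  have "(\<integral>x. ((norm x)\<^sup>2 - (?X x)\<^sup>2) * cos (t * ?X x + \<psi>) \<partial>?M)
      = (\<integral>x. r\<^sup>2 * cos (t * ?X x + \<psi>) - (r\<^sup>2 - (norm x)\<^sup>2) * cos (t * ?X x + \<psi>) - (?X x)\<^sup>2 * cos (t * ?X x + \<psi>) \<partial>?M)"
    by (simp add: algebra_simps)
  also have "\<dots> = (\<integral>x. r\<^sup>2 * cos (t * ?X x + \<psi>) - (r\<^sup>2 - (norm x)\<^sup>2) * cos (t * ?X x + \<psi>) \<partial>?M) - v"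
    unfolding v_def by (intro Bochner_Integration.integral_diff integrable_ball_lebesgue continuous_intros)
  also have "(\<integral>x. r\<^sup>2 * cos (t * ?X x + \<psi>) - (r\<^sup>2 - (norm x)\<^sup>2) * cos (t * ?X x + \<psi>) \<partial>?M)
      = (\<integral>x. r\<^sup>2 * cos (t * ?X x + \<psi>) \<partial>?M) - P"
    unfolding P_def by (intro Bochner_Integration.integral_diff integrable_ball_lebesgue continuous_intros)
  also have "(\<integral>x. r\<^sup>2 * cos (t * ?X x + \<psi>) \<partial>?M) = r\<^sup>2 * u t" by (simp add: u_def)
  finally have 3: "(real DIM('a) - 1) * P = 2 * (r\<^sup>2 * u t - P - v)"
    using ball_plane_wave_transversal[OF r \<theta>, of t \<psi>] by (simp add: P_def)
  have "- v = - r\<^sup>2 * u t + real (Suc DIM('a)) * (P / 2)" using 3 by (simp add: algebra_simps)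
  also have "P = - 2 * u' t / t" using 2 t by (simp add: field_simps)
  finally have "- v = - r\<^sup>2 * u t - (real (Suc DIM('a)) / t) * u' t" by simp
  then show "(u' has_real_derivative - r\<^sup>2 * u t - (real (Suc DIM('a)) / t) * u' t) (at t)"
    using 1 by simp
qed

lemma ball_fourier_decay:
  assumes r: "r > 0"
  obtains C where "C > 0"
    "\<And>k \<psi>. k \<noteq> (0 :: 'a::euclidean_space) \<Longrightarrow>
      (\<integral>x. cos (k \<bullet> x + \<psi>) \<partial>ball_lebesgue r)\<^sup>2 \<le> C / norm k ^ Suc DIM('a)"
proof -
  let ?M = "ball_lebesgue r :: 'a measure"
  let ?n = "Suc DIM('a)"
  define V where "V = measure ?M (space ?M)"
  \<comment> \<open>From here on the energy estimate applies; below it the trivial bound is enough.\<close>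
  define t0 where "t0 = real ?n / r"
  define C1 where "C1 = 4 * exp 1 / r\<^sup>2 * (t0 ^ ?n * ((r * V)\<^sup>2 + (r * V)\<^sup>2))"
  define C2 where "C2 = V\<^sup>2 * t0 ^ ?n"
  interpret finite_measure ?M by (rule finite_measure_ball_lebesgue)
  have t0: "t0 > 0" using r by (simp add: t0_def)
  have V: "\<bar>\<integral>x. g x \<partial>?M\<bar> \<le> b * V"
    if "continuous_on UNIV g" "\<And>x. norm x \<le> r \<Longrightarrow> \<bar>g x\<bar> \<le> b" for g :: "'a \<Rightarrow> real" and b
  proof -
    have "\<bar>\<integral>x. g x \<partial>?M\<bar> \<le> (\<integral>x. \<bar>g x\<bar> \<partial>?M)" by (rule integral_abs_bound)
    also have "\<dots> \<le> (\<integral>x. b \<partial>?M)"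
      using that by (intro integral_mono integrable_abs integrable_ball_lebesgue) auto
    finally show ?thesis by (simp add: V_def mult.commute)
  qed
  have main: "(\<integral>x. cos (t * (\<theta> \<bullet> x) + \<psi>) \<partial>?M)\<^sup>2 * t ^ ?n \<le> C1 + C2"
    if \<theta>: "norm \<theta> = 1" and t: "t > 0" for \<theta> t \<psi>
  proof -
    define u where "u = (\<lambda>t. \<integral>x. cos (t * (\<theta> \<bullet> x) + \<psi>) \<partial>?M)"
    define u' where "u' = (\<lambda>t. \<integral>x. - ((\<theta> \<bullet> x) * sin (t * (\<theta> \<bullet> x) + \<psi>)) \<partial>?M)"
    have ub: "\<bar>u s\<bar> \<le> V" for s
    proof -
      have "continuous_on UNIV (\<lambda>x. cos (s * (\<theta> \<bullet> x) + \<psi>))" by (intro continuous_intros)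
      from V[OF this, of 1] show ?thesis by (simp add: u_def)
    qed
    have ub': "\<bar>u' s\<bar> \<le> r * V" for s
      unfolding u'_def
    proof (rule V)
      fix x :: 'a assume x: "norm x \<le> r"
      have "\<bar>\<theta> \<bullet> x\<bar> * \<bar>sin (s * (\<theta> \<bullet> x) + \<psi>)\<bar> \<le> r * 1"
        using Cauchy_Schwarz_ineq2[of \<theta> x] \<theta> x r by (intro mult_mono) auto
      then show "\<bar>- ((\<theta> \<bullet> x) * sin (s * (\<theta> \<bullet> x) + \<psi>))\<bar> \<le> r" by (simp add: abs_mult)
    qed (intro continuous_intros)
    have C: "C1 \<ge> 0" "C2 \<ge> 0" using t0 by (simp_all add: C1_def C2_def)
    show ?thesis
    proof (cases "t \<ge> t0")
      case True
      have "(u t)\<^sup>2 * t ^ ?n \<le> 4 * exp 1 / r\<^sup>2 * (t0 ^ ?n * ((r * u t0)\<^sup>2 + (u' t0)\<^sup>2))"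
        unfolding t0_def
      proof (rule energy_decay[OF r, where u = u and u' = u' and n = ?n])
        show "(u has_real_derivative u' s) (at s)" for s
          unfolding u_def u'_def by (rule ball_plane_wave_bessel(1)[OF r \<theta>])
        show "(u' has_real_derivative - r\<^sup>2 * u s - real ?n / s * u' s) (at s)" if "s > 0" for s
          unfolding u_def u'_def by (rule ball_plane_wave_bessel(2)[OF r \<theta> that])
      qed (use True in \<open>simp_all add: t0_def\<close>)
      also have "\<dots> \<le> C1"
      proof -
        have "(r * u t0)\<^sup>2 \<le> (r * V)\<^sup>2"
          using ub[of t0] r by (intro abs_le_square_iff[THEN iffD1]) (simp add: abs_mult mult_left_mono V_def)
        moreover have "(u' t0)\<^sup>2 \<le> (r * V)\<^sup>2"
          using ub'[of t0] r by (intro abs_le_square_iff[THEN iffD1]) (simp add: abs_mult V_def)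
        ultimately show ?thesis
          unfolding C1_def using t0 by (intro mult_left_mono add_mono) auto
      qed
      finally show ?thesis using C by (simp add: u_def)
    next
      case False
      have "(u t)\<^sup>2 * t ^ ?n \<le> V\<^sup>2 * t0 ^ ?n"
      proof (rule mult_mono)
        show "(u t)\<^sup>2 \<le> V\<^sup>2" using ub[of t] by (intro abs_le_square_iff[THEN iffD1]) (simp add: V_def)
        show "t ^ ?n \<le> t0 ^ ?n" using False t by (intro power_mono) auto
      qed (use t in auto)
      then show ?thesis using C by (simp add: u_def C2_def)
    qed
  qed
  show ?thesis
  proof (rule that[of "C1 + C2 + 1"])
    show "C1 + C2 + 1 > 0" using t0 by (simp add: C1_def C2_def add_nonneg_pos)
    fix k :: 'a and \<psi> assume k: "k \<noteq> 0"
    have "(\<integral>x. cos (norm k * ((k /\<^sub>R norm k) \<bullet> x) + \<psi>) \<partial>?M)\<^sup>2 * norm k ^ ?n \<le> C1 + C2"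
      using k by (intro main) auto
    moreover have wave: "norm k * ((k /\<^sub>R norm k) \<bullet> x) = k \<bullet> x" for x using k by simp
    ultimately have "(\<integral>x. cos (k \<bullet> x + \<psi>) \<partial>?M)\<^sup>2 * norm k ^ ?n \<le> C1 + C2 + 1"
      unfolding wave by linarith
    then show "(\<integral>x. cos (k \<bullet> x + \<psi>) \<partial>?M)\<^sup>2 \<le> (C1 + C2 + 1) / norm k ^ ?n"
      using k by (simp add: field_simps)
  qed
qed

section \<open>Translation invariance and characters on the torus\<close>

definition torus_periodic :: "(real ^ 'd \<Rightarrow> 'b) \<Rightarrow> bool" where
  "torus_periodic f \<longleftrightarrow> (\<forall>x. \<forall>k\<in>int_lattice. f (x + k) = f x)"

lemma torus_periodicD: "torus_periodic f \<Longrightarrow> k \<in> int_lattice \<Longrightarrow> f (x + k) = f x"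
  by (simp add: torus_periodic_def)

lemma torus_periodic_red: "torus_periodic f \<Longrightarrow> f (torus_red x) = f x"
  using torus_periodicD[OF _ diff_torus_red_in_int_lattice, of f "torus_red x" x] by simp

lemma int_lattice_add: "k \<in> int_lattice \<Longrightarrow> l \<in> int_lattice \<Longrightarrow> k + l \<in> int_lattice"
  and int_lattice_diff: "k \<in> int_lattice \<Longrightarrow> l \<in> int_lattice \<Longrightarrow> k - l \<in> int_lattice"
  and int_lattice_uminus: "k \<in> int_lattice \<Longrightarrow> - k \<in> int_lattice"
  by (auto simp: int_lattice_def)

lemma int_lattice_inner: "k \<in> int_lattice \<Longrightarrow> l \<in> int_lattice \<Longrightarrow> k \<bullet> l \<in> \<int>"
  by (auto simp: int_lattice_def inner_vec_def intro!: Ints_sum Ints_mult)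

lemma torus_red_unique:
  assumes "k \<in> int_lattice" "x - k \<in> torus_cube"
  shows "torus_red x = x - k"
  using torus_red_add_int_lattice[OF assms(1), of "x - k"] torus_red_id[OF assms(2)] by simp

lemma emeasure_lborel_translate_vimage:
  fixes S :: "'a::euclidean_space set"
  assumes "S \<in> sets borel"
  shows "emeasure lborel {x. x + c \<in> S} = emeasure lborel S"
proof -
  have "emeasure lborel S = emeasure (distr lborel borel ((+) c)) S" by (simp add: lborel_distr_plus)
  also have "\<dots> = emeasure lborel {x. x + c \<in> S}"
    using assms by (subst emeasure_distr) (auto simp: vimage_def add.commute)
  finally show ?thesis by simp
qed

lemma sets_torus_haar [simp, measurable_cong]: "sets torus_haar = sets torus_borel"
  by (simp add: torus_haar_def torus_borel_def sets_restrict_space)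

lemma space_torus_haar [simp]: "space torus_haar = torus_cube"
  by (simp add: torus_haar_def space_restrict_space)

text \<open>
The translate of the cube by $h$ is cut into countably many pieces by the lattice translates of the
cube. Reduction moves every piece by a lattice vector back into the cube, where the
pieces fit together again.
\<close>

lemma torus_translation_invariant:
  "distr torus_haar torus_borel (\<lambda>x. torus_red (x + h)) = (torus_haar :: (real ^ 'd) measure)"
proof (rule measure_eqI)
  fix A :: "(real ^ 'd) set" assume "A \<in> sets (distr torus_haar torus_borel (\<lambda>x. torus_red (x + h)))"
  then have A: "A \<in> sets torus_borel" by simp
  then have Ac: "A \<subseteq> torus_cube" using sets.sets_into_space by fastforce
  have Ab: "A \<in> sets borel" using A Ac
    unfolding torus_borel_def by (subst (asm) sets_restrict_space_iff) auto
  have tr [measurable]: "(\<lambda>x. x + c) \<in> borel \<rightarrow>\<^sub>M borel" for c :: "real ^ 'd" by simp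
  define E where "E k = {x \<in> torus_cube. x + (h - k) \<in> A}" for k
  define F where "F k = {y \<in> A. y - (h - k) \<in> torus_cube}" for k
  have meas: "(\<lambda>x. torus_red (x + h)) \<in> torus_haar \<rightarrow>\<^sub>M torus_borel"
    unfolding torus_haar_def by (intro measurable_restrict_space1) measurable
  have E: "E k \<in> sets borel" for k
  proof -
    have "E k = torus_cube \<inter> ((\<lambda>x. x + (h - k)) -` A \<inter> space borel)" by (auto simp: E_def)
    also have "\<dots> \<in> sets borel" by (intro sets.Int torus_cube_borel measurable_sets[OF tr Ab])
    finally show ?thesis .
  qed
  have F: "F k \<in> sets borel" for k
  proof -
    have "F k = A \<inter> ((\<lambda>y. y - (h - k)) -` torus_cube \<inter> space borel)" by (auto simp: F_def)
    also have "\<dots> \<in> sets borel" by (intro sets.Int Ab measurable_sets[OF _ torus_cube_borel]) simp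
    finally show ?thesis .
  qed
  have Ered: "torus_red (x + h) = x + h - k" if "x \<in> E k" "k \<in> int_lattice" for x k
    using that Ac by (intro torus_red_unique) (auto simp: E_def algebra_simps)
  have Fred: "torus_red (y - h) = y - h + k" if "y \<in> F k" "k \<in> int_lattice" for y k
    using that torus_red_unique[of "- k" "y - h"] by (auto simp: F_def algebra_simps int_lattice_uminus)
  have "emeasure (distr torus_haar torus_borel (\<lambda>x. torus_red (x + h))) A
      = emeasure torus_haar ((\<lambda>x. torus_red (x + h)) -` A \<inter> space torus_haar)"
    by (rule emeasure_distr[OF meas A])
  also have "(\<lambda>x. torus_red (x + h)) -` A \<inter> space torus_haar = (\<Union>k\<in>int_lattice. E k)"
  proof (intro equalityI subsetI)
    fix x assume "x \<in> (\<lambda>x. torus_red (x + h)) -` A \<inter> space torus_haar"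
    then have "x \<in> E (x + h - torus_red (x + h))" by (simp add: E_def)
    then show "x \<in> (\<Union>k\<in>int_lattice. E k)" using diff_torus_red_in_int_lattice by blast
  next
    fix x assume "x \<in> (\<Union>k\<in>int_lattice. E k)"
    then obtain k where k: "x \<in> E k" "k \<in> int_lattice" by blast
    show "x \<in> (\<lambda>x. torus_red (x + h)) -` A \<inter> space torus_haar"
      using k(1) Ered[OF k] by (simp add: E_def add_diff_eq)
  qed
  also have "emeasure torus_haar \<dots> = emeasure lborel (\<Union>k\<in>int_lattice. E k)"
    unfolding torus_haar_def by (rule emeasure_restrict_space) (auto simp: E_def)
  also have "\<dots> = (\<integral>\<^sup>+k. emeasure lborel (E k) \<partial>count_space int_lattice)"
  proof (rule emeasure_UN_countable[OF _ countable_int_lattice])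
    show "disjoint_family_on E int_lattice"
      unfolding disjoint_family_on_def by (metis Ered IntE equals0I diff_left_imp_eq)
  qed (use E in auto)
  also have "\<dots> = (\<integral>\<^sup>+k. emeasure lborel (F k) \<partial>count_space int_lattice)"
  proof (rule nn_integral_cong)
    fix k :: "real ^ 'd"
    have "E k = {x. x + (h - k) \<in> F k}" by (auto simp: E_def F_def)
    then show "emeasure lborel (E k) = emeasure lborel (F k)"
      using emeasure_lborel_translate_vimage[OF F] by simp
  qed
  also have "\<dots> = emeasure lborel (\<Union>k\<in>int_lattice. F k)"
  proof (rule emeasure_UN_countable[OF _ countable_int_lattice, symmetric])
    show "disjoint_family_on F int_lattice"
      unfolding disjoint_family_on_def by (metis Fred IntE equals0I add_left_imp_eq)
  qed (use F in auto)
  also have "(\<Union>k\<in>int_lattice. F k) = A"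
  proof (intro equalityI subsetI)
    fix y assume y: "y \<in> A"
    have "- (y - h - torus_red (y - h)) \<in> int_lattice"
      by (intro int_lattice_uminus diff_torus_red_in_int_lattice)
    moreover have "y \<in> F (- (y - h - torus_red (y - h)))" using y by (simp add: F_def)
    ultimately show "y \<in> (\<Union>k\<in>int_lattice. F k)" by blast
  qed (auto simp: F_def)
  also have "emeasure lborel A = emeasure torus_haar A"
    unfolding torus_haar_def by (rule emeasure_restrict_space[symmetric]) (use Ac in auto)
  finally show "emeasure (distr torus_haar torus_borel (\<lambda>x. torus_red (x + h))) A = emeasure torus_haar A" .
qed simp

lemma borel_measurable_torus:
  "f \<in> borel_measurable borel \<Longrightarrow> f \<in> borel_measurable torus_borel"
  "f \<in> borel_measurable borel \<Longrightarrow> f \<in> borel_measurable torus_haar"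
  unfolding torus_borel_def torus_haar_def by (auto intro!: measurable_restrict_space1)

lemma integral_torus_shift:
  fixes f :: "real ^ 'd \<Rightarrow> 'b::{banach, second_countable_topology}"
  assumes f: "f \<in> borel_measurable borel" and per: "torus_periodic f"
  shows "(\<integral>x. f (x + h) \<partial>torus_haar) = (\<integral>x. f x \<partial>torus_haar)"
proof -
  have meas: "(\<lambda>x. torus_red (x + h)) \<in> torus_haar \<rightarrow>\<^sub>M torus_borel"
    unfolding torus_haar_def by (intro measurable_restrict_space1) measurable
  have "(\<integral>x. f x \<partial>torus_haar) = (\<integral>x. f x \<partial>distr torus_haar torus_borel (\<lambda>x. torus_red (x + h)))"
    by (simp only: torus_translation_invariant)
  also have "\<dots> = (\<integral>x. f (torus_red (x + h)) \<partial>torus_haar)"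
    by (rule integral_distr[OF meas borel_measurable_torus(1)[OF f]])
  finally show ?thesis by (simp add: torus_periodic_red[OF per])
qed

lemma integrable_torus_bounded:
  fixes f :: "real ^ 'd \<Rightarrow> 'b::{banach, second_countable_topology}"
  assumes "f \<in> borel_measurable borel" and "\<And>x. norm (f x) \<le> B"
  shows "integrable torus_haar f"
proof -
  interpret prob_space "torus_haar :: (real ^ 'd) measure" by (rule prob_space_torus_haar)
  show ?thesis
    by (rule integrable_const_bound[of _ B]) (auto simp: assms borel_measurable_torus)
qed

definition torus_char :: "real ^ 'd \<Rightarrow> real ^ 'd \<Rightarrow> complex" where
  "torus_char k x = cis (2 * pi * (k \<bullet> x))"

lemma torus_char_borel [measurable]: "torus_char k \<in> borel_measurable borel"
  unfolding torus_char_def cis_conv_exp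
  by (intro borel_measurable_continuous_onI continuous_intros)

lemma norm_torus_char [simp]: "norm (torus_char k x) = 1"
  by (simp add: torus_char_def)

lemma torus_char_add: "torus_char k (x + y) = torus_char k x * torus_char k y"
  by (simp add: torus_char_def cis_mult inner_add_right algebra_simps)

lemma torus_char_add_left: "torus_char (k + l) x = torus_char k x * torus_char l x"
  by (simp add: torus_char_def cis_mult inner_add_left algebra_simps)

lemma torus_char_diff_left: "torus_char (k - l) x = torus_char k x * cnj (torus_char l x)"
  by (simp add: torus_char_def cis_mult cis_cnj inner_diff_left algebra_simps)

lemma torus_char_zero [simp]: "torus_char 0 x = 1"
  by (simp add: torus_char_def)

lemma torus_char_lattice: "k \<in> int_lattice \<Longrightarrow> l \<in> int_lattice \<Longrightarrow> torus_char k l = 1"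
  unfolding torus_char_def by (intro cis_multiple_2pi int_lattice_inner)

lemma torus_periodic_char: "k \<in> int_lattice \<Longrightarrow> torus_periodic (torus_char k)"
  by (simp add: torus_periodic_def torus_char_add torus_char_lattice)

lemma integral_torus_char:
  assumes k: "k \<in> (int_lattice :: (real ^ 'd) set)"
  shows "(\<integral>x. torus_char k x \<partial>torus_haar) = (if k = 0 then 1 else 0)"
proof (cases "k = 0")
  case True
  interpret prob_space "torus_haar :: (real ^ 'd) measure" by (rule prob_space_torus_haar)
  show ?thesis using True prob_space by simp
next
  case False
  then obtain i where i: "k $ i \<noteq> 0" by (auto simp: vec_eq_iff)
  \<comment> \<open>A shift by half a period of the character changes its sign.\<close>
  define h :: "real ^ 'd" where "h = axis i (1 / (2 * k $ i))"
  have "k \<bullet> h = 1 / 2" using i by (simp add: h_def inner_axis)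
  then have kh: "2 * pi * (k \<bullet> h) = pi" by simp
  have "torus_char k h = - 1" by (simp only: torus_char_def kh cis_pi)
  then have "(\<integral>x. torus_char k (x + h) \<partial>torus_haar) = - (\<integral>x. torus_char k x \<partial>torus_haar)"
    by (simp add: torus_char_add)
  moreover have "(\<integral>x. torus_char k (x + h) \<partial>torus_haar) = (\<integral>x. torus_char k x \<partial>torus_haar)"
    by (rule integral_torus_shift[OF torus_char_borel torus_periodic_char[OF k]])
  ultimately show ?thesis using False by simp
qed

section \<open>Fourier coefficients and autocorrelation\<close>

definition fourier_coeff :: "(real ^ 'd \<Rightarrow> real) \<Rightarrow> real ^ 'd \<Rightarrow> complex" where
  "fourier_coeff f k = (\<integral>x. of_real (f x) * torus_char k x \<partial>torus_haar)"

definition torus_autocorr :: "(real ^ 'd \<Rightarrow> real) \<Rightarrow> real ^ 'd \<Rightarrow> real" where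
  "torus_autocorr f z = (\<integral>x. f x * f (x + z) \<partial>torus_haar)"

lemma torus_autocorr_borel [measurable]:
  fixes f :: "real ^ 'd \<Rightarrow> real"
  assumes f [measurable]: "f \<in> borel_measurable borel"
  shows "torus_autocorr f \<in> borel_measurable borel"
proof -
  interpret prob_space "torus_haar :: (real ^ 'd) measure" by (rule prob_space_torus_haar)
  have id [measurable]: "(\<lambda>x. x) \<in> torus_haar \<rightarrow>\<^sub>M (borel :: (real ^ 'd) measure)"
    unfolding torus_haar_def by (auto intro!: measurable_restrict_space1)
  have s [measurable]: "snd \<in> (borel :: (real ^ 'd) measure) \<Otimes>\<^sub>M torus_haar \<rightarrow>\<^sub>M (borel :: (real ^ 'd) measure)"
    by (rule measurable_compose[OF measurable_snd id])
  show ?thesis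
    unfolding torus_autocorr_def
    by (rule borel_measurable_lebesgue_integral) (simp add: split_beta)
qed

lemma torus_autocorr_bound:
  fixes f :: "real ^ 'd \<Rightarrow> real"
  assumes "f \<in> borel_measurable borel" and "\<And>x. \<bar>f x\<bar> \<le> B"
  shows "\<bar>torus_autocorr f z\<bar> \<le> B * B"
proof -
  interpret prob_space "torus_haar :: (real ^ 'd) measure" by (rule prob_space_torus_haar)
  have B: "B \<ge> 0" using assms(2)[of 0] by linarith
  have "\<bar>torus_autocorr f z\<bar> \<le> (\<integral>x. \<bar>f x * f (x + z)\<bar> \<partial>torus_haar)"
    unfolding torus_autocorr_def by (rule integral_abs_bound)
  also have "\<dots> \<le> (\<integral>x. B * B \<partial>(torus_haar :: (real ^ 'd) measure))"
  proof (rule integral_mono)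
    have "(\<lambda>x. f x * f (x + z)) \<in> borel_measurable borel" using assms(1) by measurable
    moreover have "norm (f x * f (x + z)) \<le> B * B" for x
      using assms B by (simp add: abs_mult mult_mono)
    ultimately show "integrable torus_haar (\<lambda>x. \<bar>f x * f (x + z)\<bar>)"
      by (intro integrable_abs integrable_torus_bounded)
  qed (use assms B in \<open>auto simp: abs_mult intro!: mult_mono\<close>)
  finally show ?thesis using prob_space by simp
qed

text \<open>
The Fourier coefficients of the autocorrelation are the squared moduli of those of $f$: after an
exchange of the integrals the double integral factorizes.
\<close>

lemma integral_torus_autocorr_char:
  fixes f :: "real ^ 'd \<Rightarrow> real"
  assumes f [measurable]: "f \<in> borel_measurable borel" and B: "\<And>x. \<bar>f x\<bar> \<le> B"
    and per: "torus_periodic f" and k: "k \<in> int_lattice"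
  shows "(\<integral>z. of_real (torus_autocorr f z) * torus_char k z \<partial>torus_haar)
       = of_real ((cmod (fourier_coeff f k))\<^sup>2)"
proof -
  let ?H = "torus_haar :: (real ^ 'd) measure"
  interpret H: prob_space ?H by (rule prob_space_torus_haar)
  interpret HH: pair_prob_space ?H ?H ..
  have id [measurable]: "(\<lambda>x. x) \<in> ?H \<rightarrow>\<^sub>M borel"
    unfolding torus_haar_def by (auto intro!: measurable_restrict_space1)
  have s [measurable]: "snd \<in> ?H \<Otimes>\<^sub>M ?H \<rightarrow>\<^sub>M (borel :: (real ^ 'd) measure)"
    "fst \<in> ?H \<Otimes>\<^sub>M ?H \<rightarrow>\<^sub>M (borel :: (real ^ 'd) measure)"
    by (rule measurable_compose[OF measurable_snd id] measurable_compose[OF measurable_fst id])+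
  have B0: "B \<ge> 0" using B[of 0] by linarith
  define G where "G z x = complex_of_real (f x * f (x + z)) * torus_char k z" for z x
  have G: "integrable (?H \<Otimes>\<^sub>M ?H) (\<lambda>(z, x). G z x)"
  proof (rule HH.P.integrable_const_bound[where B = "B * B"])
    show "AE p in ?H \<Otimes>\<^sub>M ?H. norm (case p of (z, x) \<Rightarrow> G z x) \<le> B * B"
      using B B0 by (intro AE_I2) (auto simp: G_def norm_mult intro!: mult_mono)
    show "(\<lambda>(z, x). G z x) \<in> borel_measurable (?H \<Otimes>\<^sub>M ?H)"
      unfolding G_def split_beta by measurable
  qed
  have "(\<integral>z. of_real (torus_autocorr f z) * torus_char k z \<partial>?H) = (\<integral>z. (\<integral>x. G z x \<partial>?H) \<partial>?H)"
    unfolding G_def torus_autocorr_def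
    by (simp only: integral_mult_left_zero integral_complex_of_real)
  also have "\<dots> = (\<integral>x. (\<integral>z. G z x \<partial>?H) \<partial>?H)"
    using HH.Fubini_integral[OF G] by simp
  also have "\<dots> = (\<integral>x. (of_real (f x) * cnj (torus_char k x)) * fourier_coeff f k \<partial>?H)"
  proof (rule Bochner_Integration.integral_cong[OF refl])
    fix x
    have shift: "torus_char k z = cnj (torus_char k x) * torus_char k (z + x)" for z
    proof -
      have "cnj (torus_char k x) * torus_char k x = 1"
        by (simp add: torus_char_def cis_cnj cis_mult)
      then show ?thesis by (simp add: torus_char_add algebra_simps)
    qed
    have "G z x = (of_real (f x) * cnj (torus_char k x)) * (of_real (f (z + x)) * torus_char k (z + x))" for z
      by (simp only: G_def shift[of z] of_real_mult add.commute[of x z] mult_ac)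
    then have "(\<integral>z. G z x \<partial>?H) = (\<integral>z. (of_real (f x) * cnj (torus_char k x)) * (of_real (f (z + x)) * torus_char k (z + x)) \<partial>?H)"
      by simp
    also have "\<dots> = (of_real (f x) * cnj (torus_char k x)) * (\<integral>z. of_real (f (z + x)) * torus_char k (z + x) \<partial>?H)"
      by (rule integral_mult_right_zero)
    also have "(\<integral>z. of_real (f (z + x)) * torus_char k (z + x) \<partial>?H) = fourier_coeff f k"
      unfolding fourier_coeff_def
    proof (rule integral_torus_shift)
      show "torus_periodic (\<lambda>z. complex_of_real (f z) * torus_char k z)"
        using per torus_periodic_char[OF k] by (simp add: torus_periodic_def)
    qed measurable
    finally show "(\<integral>z. G z x \<partial>?H) = (of_real (f x) * cnj (torus_char k x)) * fourier_coeff f k" .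
  qed
  also have "\<dots> = (\<integral>x. cnj (of_real (f x) * torus_char k x) \<partial>?H) * fourier_coeff f k"
    by simp
  also have "\<dots> = cnj (fourier_coeff f k) * fourier_coeff f k"
    unfolding fourier_coeff_def by (simp only: Bochner_Integration.integral_cnj)
  also have "\<dots> = of_real ((cmod (fourier_coeff f k))\<^sup>2)"
    by (simp only: complex_norm_square mult.commute)
  finally show ?thesis .
qed

lemma torus_autocorr_increment:
  fixes f :: "real ^ 'd \<Rightarrow> real"
  assumes f [measurable]: "f \<in> borel_measurable borel" and B: "\<And>x. \<bar>f x\<bar> \<le> B"
    and per: "torus_periodic f"
  shows "(\<integral>x. (f (x + z) - f x)\<^sup>2 \<partial>torus_haar) = 2 * (torus_autocorr f 0 - torus_autocorr f z)"
proof -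
  have B0: "B \<ge> 0" using B[of 0] by linarith
  have int: "integrable torus_haar (\<lambda>x. f (x + a) * f (x + b))" for a b
  proof (rule integrable_torus_bounded)
    show "norm (f (x + a) * f (x + b)) \<le> B * B" for x
      using B B0 by (simp add: abs_mult mult_mono)
  qed measurable
  have "(\<integral>x. (f (x + z) - f x)\<^sup>2 \<partial>torus_haar)
      = (\<integral>x. f (x + z) * f (x + z) + f (x + 0) * f (x + 0) - 2 * (f (x + 0) * f (x + z)) \<partial>torus_haar)"
    by (simp add: power2_eq_square algebra_simps)
  also have "\<dots> = (\<integral>x. f (x + z) * f (x + z) \<partial>torus_haar) + (\<integral>x. f (x + 0) * f (x + 0) \<partial>torus_haar)
                    - 2 * (\<integral>x. f (x + 0) * f (x + z) \<partial>torus_haar)"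
    using int[of z z] int[of 0 0] int[of 0 z] by simp
  also have "(\<integral>x. f (x + z) * f (x + z) \<partial>torus_haar) = (\<integral>x. f x * f x \<partial>torus_haar)"
    using per by (intro integral_torus_shift[where f = "\<lambda>x. f x * f x"]) (auto simp: torus_periodic_def)
  finally show ?thesis by (simp add: torus_autocorr_def)
qed

lemma torus_autocorr_shift:
  fixes f :: "real ^ 'd \<Rightarrow> real"
  assumes f [measurable]: "f \<in> borel_measurable borel" and per: "torus_periodic f"
  shows "(\<integral>x. f (x + a) * f (x + b) \<partial>torus_haar) = torus_autocorr f (b - a)"
proof -
  let ?h = "\<lambda>x. f x * f (x + (b - a))"
  have "(\<integral>x. ?h (x + a) \<partial>torus_haar) = (\<integral>x. ?h x \<partial>torus_haar)"
  proof (rule integral_torus_shift)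
    have "f (x + k + (b - a)) = f (x + (b - a))" if "k \<in> int_lattice" for x k
      using torus_periodicD[OF per that, of "x + (b - a)"] by (simp only: ac_simps)
    then show "torus_periodic ?h" by (simp add: torus_periodic_def torus_periodicD[OF per])
  qed measurable
  then show ?thesis by (simp add: torus_autocorr_def)
qed

lemma torus_periodic_autocorr:
  assumes "torus_periodic f"
  shows "torus_periodic (torus_autocorr f)"
  using torus_periodicD[OF assms] by (simp add: torus_periodic_def torus_autocorr_def flip: add.assoc)

lemma torus_autocorr_le_zero:
  fixes f :: "real ^ 'd \<Rightarrow> real"
  assumes "f \<in> borel_measurable borel" and "\<And>x. \<bar>f x\<bar> \<le> B" and "torus_periodic f"
  shows "torus_autocorr f z \<le> torus_autocorr f 0"
proof -
  have "0 \<le> (\<integral>x. (f (x + z) - f x)\<^sup>2 \<partial>torus_haar)" by (intro Bochner_Integration.integral_nonneg) simp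
  then show ?thesis using torus_autocorr_increment[OF assms] by simp
qed

section \<open>Fejer kernels and the Parseval inequality\<close>

text \<open>
For a large box $J$ of lattice points, the kernel divided by the cardinality of $J$ is an
approximate identity. It is a nonnegative trigonometric polynomial whose integrals against
autocorrelations are visibly bounded by sums of squared Fourier coefficients.
\<close>

definition fejer_kernel :: "(real ^ 'd) set \<Rightarrow> real ^ 'd \<Rightarrow> real" where
  "fejer_kernel J z = (cmod (\<Sum>j\<in>J. torus_char j z))\<^sup>2"

lemma fejer_kernel_nonneg: "fejer_kernel J z \<ge> 0"
  by (simp add: fejer_kernel_def)

lemma fejer_kernel_expand:
  "complex_of_real (fejer_kernel J z) = (\<Sum>j\<in>J. \<Sum>l\<in>J. torus_char (j - l) z)"
proof -
  have "complex_of_real (fejer_kernel J z) = (\<Sum>j\<in>J. torus_char j z) * cnj (\<Sum>j\<in>J. torus_char j z)"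
    by (simp only: fejer_kernel_def complex_norm_square)
  then show ?thesis by (simp add: sum_product torus_char_diff_left)
qed

lemma fejer_kernel_borel [measurable]: "fejer_kernel J \<in> borel_measurable borel"
  unfolding fejer_kernel_def by measurable

lemma fejer_kernel_bound: "\<bar>fejer_kernel J z\<bar> \<le> (real (card J))\<^sup>2"
proof -
  have "cmod (\<Sum>j\<in>J. torus_char j z) \<le> (\<Sum>j\<in>J. 1)"
    by (rule sum_norm_le) simp
  then show ?thesis by (simp add: fejer_kernel_def power_mono)
qed

lemma integral_fejer_kernel_mult:
  fixes g :: "real ^ 'd \<Rightarrow> real"
  assumes g [measurable]: "g \<in> borel_measurable borel" and B: "\<And>x. \<bar>g x\<bar> \<le> B"
  shows "complex_of_real (\<integral>z. fejer_kernel J z * g z \<partial>torus_haar)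
       = (\<Sum>j\<in>J. \<Sum>l\<in>J. \<integral>z. of_real (g z) * torus_char (j - l) z \<partial>torus_haar)"
proof -
  have int: "integrable torus_haar (\<lambda>z. complex_of_real (g z) * torus_char m z)" for m
  proof (rule integrable_torus_bounded)
    show "norm (complex_of_real (g x) * torus_char m x) \<le> B" for x using B by (simp add: norm_mult)
  qed measurable
  have "complex_of_real (\<integral>z. fejer_kernel J z * g z \<partial>torus_haar)
      = (\<integral>z. complex_of_real (fejer_kernel J z * g z) \<partial>torus_haar)"
    by (simp only: integral_complex_of_real)
  also have "\<dots> = (\<integral>z. (\<Sum>j\<in>J. \<Sum>l\<in>J. of_real (g z) * torus_char (j - l) z) \<partial>torus_haar)"
    by (simp add: fejer_kernel_expand sum_distrib_left mult.commute)
  also have "\<dots> = (\<Sum>j\<in>J. \<Sum>l\<in>J. \<integral>z. of_real (g z) * torus_char (j - l) z \<partial>torus_haar)"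
    using int by (simp add: Bochner_Integration.integral_sum Bochner_Integration.integrable_sum)
  finally show ?thesis .
qed

lemma integral_fejer_kernel:
  fixes J :: "(real ^ 'd) set"
  assumes J: "finite J" "J \<subseteq> int_lattice"
  shows "(\<integral>z. fejer_kernel J z \<partial>torus_haar) = real (card J)"
proof -
  have "complex_of_real (\<integral>z. fejer_kernel J z * 1 \<partial>torus_haar)
      = (\<Sum>j\<in>J. \<Sum>l\<in>J. \<integral>z. of_real 1 * torus_char (j - l) z \<partial>torus_haar)"
    by (rule integral_fejer_kernel_mult[where B = 1]) auto
  also have "\<dots> = (\<Sum>j\<in>J. \<Sum>l\<in>J. if l = j then 1 else 0)"
  proof (intro sum.cong refl)
    fix j l assume "j \<in> J" "l \<in> J"
    then have "j - l \<in> int_lattice" using J int_lattice_diff by blast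
    then show "(\<integral>z. of_real 1 * torus_char (j - l) z \<partial>torus_haar) = (if l = j then 1 else 0)"
      by (auto simp: integral_torus_char)
  qed
  also have "\<dots> = of_real (real (card J))" using J by (simp add: sum.delta)
  finally show ?thesis by (simp only: of_real_eq_iff mult_1_right)
qed

text \<open>
Writing the cosine as the mean of the characters of $e$ and $-e$, orthogonality leaves the pairs
$(j, l)$ with $l = j + e$ and those with $j = l + e$, which are equally many.
\<close>

lemma integral_fejer_kernel_cos:
  fixes J :: "(real ^ 'd) set"
  assumes J: "finite J" "J \<subseteq> int_lattice" and e: "e \<in> int_lattice"
  shows "(\<integral>z. fejer_kernel J z * cos (2 * pi * (e \<bullet> z)) \<partial>torus_haar) = real (card {j \<in> J. j + e \<in> J})"
proof -
  have c: "complex_of_real (cos (2 * pi * (e \<bullet> z))) = (torus_char e z + torus_char (- e) z) / 2" for z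
    by (simp add: torus_char_def complex_eq_iff)
  have int: "integrable torus_haar (torus_char m)" for m :: "real ^ 'd"
    by (rule integrable_torus_bounded[where B = 1]) auto
  have m: "(\<integral>z. of_real (cos (2 * pi * (e \<bullet> z))) * torus_char (j - l) z \<partial>torus_haar)
      = ((if l = j + e then 1 else 0) + (if j = l + e then 1 else 0)) / 2" if "j \<in> J" "l \<in> J" for j l
  proof -
    have L: "e + (j - l) \<in> int_lattice" "- e + (j - l) \<in> int_lattice"
      using that J e by (auto intro!: int_lattice_add int_lattice_diff int_lattice_uminus)
    have "(\<integral>z. of_real (cos (2 * pi * (e \<bullet> z))) * torus_char (j - l) z \<partial>torus_haar)
        = (\<integral>z. (torus_char (e + (j - l)) z + torus_char (- e + (j - l)) z) / 2 \<partial>torus_haar)"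
      unfolding c torus_char_add_left[of _ "j - l"] by (simp add: algebra_simps add_divide_distrib)
    also have "\<dots> = ((\<integral>z. torus_char (e + (j - l)) z \<partial>torus_haar) + (\<integral>z. torus_char (- e + (j - l)) z \<partial>torus_haar)) / 2"
      using int by simp
    also have "\<dots> = ((if e + (j - l) = 0 then 1 else 0) + (if - e + (j - l) = 0 then 1 else 0)) / 2"
      by (simp only: integral_torus_char[OF L(1)] integral_torus_char[OF L(2)])
    also have "e + (j - l) = 0 \<longleftrightarrow> l = j + e" by (auto simp: algebra_simps)
    also have "- e + (j - l) = 0 \<longleftrightarrow> j = l + e" by (auto simp: algebra_simps)
    finally show ?thesis .
  qed
  have cnt: "(\<Sum>j\<in>J. \<Sum>l\<in>J. if l = j + e then 1 else 0) = complex_of_nat (card {j \<in> J. j + e \<in> J})"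
  proof -
    have "(\<Sum>j\<in>J. \<Sum>l\<in>J. if l = j + e then 1 else 0) = (\<Sum>j\<in>J. if j + e \<in> J then 1 else (0 :: complex))"
      using J(1) by (simp add: sum.delta)
    also have "\<dots> = of_nat (card {j \<in> J. j + e \<in> J})"
      using J(1) by (simp add: sum.If_cases Int_def)
    finally show ?thesis .
  qed
  have "complex_of_real (\<integral>z. fejer_kernel J z * cos (2 * pi * (e \<bullet> z)) \<partial>torus_haar)
      = (\<Sum>j\<in>J. \<Sum>l\<in>J. \<integral>z. of_real (cos (2 * pi * (e \<bullet> z))) * torus_char (j - l) z \<partial>torus_haar)"
    by (rule integral_fejer_kernel_mult[where B = 1])
       (auto intro!: borel_measurable_continuous_onI continuous_intros)
  also have "\<dots> = (\<Sum>j\<in>J. \<Sum>l\<in>J. ((if l = j + e then 1 else 0) + (if j = l + e then 1 else 0)) / 2)"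
    by (intro sum.cong refl m)
  also have "\<dots> = ((\<Sum>j\<in>J. \<Sum>l\<in>J. if l = j + e then 1 else 0) + (\<Sum>j\<in>J. \<Sum>l\<in>J. if j = l + e then 1 else 0)) / 2"
    by (simp add: sum.distrib flip: sum_divide_distrib)
  also have "(\<Sum>j\<in>J. \<Sum>l\<in>J. if j = l + e then 1 else (0 :: complex)) = (\<Sum>l\<in>J. \<Sum>j\<in>J. if j = l + e then 1 else 0)"
    by (rule sum.swap)
  also have "(\<Sum>j\<in>J. \<Sum>l\<in>J. if l = j + e then 1 else 0) + (\<Sum>l\<in>J. \<Sum>j\<in>J. if j = l + e then 1 else 0)
      = 2 * complex_of_real (real (card {j \<in> J. j + e \<in> J}))"
    unfolding cnt of_real_of_nat_eq by (rule mult_2[symmetric])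
  finally have "complex_of_real (\<integral>z. fejer_kernel J z * cos (2 * pi * (e \<bullet> z)) \<partial>torus_haar)
      = complex_of_real (real (card {j \<in> J. j + e \<in> J}))" by simp
  then show ?thesis by (simp only: of_real_eq_iff)
qed

definition lattice_box :: "nat \<Rightarrow> (real ^ 'd) set" where
  "lattice_box n = (\<lambda>g. \<chi> i. real (g i)) ` PiE UNIV (\<lambda>_. {..<n})"

lemma lattice_box_subset: "lattice_box n \<subseteq> int_lattice"
  by (auto simp: lattice_box_def int_lattice_def)

lemma finite_lattice_box: "finite (lattice_box n)"
  unfolding lattice_box_def by (intro finite_imageI finite_PiE) auto

lemma card_lattice_box: "card (lattice_box n :: (real ^ 'd) set) = n ^ CARD('d)"
proof -
  have "inj (\<lambda>g :: 'd \<Rightarrow> nat. (\<chi> i. real (g i)) :: real ^ 'd)"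
    by (auto simp: inj_on_def vec_eq_iff fun_eq_iff)
  then have "card (lattice_box n :: (real ^ 'd) set) = card (PiE (UNIV :: 'd set) (\<lambda>_. {..<n}))"
    unfolding lattice_box_def by (intro card_image) (auto simp: inj_on_def)
  then show ?thesis by (simp add: card_PiE)
qed

text \<open>
Only the face of the box on which the $i$-th coordinate equals $n - 1$ leaves the box under the
shift.
\<close>

lemma card_lattice_box_shift:
  "real (card (lattice_box n :: (real ^ 'd) set)) - real (card {j \<in> lattice_box n. j + axis i 1 \<in> (lattice_box n :: (real ^ 'd) set)})
    \<le> real n ^ (CARD('d) - 1)"
proof -
  let ?L = "lattice_box n :: (real ^ 'd) set"
  let ?S = "{j \<in> ?L. j + axis i 1 \<in> ?L}"
  let ?P = "PiE UNIV (\<lambda>l. if l = i then {n - 1} else {..<n}) :: ('d \<Rightarrow> nat) set"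
  have sub: "?L - ?S \<subseteq> (\<lambda>g. \<chi> i. real (g i)) ` ?P"
  proof
    fix j assume j: "j \<in> ?L - ?S"
    then obtain g where g: "j = (\<chi> i. real (g i))" "\<And>l. g l < n" by (auto simp: lattice_box_def)
    have "\<not> Suc (g i) < n"
    proof
      assume "Suc (g i) < n"
      then have "g(i := Suc (g i)) \<in> PiE UNIV (\<lambda>_. {..<n})" using g by auto
      moreover have "j + axis i 1 = (\<chi> l. real ((g(i := Suc (g i))) l))"
        by (auto simp: g vec_eq_iff axis_def)
      ultimately have "j + axis i 1 \<in> ?L" unfolding lattice_box_def by blast
      then show False using j by simp
    qed
    then have "g i = n - 1" using g(2)[of i] by simp
    then have "g \<in> ?P" using g(2) by (auto simp: PiE_iff)
    then show "j \<in> (\<lambda>g. \<chi> i. real (g i)) ` ?P" using g(1) by blast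
  qed
  have fin: "finite ?P" by (intro finite_PiE) auto
  have "card ?L - card ?S = card (?L - ?S)"
    using finite_lattice_box by (subst card_Diff_subset) (auto intro: finite_subset)
  also have "\<dots> \<le> card ?P"
    using sub fin by (meson card_image_le card_mono finite_imageI order_trans)
  also have "card ?P = (\<Prod>l\<in>UNIV. if l = i then 1 else n)"
    by (subst card_PiE) (auto intro!: prod.cong)
  also have "\<dots> = n ^ (CARD('d) - 1)"
    by (simp add: prod.If_cases card_Diff_subset Compl_eq_Diff_UNIV)
  finally have "real (card ?L - card ?S) \<le> real (n ^ (CARD('d) - 1))" by (simp only: of_nat_le_iff)
  moreover have "card ?S \<le> card ?L" using finite_lattice_box by (intro card_mono) auto
  ultimately show ?thesis by (simp add: of_nat_diff)
qed

text \<open>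
A trigonometric substitute for the squared distance to the lattice. It measures concentration of
the Fejer kernels at $0$ through finitely many Fourier coefficients instead of pointwise estimates
away from $0$.
\<close>

definition torus_gauge :: "real ^ 'd \<Rightarrow> real" where
  "torus_gauge z = (\<Sum>i\<in>UNIV. 1 - cos (2 * pi * z $ i))"

lemma torus_gauge_nonneg: "torus_gauge z \<ge> 0"
  by (simp add: torus_gauge_def sum_nonneg)

lemma torus_gauge_lower:
  assumes \<delta>: "\<delta> > 0"
  obtains m where "m > 0" "\<And>z :: real ^ 'd. z \<in> torus_cube \<Longrightarrow> norm z \<ge> \<delta> \<Longrightarrow> torus_gauge z \<ge> m"
proof -
  define S where "S = {z :: real ^ 'd. (\<forall>i. - 1 / 2 \<le> z $ i \<and> z $ i \<le> 1 / 2)} \<inter> {z. norm z \<ge> \<delta>}"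
  have S1: "{z :: real ^ 'd. (\<forall>i. - 1 / 2 \<le> z $ i \<and> z $ i \<le> 1 / 2)} = cbox (\<chi> i. - 1 / 2) (\<chi> i. 1 / 2)"
    by (auto simp: mem_box_cart)
  have "compact S" unfolding S_def S1
    by (intro compact_Int_closed compact_cbox closed_Collect_le continuous_intros)
  have sub: "z \<in> S" if "z \<in> torus_cube" "norm z \<ge> \<delta>" for z
    using that by (auto simp: S_def torus_cube_def less_imp_le)
  have pos: "torus_gauge z > 0" if "z \<in> S" for z
  proof (rule ccontr)
    assume "\<not> torus_gauge z > 0"
    then have "torus_gauge z = 0" using torus_gauge_nonneg[of z] by simp
    then have "\<forall>i. 1 - cos (2 * pi * z $ i) = 0"
      unfolding torus_gauge_def by (subst (asm) sum_nonneg_eq_0_iff) auto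
    then have c: "cos (2 * pi * z $ i) = 1" for i by simp
    have "z $ i = 0" for i
    proof -
      obtain n :: int where "2 * pi * z $ i = of_int n * 2 * pi" using c[of i] by (auto simp: cos_one_2pi_int)
      then have n: "z $ i = of_int n" by simp
      have "- 1 / 2 \<le> z $ i" "z $ i \<le> 1 / 2" using that by (auto simp: S_def)
      then have "n = 0" unfolding n by linarith
      then show ?thesis using n by simp
    qed
    then have "z = 0" by (simp add: vec_eq_iff)
    then show False using that \<delta> by (simp add: S_def)
  qed
  show ?thesis
  proof (cases "S = {}")
    case True
    show ?thesis by (rule that[of 1]) (use True sub in auto)
  next
    case False
    have "continuous_on S torus_gauge" unfolding torus_gauge_def by (intro continuous_intros)
    from continuous_attains_inf[OF \<open>compact S\<close> False this]
    obtain z0 where "z0 \<in> S" "\<And>z. z \<in> S \<Longrightarrow> torus_gauge z0 \<le> torus_gauge z" by blast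
    then show ?thesis using that[of "torus_gauge z0"] pos sub by blast
  qed
qed

lemma integral_fejer_kernel_gauge:
  "(\<integral>z. fejer_kernel (lattice_box n :: (real ^ 'd) set) z * torus_gauge z \<partial>torus_haar)
          \<le> real CARD('d) * real n ^ (CARD('d) - 1)"
proof -
  let ?L = "lattice_box n :: (real ^ 'd) set"
  have a: "axis i 1 \<in> (int_lattice :: (real ^ 'd) set)" for i by (auto simp: int_lattice_def axis_def)
  have int: "integrable torus_haar (fejer_kernel ?L)"
    by (rule integrable_torus_bounded) (auto intro: fejer_kernel_bound)
  have intc: "integrable torus_haar (\<lambda>z. fejer_kernel ?L z * cos (2 * pi * (axis i 1 \<bullet> z)))" for i
  proof (rule integrable_torus_bounded)
    show "norm (fejer_kernel ?L z * cos (2 * pi * (axis i 1 \<bullet> z))) \<le> (real (card ?L))\<^sup>2 * 1" for z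
      unfolding real_norm_def abs_mult by (intro mult_mono fejer_kernel_bound) auto
    have [measurable]: "(\<lambda>z :: real ^ 'd. cos (2 * pi * (axis i 1 \<bullet> z))) \<in> borel_measurable borel"
      by (intro borel_measurable_continuous_onI continuous_intros)
    show "(\<lambda>z. fejer_kernel ?L z * cos (2 * pi * (axis i 1 \<bullet> z))) \<in> borel_measurable borel" by measurable
  qed
  have "(\<integral>z. fejer_kernel ?L z * torus_gauge z \<partial>torus_haar)
     = (\<integral>z. (\<Sum>i\<in>UNIV. fejer_kernel ?L z - fejer_kernel ?L z * cos (2 * pi * (axis i 1 \<bullet> z))) \<partial>torus_haar)"
    by (simp add: torus_gauge_def sum_distrib_left right_diff_distrib inner_axis' cong: sum.cong)
  also have "\<dots> = (\<Sum>i\<in>UNIV. real (card ?L) - real (card {j \<in> ?L. j + axis i 1 \<in> ?L}))"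
    using int intc
    by (simp add: Bochner_Integration.integral_sum integral_fejer_kernel[OF finite_lattice_box lattice_box_subset]
        integral_fejer_kernel_cos[OF finite_lattice_box lattice_box_subset a])
  also have "\<dots> \<le> (\<Sum>i\<in>(UNIV :: 'd set). real n ^ (CARD('d) - 1))"
    by (intro sum_mono card_lattice_box_shift)
  finally show ?thesis by simp
qed

text \<open>
Let $A$ be the autocorrelation of $f$, so that $A(0) = \int f^2$. The mean of $A$ with respect to a
normalized Fejer kernel is an average of sums of $|\hat f(j - l)|^2$, hence at most $S$. It
differs from $A(0)$ by the mean of $A(0) - A(z)$, which is small for $z$ near $0$ by the
$L^2$-continuity of translations and is dominated by a multiple of the gauge elsewhere. The mean
of the gauge tends to $0$ as the box grows.
\<close>

lemma parseval_inequality: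
  fixes f :: "real ^ 'd \<Rightarrow> real"
  assumes f [measurable]: "f \<in> borel_measurable borel" and B: "\<And>x. \<bar>f x\<bar> \<le> B"
    and per: "torus_periodic f"
    and mod: "\<And>\<eta>. \<eta> > 0 \<Longrightarrow> \<exists>\<delta>>0. \<forall>z. norm z < \<delta> \<longrightarrow> (\<integral>x. (f (x + z) - f x)\<^sup>2 \<partial>torus_haar) \<le> \<eta>"
    and S: "\<And>K. finite K \<Longrightarrow> K \<subseteq> int_lattice \<Longrightarrow> (\<Sum>k\<in>K. (cmod (fourier_coeff f k))\<^sup>2) \<le> S"
  shows "(\<integral>x. (f x)\<^sup>2 \<partial>torus_haar) \<le> S"
proof -
  let ?A = "torus_autocorr f"
  have A0: "?A 0 = (\<integral>x. (f x)\<^sup>2 \<partial>torus_haar)" by (simp add: torus_autocorr_def power2_eq_square)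
  have Ab: "\<bar>?A z\<bar> \<le> B * B" for z by (rule torus_autocorr_bound[OF f B])
  have incr: "?A 0 - ?A z = (\<integral>x. (f (x + z) - f x)\<^sup>2 \<partial>torus_haar) / 2" for z
    using torus_autocorr_increment[OF f B per, of z] by simp
  have "?A 0 \<le> S + \<eta>" if \<eta>: "\<eta> > 0" for \<eta>
  proof -
    obtain \<delta> where \<delta>: "\<delta> > 0" "\<And>z. norm z < \<delta> \<Longrightarrow> ?A 0 - ?A z \<le> \<eta> / 2"
      using mod[OF \<eta>] unfolding incr by (metis divide_right_mono zero_le_numeral)
    obtain m where m: "m > 0" "\<And>z :: real ^ 'd. z \<in> torus_cube \<Longrightarrow> norm z \<ge> \<delta> \<Longrightarrow> torus_gauge z \<ge> m"
      using torus_gauge_lower[OF \<delta>(1)] by blast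
    define C where "C = 2 * (B * B) / m"
    have BB: "B * B \<ge> 0" by simp
    have C: "C \<ge> 0" using m BB by (simp add: C_def)
    have dom: "?A 0 - ?A z \<le> \<eta> / 2 + C * torus_gauge z" if "z \<in> torus_cube" for z
    proof (cases "norm z < \<delta>")
      case True
      then show ?thesis using \<delta>(2)[OF True] C torus_gauge_nonneg[of z] by (simp add: add_increasing2)
    next
      case False
      have "?A 0 - ?A z \<le> 2 * (B * B)" using Ab[of 0] Ab[of z] by linarith
      also have "\<dots> = C * m" using m by (simp add: C_def)
      also have "\<dots> \<le> C * torus_gauge z" using m(2)[OF that] False C by (intro mult_left_mono) auto
      finally show ?thesis using \<eta> by simp
    qed
    \<comment> \<open>The normalized kernel of the box of side $n$ gives the gauge a mean of at most $d / n$.\<close>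
    obtain n where n: "n > 0" "C * real CARD('d) / real n \<le> \<eta> / 2"
    proof -
      obtain n where n: "real n > 2 * C * real CARD('d) / \<eta>" using reals_Archimedean2 by blast
      have "2 * C * real CARD('d) / \<eta> \<ge> 0" using C \<eta> by simp
      then have n0: "n > 0" using n by (cases n) auto
      have "C * real CARD('d) / real n \<le> \<eta> / 2" using n n0 \<eta> by (simp add: field_simps)
      then show ?thesis using that n0 by blast
    qed
    define L where "L = (lattice_box n :: (real ^ 'd) set)"
    have L: "finite L" "L \<subseteq> int_lattice" by (simp_all add: L_def finite_lattice_box lattice_box_subset)
    have cL: "real (card L) = real n ^ CARD('d)" by (simp add: L_def card_lattice_box)
    have cLpos: "real (card L) > 0" using n by (simp add: cL)
    have intK: "integrable torus_haar (fejer_kernel L)"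
      by (rule integrable_torus_bounded) (auto intro: fejer_kernel_bound)
    have gm [measurable]: "(torus_gauge :: real ^ 'd \<Rightarrow> real) \<in> borel_measurable borel"
      unfolding torus_gauge_def by (intro borel_measurable_continuous_onI continuous_intros)
    have intKg: "integrable torus_haar (\<lambda>z. fejer_kernel L z * g z)"
      if [measurable]: "g \<in> borel_measurable borel" and b: "\<And>z. \<bar>g z\<bar> \<le> b" for g :: "real ^ 'd \<Rightarrow> real" and b
    proof (rule integrable_torus_bounded)
      show "norm (fejer_kernel L z * g z) \<le> (real (card L))\<^sup>2 * b" for z
        unfolding real_norm_def abs_mult by (intro mult_mono fejer_kernel_bound b) auto
    qed measurable
    have iA: "integrable torus_haar (\<lambda>z. fejer_kernel L z * ?A z)" by (rule intKg[OF _ Ab]) measurable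
    have iG: "integrable torus_haar (\<lambda>z. fejer_kernel L z * torus_gauge z)"
    proof (rule intKg[OF gm])
      fix z :: "real ^ 'd"
      have "torus_gauge z \<le> (\<Sum>i\<in>(UNIV :: 'd set). 2)"
        unfolding torus_gauge_def
      proof (rule sum_mono)
        show "1 - cos (2 * pi * z $ i) \<le> 2" for i using cos_ge_minus_one[of "2 * pi * z $ i"] by linarith
      qed
      then show "\<bar>torus_gauge z\<bar> \<le> 2 * real CARD('d)" using torus_gauge_nonneg[of z] by simp
    qed
    have KA: "(\<integral>z. fejer_kernel L z * ?A z \<partial>torus_haar) \<le> real (card L) * S"
    proof -
      have "complex_of_real (\<integral>z. fejer_kernel L z * ?A z \<partial>torus_haar)
          = (\<Sum>j\<in>L. \<Sum>l\<in>L. \<integral>z. of_real (?A z) * torus_char (j - l) z \<partial>torus_haar)"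
        by (rule integral_fejer_kernel_mult[OF _ Ab]) measurable
      also have "\<dots> = (\<Sum>j\<in>L. \<Sum>l\<in>L. of_real ((cmod (fourier_coeff f (j - l)))\<^sup>2))"
        using L by (intro sum.cong refl integral_torus_autocorr_char[OF f B per]) (auto intro!: int_lattice_diff)
      also have "\<dots> = of_real (\<Sum>j\<in>L. \<Sum>l\<in>L. (cmod (fourier_coeff f (j - l)))\<^sup>2)" by simp
      finally have "(\<integral>z. fejer_kernel L z * ?A z \<partial>torus_haar) = (\<Sum>j\<in>L. \<Sum>l\<in>L. (cmod (fourier_coeff f (j - l)))\<^sup>2)"
        by (simp only: of_real_eq_iff)
      also have "\<dots> \<le> (\<Sum>j\<in>L. S)"
      proof (rule sum_mono)
        fix j assume j: "j \<in> L"
        have "(\<Sum>l\<in>L. (cmod (fourier_coeff f (j - l)))\<^sup>2) = (\<Sum>k\<in>(\<lambda>l. j - l) ` L. (cmod (fourier_coeff f k))\<^sup>2)"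
          by (subst sum.reindex) (auto simp: inj_on_def)
        also have "\<dots> \<le> S" using L j by (intro S) (auto intro!: int_lattice_diff)
        finally show "(\<Sum>l\<in>L. (cmod (fourier_coeff f (j - l)))\<^sup>2) \<le> S" .
      qed
      finally show ?thesis by simp
    qed
    have "real (card L) * ?A 0 - (\<integral>z. fejer_kernel L z * ?A z \<partial>torus_haar)
        = (\<integral>z. fejer_kernel L z * (?A 0 - ?A z) \<partial>torus_haar)"
      using intK iA by (simp add: right_diff_distrib integral_fejer_kernel[OF L])
    also have "\<dots> \<le> (\<integral>z. fejer_kernel L z * (\<eta> / 2) + C * (fejer_kernel L z * torus_gauge z) \<partial>torus_haar)"
    proof (rule integral_mono)
      show "integrable torus_haar (\<lambda>z. fejer_kernel L z * (?A 0 - ?A z))"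
        using intK iA by (simp add: right_diff_distrib)
      show "integrable torus_haar (\<lambda>z. fejer_kernel L z * (\<eta> / 2) + C * (fejer_kernel L z * torus_gauge z))"
        using intK iG by simp
      fix z :: "real ^ 'd" assume "z \<in> space torus_haar"
      then have "fejer_kernel L z * (?A 0 - ?A z) \<le> fejer_kernel L z * (\<eta> / 2 + C * torus_gauge z)"
        by (intro mult_left_mono dom fejer_kernel_nonneg) simp
      then show "fejer_kernel L z * (?A 0 - ?A z) \<le> fejer_kernel L z * (\<eta> / 2) + C * (fejer_kernel L z * torus_gauge z)"
        by (simp add: algebra_simps)
    qed
    also have "\<dots> = real (card L) * (\<eta> / 2) + C * (\<integral>z. fejer_kernel L z * torus_gauge z \<partial>torus_haar)"
      using intK iG by (simp add: integral_fejer_kernel[OF L])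
    also have "\<dots> \<le> real (card L) * (\<eta> / 2) + C * (real CARD('d) * real n ^ (CARD('d) - 1))"
      using integral_fejer_kernel_gauge[of n, where 'd = 'd] C
      by (intro add_left_mono mult_left_mono) (auto simp: L_def)
    also have "real n ^ (CARD('d) - 1) = real (card L) / real n"
      using n by (simp add: cL power_diff)
    also have "real (card L) * (\<eta> / 2) + C * (real CARD('d) * (real (card L) / real n))
        = real (card L) * (\<eta> / 2 + C * real CARD('d) / real n)" by (simp add: algebra_simps)
    also have "\<dots> \<le> real (card L) * \<eta>"
    proof (rule mult_left_mono)
      show "\<eta> / 2 + C * real CARD('d) / real n \<le> \<eta>" using n(2) by linarith
    qed auto
    finally have "real (card L) * ?A 0 \<le> real (card L) * (S + \<eta>)" using KA by (simp add: algebra_simps)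
    then show ?thesis using cLpos by simp
  qed
  then have "?A 0 \<le> S" by (rule field_le_epsilon)
  then show ?thesis by (simp add: A0)
qed

section \<open>The ball in the torus\<close>

definition periodic_ball :: "real \<Rightarrow> (real ^ 'd) set" where
  "periodic_ball r = {x. \<exists>k\<in>int_lattice. norm (x - k) \<le> r}"

lemma periodic_ball_sets [measurable]: "periodic_ball r \<in> sets (borel :: (real ^ 'd) measure)"
proof -
  have "periodic_ball r = (\<Union>k\<in>int_lattice. cball (k :: real ^ 'd) r)"
    by (auto simp: periodic_ball_def dist_norm norm_minus_commute)
  also have "\<dots> \<in> sets borel"
    by (rule sets.countable_UN''[OF countable_int_lattice]) auto
  finally show ?thesis .
qed

lemma periodic_ball_add:
  assumes "l \<in> int_lattice"
  shows "x + l \<in> periodic_ball r \<longleftrightarrow> x \<in> periodic_ball r"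
proof
  assume "x + l \<in> periodic_ball r"
  then obtain k where k: "k \<in> int_lattice" "norm (x + l - k) \<le> r" by (auto simp: periodic_ball_def)
  have "x - (k - l) = x + l - k" by simp
  then show "x \<in> periodic_ball r"
    using k assms int_lattice_diff unfolding periodic_ball_def by (metis (mono_tags, lifting) mem_Collect_eq)
next
  assume "x \<in> periodic_ball r"
  then obtain k where k: "k \<in> int_lattice" "norm (x - k) \<le> r" by (auto simp: periodic_ball_def)
  have "x + l - (k + l) = x - k" by simp
  then show "x + l \<in> periodic_ball r"
    using k assms int_lattice_add unfolding periodic_ball_def by (metis (mono_tags, lifting) mem_Collect_eq)
qed

lemma cball_subset_torus_cube:
  assumes "r < 1 / 2"
  shows "cball 0 r \<subseteq> (torus_cube :: (real ^ 'd) set)"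
proof
  fix x :: "real ^ 'd" assume "x \<in> cball 0 r"
  then have "\<bar>x $ i\<bar> < 1 / 2" for i using component_le_norm_cart[of x i] assms by simp
  then have "- (1 / 2) < x $ i \<and> x $ i < 1 / 2" for i by (meson abs_less_iff minus_less_iff)
  then show "x \<in> torus_cube" by (auto simp: torus_cube_def less_imp_le)
qed

text \<open>
Since $r < 1/2$, different lattice translates of the ball do not overlap, and the one around the
origin lies inside the cube.
\<close>

lemma torus_cube_near_lattice:
  assumes "r < 1 / 2" "x \<in> torus_cube" "k \<in> int_lattice" "norm (x - k) \<le> r"
  shows "k = 0"
proof -
  have "x - k \<in> torus_cube" using cball_subset_torus_cube[OF assms(1)] assms(4) by auto
  from torus_red_unique[OF assms(3) this] torus_red_id[OF assms(2)] show ?thesis by simp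
qed

lemma periodic_ball_cube:
  assumes "r < 1 / 2" "x \<in> torus_cube"
  shows "x \<in> periodic_ball r \<longleftrightarrow> x \<in> cball 0 r"
proof
  assume "x \<in> periodic_ball r"
  then obtain k where k: "k \<in> int_lattice" "norm (x - k) \<le> r" by (auto simp: periodic_ball_def)
  with torus_cube_near_lattice[OF assms k] show "x \<in> cball 0 r" by simp
next
  assume "x \<in> cball 0 r"
  moreover have "0 \<in> int_lattice" by (simp add: int_lattice_def)
  ultimately show "x \<in> periodic_ball r"
    unfolding periodic_ball_def by (intro CollectI bexI[of _ 0]) auto
qed

lemma indicator_torus_shifted_ball:
  assumes "r > 0" "w \<in> torus_cube"
  shows "indicat_real (torus_shifted_ball r t) w = indicat_real (periodic_ball r) (w + t)"
proof -
  have "(\<lambda>x. r *\<^sub>R x) ` cball 0 1 = cball (0 :: real ^ 'a) r"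
    using cball_scale[of r "0 :: real ^ 'a" 1] assms by simp
  then show ?thesis using assms
    by (auto simp: torus_shifted_ball_def periodic_ball_def indicator_def)
qed

lemma integral_torus_indicator_ball:
  fixes g :: "real ^ 'd \<Rightarrow> 'b::{banach, second_countable_topology}"
  assumes r: "r < 1 / 2"
  shows "(\<integral>x. indicat_real (periodic_ball r) x *\<^sub>R g x \<partial>torus_haar) = (\<integral>x. g x \<partial>ball_lebesgue r)"
proof -
  have "(\<integral>x. indicat_real (periodic_ball r) x *\<^sub>R g x \<partial>torus_haar)
      = (\<integral>x. indicat_real torus_cube x *\<^sub>R (indicat_real (periodic_ball r) x *\<^sub>R g x) \<partial>lborel)"
    unfolding torus_haar_def by (rule integral_restrict_space) simp
  also have "\<dots> = (\<integral>x. indicat_real (cball 0 r) x *\<^sub>R g x \<partial>lborel)"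
    using periodic_ball_cube[OF r] cball_subset_torus_cube[OF r]
    by (intro Bochner_Integration.integral_cong refl) (auto simp: indicator_def simp del: mem_cball)
  also have "\<dots> = (\<integral>x. g x \<partial>ball_lebesgue r)"
    unfolding ball_lebesgue_def by (rule integral_restrict_space[symmetric]) simp
  finally show ?thesis .
qed

lemma power_diff_le:
  fixes a b :: real
  assumes "0 \<le> b" "b \<le> a" "a \<le> 1"
  shows "a ^ n - b ^ n \<le> real n * (a - b)"
proof (induction n)
  case (Suc n)
  have "a ^ Suc n - b ^ Suc n = a * (a ^ n - b ^ n) + b ^ n * (a - b)" by (simp add: algebra_simps)
  also have "\<dots> \<le> 1 * (a ^ n - b ^ n) + 1 * (a - b)"
    using assms by (intro add_mono mult_right_mono power_le_one) (auto intro: power_mono)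
  also have "\<dots> \<le> real (Suc n) * (a - b)" using Suc by (simp add: algebra_simps)
  finally show ?case .
qed simp

lemma measure_spherical_shell:
  fixes h :: real
  assumes "0 \<le> h" "h < r" "r + h \<le> 1"
  shows "measure lborel {x :: 'a::euclidean_space. r - h \<le> norm x \<and> norm x \<le> r + h}
           \<le> 2 * unit_ball_vol (real DIM('a)) * real DIM('a) * h"
proof -
  let ?S = "{x :: 'a. r - h \<le> norm x \<and> norm x \<le> r + h}"
  have eq: "?S = cball 0 (r + h) - ball 0 (r - h)" by auto
  have sub: "ball (0 :: 'a) (r - h) \<subseteq> cball 0 (r + h)" using assms by auto
  have fin: "emeasure lborel (cball (0 :: 'a) (r + h)) \<noteq> \<infinity>"
    using emeasure_bounded_finite[OF bounded_cball, of "0 :: 'a" "r + h"] by simp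
  have "measure lborel ?S = measure lborel (cball (0 :: 'a) (r + h)) - measure lborel (ball (0 :: 'a) (r - h))"
    unfolding eq by (rule measure_Diff[OF fin _ _ sub]) auto
  also have "\<dots> = unit_ball_vol (real DIM('a)) * ((r + h) ^ DIM('a) - (r - h) ^ DIM('a))"
    using assms by (simp add: content_cball content_ball algebra_simps)
  also have "\<dots> \<le> unit_ball_vol (real DIM('a)) * (real DIM('a) * ((r + h) - (r - h)))"
    using assms by (intro mult_left_mono power_diff_le) auto
  finally show ?thesis by (simp add: algebra_simps)
qed

text \<open>
The ball and its translate by $h$ differ only within distance $|h|$ of the sphere. For small $|h|$
this shell stays inside the cube, and its volume is $O(|h|)$; for other $h$ the integral is at most
$1$.
\<close>

lemma periodic_ball_modulus:
  assumes r: "0 < r" "r < 1 / 2"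
  obtains C where "C > 0"
    "\<And>h :: real ^ 'd. (\<integral>x. (indicat_real (periodic_ball r) (x + h) - indicat_real (periodic_ball r) x)\<^sup>2 \<partial>torus_haar) \<le> C * norm h"
proof -
  interpret prob_space "torus_haar :: (real ^ 'd) measure" by (rule prob_space_torus_haar)
  let ?f = "indicat_real (periodic_ball r :: (real ^ 'd) set)"
  \<comment> \<open>The shell must neither contain the origin nor reach the boundary of the cube.\<close>
  define \<delta> where "\<delta> = min (r / 2) ((1 / 2 - r) / 2)"
  define V where "V = 2 * unit_ball_vol (real DIM(real ^ 'd)) * real DIM(real ^ 'd)"
  have \<delta>: "\<delta> > 0" "\<delta> < r" "r + \<delta> < 1 / 2" using r by (auto simp: \<delta>_def min_def field_simps)
  have V: "V \<ge> 0" by (simp add: V_def)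
  have int: "integrable torus_haar (\<lambda>x. (?f (x + h) - ?f x)\<^sup>2)" for h
    by (rule integrable_torus_bounded[where B = 1]) (auto simp: indicator_def)
  have "(\<integral>x. (?f (x + h) - ?f x)\<^sup>2 \<partial>torus_haar) \<le> (V + 1 / \<delta>) * norm h" for h
  proof (cases "norm h < \<delta>")
    case True
    define S where "S = {x :: real ^ 'd. r - norm h \<le> norm x \<and> norm x \<le> r + norm h}"
    have Sb: "S \<in> sets borel" unfolding S_def
      by (intro borel_closed closed_Collect_conj closed_Collect_le continuous_intros)
    have Sc: "S \<subseteq> cball 0 (r + norm h)" by (auto simp: S_def)
    also have "\<dots> \<subseteq> torus_cube" using True \<delta> by (intro cball_subset_torus_cube) auto
    finally have Sq: "S \<subseteq> torus_cube" .
    have S: "x \<in> S" if x: "x \<in> torus_cube" and ne: "?f (x + h) \<noteq> ?f x" for x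
    proof -
      obtain k where k: "k \<in> int_lattice" "r - norm h \<le> norm (x - k)" "norm (x - k) \<le> r + norm h"
      proof (cases "x \<in> periodic_ball r")
        case T: True
        then obtain k where k: "k \<in> int_lattice" "norm (x - k) \<le> r" by (auto simp: periodic_ball_def)
        have "x + h \<notin> periodic_ball r" using ne T by (auto simp: indicator_def)
        then have "norm (x + h - k) > r" using k(1) by (auto simp: periodic_ball_def not_le)
        moreover have "norm (x + h - k) \<le> norm (x - k) + norm h"
          using norm_triangle_ineq[of "x - k" h] by (simp add: algebra_simps)
        ultimately have "r - norm h \<le> norm (x - k)" by linarith
        moreover have "norm (x - k) \<le> r + norm h" using k(2) norm_ge_zero[of h] by linarith
        ultimately show ?thesis using that k(1) by blast
      next
        case F: False
        then have "x + h \<in> periodic_ball r" using ne by (auto simp: indicator_def split: if_splits)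
        then obtain k where k: "k \<in> int_lattice" "norm (x + h - k) \<le> r" by (auto simp: periodic_ball_def)
        have "norm (x - k) > r" using F k(1) by (auto simp: periodic_ball_def not_le)
        then have "r - norm h \<le> norm (x - k)" using norm_ge_zero[of h] by linarith
        moreover have "norm (x - k) \<le> norm (x + h - k) + norm h"
          using norm_triangle_ineq4[of "x + h - k" h] by (simp add: algebra_simps)
        then have "norm (x - k) \<le> r + norm h" using k(2) by linarith
        ultimately show ?thesis using that k(1) by blast
      qed
      moreover have "k = 0" by (rule torus_cube_near_lattice[OF _ x k(1,3)]) (use True \<delta> in linarith)
      ultimately show ?thesis by (simp add: S_def)
    qed
    have "(\<integral>x. (?f (x + h) - ?f x)\<^sup>2 \<partial>torus_haar) \<le> (\<integral>x. indicat_real S x \<partial>torus_haar)"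
    proof (rule integral_mono[OF int])
      show "integrable torus_haar (indicat_real S)"
        by (rule integrable_torus_bounded[where B = 1]) (use Sb in \<open>auto simp: indicator_def\<close>)
      show "(?f (x + h) - ?f x)\<^sup>2 \<le> indicat_real S x" if "x \<in> space torus_haar" for x
        using S[of x] that by (cases "?f (x + h) = ?f x") (auto simp: indicator_def split: if_splits)
    qed
    also have "\<dots> = (\<integral>x. indicat_real torus_cube x *\<^sub>R indicat_real S x \<partial>lborel)"
      unfolding torus_haar_def by (rule integral_restrict_space) simp
    also have "\<dots> = (\<integral>x. indicat_real S x \<partial>lborel)"
      using Sq by (intro Bochner_Integration.integral_cong refl) (auto simp: indicator_def)
    also have "\<dots> = measure lborel S" using Sb by simp
    also have "\<dots> \<le> V * norm h"
      unfolding S_def V_def using True \<delta> by (intro measure_spherical_shell) auto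
    also have "\<dots> \<le> (V + 1 / \<delta>) * norm h" using \<delta> by (intro mult_right_mono) auto
    finally show ?thesis .
  next
    case False
    have "(\<integral>x. (?f (x + h) - ?f x)\<^sup>2 \<partial>torus_haar) \<le> 1"
      by (rule integral_le_const[OF int]) (auto simp: indicator_def)
    also have "1 \<le> (1 / \<delta>) * norm h" using False \<delta> by (simp add: field_simps)
    also have "\<dots> \<le> (V + 1 / \<delta>) * norm h" using V by (intro mult_right_mono) auto
    finally show ?thesis .
  qed
  moreover have "V + 1 / \<delta> > 0" using V \<delta> by (simp add: add_nonneg_pos)
  ultimately show ?thesis using that by blast
qed

text \<open>
The imaginary part is covered by the phase $\psi = - \pi / 2$ in ball_fourier_decay.
\<close>

lemma fourier_coeff_ball_decay:
  assumes r: "0 < r" "r < 1 / 2"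
  obtains C where "C > 0"
    "\<And>k :: real ^ 'd. k \<noteq> 0 \<Longrightarrow>
      (cmod (fourier_coeff (indicat_real (periodic_ball r)) k))\<^sup>2 \<le> C / norm k ^ Suc CARD('d)"
proof -
  obtain C where C: "C > 0" "\<And>k \<psi>. k \<noteq> (0 :: real ^ 'd) \<Longrightarrow>
      (\<integral>x. cos (k \<bullet> x + \<psi>) \<partial>ball_lebesgue r)\<^sup>2 \<le> C / norm k ^ Suc DIM(real ^ 'd)"
    using ball_fourier_decay[OF r(1), where 'a = "real ^ 'd"] by blast
  have "(cmod (fourier_coeff (indicat_real (periodic_ball r)) k))\<^sup>2 \<le> 2 * C / norm k ^ Suc CARD('d)"
    if k: "k \<noteq> 0" for k :: "real ^ 'd"
  proof -
    let ?k = "(2 * pi) *\<^sub>R k"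
    have eq: "fourier_coeff (indicat_real (periodic_ball r)) k = (\<integral>x. torus_char k x \<partial>ball_lebesgue r)"
      unfolding fourier_coeff_def integral_torus_indicator_ball[OF r(2), symmetric] by (simp add: scaleR_conv_of_real)
    have int: "integrable (ball_lebesgue r) (torus_char k)"
    proof -
      interpret finite_measure "ball_lebesgue r :: (real ^ 'd) measure" by (rule finite_measure_ball_lebesgue)
      have "torus_char k \<in> borel_measurable (ball_lebesgue r)"
        unfolding ball_lebesgue_def by (intro measurable_restrict_space1) simp
      then show ?thesis by (intro integrable_const_bound[where B = 1]) auto
    qed
    have re: "Re (fourier_coeff (indicat_real (periodic_ball r)) k) = (\<integral>x. cos (?k \<bullet> x + 0) \<partial>ball_lebesgue r)"
      unfolding eq Bochner_Integration.integral_Re[OF int, symmetric] by (simp add: torus_char_def)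
    have im: "Im (fourier_coeff (indicat_real (periodic_ball r)) k) = (\<integral>x. cos (?k \<bullet> x + (- (pi / 2))) \<partial>ball_lebesgue r)"
      unfolding eq Bochner_Integration.integral_Im[OF int, symmetric] by (simp add: torus_char_def cos_diff)
    have "(cmod (fourier_coeff (indicat_real (periodic_ball r)) k))\<^sup>2
        \<le> C / norm ?k ^ Suc DIM(real ^ 'd) + C / norm ?k ^ Suc DIM(real ^ 'd)"
      unfolding cmod_power2 re im using k by (intro add_mono C(2)) simp_all
    also have "\<dots> \<le> C / norm k ^ Suc CARD('d) + C / norm k ^ Suc CARD('d)"
    proof -
      have "norm k \<le> norm ?k" using pi_gt3 by (simp add: mult_le_cancel_right1)
      then have "norm k ^ Suc CARD('d) \<le> norm ?k ^ Suc CARD('d)" by (intro power_mono) auto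
      then have "C / norm ?k ^ Suc CARD('d) \<le> C / norm k ^ Suc CARD('d)"
        using C(1) k by (intro divide_left_mono) auto
      then show ?thesis by (intro add_mono) auto
    qed
    finally show ?thesis by (simp add: field_simps)
  qed
  then show ?thesis using that[of "2 * C"] C(1) by simp
qed

section \<open>A lattice sum\<close>

lemma sum_powr_bounded:
  fixes s :: real
  assumes "s > 1"
  obtains T where "T > 0" "\<And>L :: nat. (\<Sum>n\<in>{- int L..int L}. 1 / (max 1 \<bar>real_of_int n\<bar>) powr s) \<le> T"
proof -
  let ?g = "\<lambda>n :: nat. 1 / (max 1 (real n)) powr s"
  define T where "T = 1 + (\<Sum>n. real n powr (- s))"
  have summ: "summable (\<lambda>n. real n powr (- s))" using assms by (simp add: summable_real_powr_iff)
  have nat: "(\<Sum>n\<le>L. ?g n) \<le> T" for L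
  proof -
    have "(\<Sum>n\<le>L. ?g n) \<le> (\<Sum>n\<le>L. (if n = 0 then 1 else 0) + real n powr (- s))"
      by (intro sum_mono) (auto simp: powr_minus_divide max_def)
    also have "\<dots> = 1 + (\<Sum>n\<le>L. real n powr (- s))" by (simp add: sum.distrib)
    also have "\<dots> \<le> T" unfolding T_def using summ by (intro add_left_mono sum_le_suminf) auto
    finally show ?thesis .
  qed
  have "(\<Sum>n\<in>{- int L..int L}. 1 / (max 1 \<bar>real_of_int n\<bar>) powr s) \<le> 2 * T" for L :: nat
  proof -
    let ?h = "\<lambda>n :: int. 1 / (max 1 \<bar>real_of_int n\<bar>) powr s"
    have "{- int L..int L} \<subseteq> int ` {..L} \<union> (\<lambda>n. - int n) ` {..L}"
    proof
      fix n assume n: "n \<in> {- int L..int L}"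
      show "n \<in> int ` {..L} \<union> (\<lambda>n. - int n) ` {..L}"
      proof (cases "n \<ge> 0")
        case True
        then have "n = int (nat n)" "nat n \<le> L" using n by auto
        then show ?thesis by blast
      next
        case False
        then have "n = - int (nat (- n))" "nat (- n) \<le> L" using n by auto
        then show ?thesis by blast
      qed
    qed
    then have "sum ?h {- int L..int L} \<le> sum ?h (int ` {..L} \<union> (\<lambda>n. - int n) ` {..L})"
      by (intro sum_mono2) auto
    also have "\<dots> \<le> sum ?h (int ` {..L}) + sum ?h ((\<lambda>n. - int n) ` {..L})"
      by (subst sum_Un) (auto intro!: sum_nonneg)
    also have "\<dots> = (\<Sum>n\<le>L. ?g n) + (\<Sum>n\<le>L. ?g n)"
      by (subst (1 2) sum.reindex) (auto simp: inj_on_def)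
    also have "\<dots> \<le> 2 * T" using nat[of L] by simp
    finally show ?thesis .
  qed
  moreover have "2 * T > 0" using suminf_nonneg[OF summ] by (simp add: T_def)
  ultimately show ?thesis using that by blast
qed

text \<open>
For a nonzero lattice vector, $|k| \ge \max(1, |k_i|)$ for every coordinate. Distributing the
$d + 1$ factors $|k|$ evenly over the $d$ coordinates bounds the summand by a product of
one-dimensional terms with exponent $s = (d + 1) / d > 1$, whose sum factorizes.
\<close>

lemma lattice_sum_bounded:
  obtains T where "T > 0"
    "\<And>K :: (real ^ 'd) set. finite K \<Longrightarrow> K \<subseteq> int_lattice - {0} \<Longrightarrow> (\<Sum>k\<in>K. 1 / norm k ^ Suc CARD('d)) \<le> T"
proof -
  define s where "s = real (Suc CARD('d)) / real CARD('d)"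
  have s: "s > 1" by (simp add: s_def)
  obtain T where T: "T > 0" "\<And>L :: nat. (\<Sum>n\<in>{- int L..int L}. 1 / (max 1 \<bar>real_of_int n\<bar>) powr s) \<le> T"
    using sum_powr_bounded[OF s] by blast
  have "(\<Sum>k\<in>K. 1 / norm k ^ Suc CARD('d)) \<le> T ^ CARD('d)"
    if K: "finite K" "K \<subseteq> int_lattice - {0}" for K :: "(real ^ 'd) set"
  proof -
    define q where "q k = (\<lambda>i. \<lfloor>k $ i\<rfloor>)" for k :: "real ^ 'd"
    have qk: "of_int (q k i) = k $ i" if "k \<in> K" for k i
    proof -
      have "k $ i \<in> \<int>" using that K by (auto simp: int_lattice_def)
      then show ?thesis by (auto simp: q_def elim: Ints_cases)
    qed
    obtain L :: nat where L: "\<And>k i. k \<in> K \<Longrightarrow> \<bar>q k i\<bar> \<le> int L"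
    proof -
      let ?A = "(\<lambda>(k, i). nat \<bar>q k i\<bar>) ` (K \<times> (UNIV :: 'd set))"
      have "finite ?A" using K by auto
      then have "nat \<bar>q k i\<bar> \<le> Max ?A" if "k \<in> K" for k i
        using that by (intro Max_ge) auto
      then have "\<bar>q k i\<bar> \<le> int (Max ?A)" if "k \<in> K" for k i
        using that by (simp only: nat_le_iff)
      then show ?thesis by (rule that)
    qed
    let ?B = "PiE (UNIV :: 'd set) (\<lambda>_. {- int L..int L})"
    let ?p = "\<lambda>g. \<Prod>i\<in>(UNIV :: 'd set). 1 / (max 1 \<bar>real_of_int (g i)\<bar>) powr s"
    have summand: "1 / norm k ^ Suc CARD('d) \<le> ?p (q k)" if k: "k \<in> K" for k
    proof -
      have "k \<noteq> 0" using k K by auto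
      then obtain j where j: "k $ j \<noteq> 0" by (auto simp: vec_eq_iff)
      have "\<bar>k $ j\<bar> \<ge> 1"
      proof -
        have "q k j \<noteq> 0" using j qk[OF k, of j] by auto
        then have "\<bar>q k j\<bar> \<ge> 1" by linarith
        then show ?thesis unfolding qk[OF k, symmetric] by linarith
      qed
      then have n1: "norm k \<ge> 1" using component_le_norm_cart[of k j] by linarith
      have "(\<Prod>i\<in>(UNIV :: 'd set). (max 1 \<bar>real_of_int (q k i)\<bar>) powr s) \<le> (\<Prod>i\<in>(UNIV :: 'd set). norm k powr s)"
        using s n1 component_le_norm_cart[of k] by (intro prod_mono) (auto simp: qk[OF k] intro!: powr_mono2)
      also have "\<dots> = norm k ^ Suc CARD('d)"
      proof -
        have "(\<Prod>i\<in>(UNIV :: 'd set). norm k powr s) = (norm k powr s) powr real CARD('d)"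
        proof (subst powr_realpow)
          show "0 < norm k powr s" unfolding powr_gt_zero using n1 by linarith
        qed simp
        also have "\<dots> = norm k powr real (Suc CARD('d))" by (simp add: powr_powr s_def)
        also have "\<dots> = norm k ^ Suc CARD('d)" using n1 by (subst powr_realpow) auto
        finally show ?thesis .
      qed
      finally have "1 / norm k ^ Suc CARD('d) \<le> 1 / (\<Prod>i\<in>(UNIV :: 'd set). (max 1 \<bar>real_of_int (q k i)\<bar>) powr s)"
        using less_le_trans[OF zero_less_one n1]
        by (intro divide_left_mono mult_pos_pos prod_pos zero_less_power) auto
      then show ?thesis by (simp add: prod_dividef)
    qed
    have inj: "inj_on q K" using qk by (auto simp: inj_on_def vec_eq_iff) (metis)
    have "(\<Sum>k\<in>K. 1 / norm k ^ Suc CARD('d)) \<le> (\<Sum>k\<in>K. ?p (q k))" by (intro sum_mono summand)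
    also have "\<dots> = (\<Sum>g\<in>q ` K. ?p g)" by (subst sum.reindex[OF inj]) simp
    also have "\<dots> \<le> (\<Sum>g\<in>?B. ?p g)"
    proof (rule sum_mono2)
      show "finite ?B" by (intro finite_PiE) auto
      show "q ` K \<subseteq> ?B"
      proof (rule image_subsetI, rule PiE_I)
        fix k i assume "k \<in> K"
        from L[OF this, of i] show "q k i \<in> {- int L..int L}" by (auto simp: abs_le_iff)
      qed auto
      show "0 \<le> ?p g" for g by (intro prod_nonneg) auto
    qed
    also have "\<dots> = (\<Prod>i\<in>(UNIV :: 'd set). \<Sum>n\<in>{- int L..int L}. 1 / (max 1 \<bar>real_of_int n\<bar>) powr s)"
      by (rule prod_sum_PiE[symmetric]) auto
    also have "\<dots> \<le> (\<Prod>i\<in>(UNIV :: 'd set). T)" by (intro prod_mono conjI T sum_nonneg) auto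
    finally show ?thesis by simp
  qed
  moreover have "T ^ CARD('d) > 0" using T by simp
  ultimately show ?thesis using that by blast
qed

section \<open>The discrepancy of the unperturbed grid\<close>

lemma finite_torus_grid: "M > 0 \<Longrightarrow> finite (torus_grid M :: (real ^ 'd) set)"
  by (rule card_ge_0_finite) (simp add: card_torus_grid)

lemma torus_grid_shift:
  assumes M: "M > 0" and l: "l \<in> (int_lattice :: (real ^ 'd) set)"
  shows "bij_betw (\<lambda>s. torus_red (s + (1 / real M) *\<^sub>R l)) (torus_grid M) (torus_grid M)"
proof -
  let ?h = "\<lambda>s. torus_red (s + (1 / real M) *\<^sub>R l)"
  have "?h s \<in> torus_grid M" if s: "s \<in> torus_grid M" for s
  proof -
    obtain k where k: "k \<in> int_lattice" "s = (1 / real M) *\<^sub>R k" using s by (auto simp: torus_grid_def)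
    define m where "m = s + (1 / real M) *\<^sub>R l - ?h s"
    have m: "m \<in> int_lattice" unfolding m_def by (rule diff_torus_red_in_int_lattice)
    have "real M *\<^sub>R m \<in> int_lattice" using m by (auto simp: int_lattice_def)
    then have "k + l - real M *\<^sub>R m \<in> int_lattice" using k l by (intro int_lattice_diff int_lattice_add)
    moreover have "?h s = (1 / real M) *\<^sub>R (k + l - real M *\<^sub>R m)"
    proof -
      have "?h s = s + (1 / real M) *\<^sub>R l - m" by (simp add: m_def)
      then show ?thesis using k M by (simp add: algebra_simps)
    qed
    ultimately show ?thesis unfolding torus_grid_def by (intro IntI image_eqI torus_red_in_cube)
  qed
  then have "?h ` torus_grid M \<subseteq> torus_grid M" by blast
  moreover have inj: "inj_on ?h (torus_grid M)"
  proof (rule inj_onI)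
    fix s s' assume s: "s \<in> torus_grid M" "s' \<in> torus_grid M" and eq: "?h s = ?h s'"
    have "(s + (1 / real M) *\<^sub>R l - ?h s) - (s' + (1 / real M) *\<^sub>R l - ?h s') \<in> int_lattice"
      by (intro int_lattice_diff diff_torus_red_in_int_lattice)
    then have "s - s' \<in> int_lattice" using eq by simp
    from torus_red_add_int_lattice[OF this, of s'] have "torus_red s = torus_red s'" by simp
    then show "s = s'" using s by (simp add: torus_red_id torus_grid_def)
  qed
  ultimately show ?thesis
    unfolding bij_betw_def by (intro conjI endo_inj_surj finite_torus_grid M)
qed

text \<open>
A shift by $1/M$ along a coordinate axis permutes the grid and multiplies the sum by
$e^{2 \pi i k_i / M}$. So a nonzero sum forces $M$ to divide every $k_i$.
\<close>

lemma sum_torus_char_grid: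
  assumes M: "M > 0" and k: "k \<in> (int_lattice :: (real ^ 'd) set)"
    and nz: "(\<Sum>s\<in>torus_grid M. torus_char k s) \<noteq> 0"
  shows "(1 / real M) *\<^sub>R k \<in> int_lattice"
proof (rule ccontr)
  assume "(1 / real M) *\<^sub>R k \<notin> int_lattice"
  then obtain i where i: "k $ i / real M \<notin> \<int>" by (auto simp: int_lattice_def)
  define l :: "real ^ 'd" where "l = axis i 1"
  have l: "l \<in> int_lattice" by (auto simp: l_def int_lattice_def axis_def)
  let ?h = "(1 / real M) *\<^sub>R l"
  let ?I = "\<Sum>s\<in>torus_grid M. torus_char k s"
  have "?I = (\<Sum>s\<in>torus_grid M. torus_char k (torus_red (s + ?h)))"
    by (rule sum.reindex_bij_betw[OF torus_grid_shift[OF M l], symmetric])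
  also have "\<dots> = ?I * torus_char k ?h"
    by (simp only: torus_periodic_red[OF torus_periodic_char[OF k]] torus_char_add sum_distrib_right)
  finally have "torus_char k ?h = 1" using nz by simp
  then have "cos (2 * pi * (k $ i / real M)) = 1"
    by (simp add: torus_char_def l_def inner_axis complex_eq_iff)
  then obtain n :: int where n: "2 * pi * (k $ i / real M) = of_int n * 2 * pi" by (auto simp: cos_one_2pi_int)
  have "k $ i / real M = 2 * pi * (k $ i / real M) / (2 * pi)" by simp
  also have "\<dots> = of_int n" unfolding n by simp
  finally have "k $ i / real M = of_int n" .
  then show False using i by simp
qed

definition centred_ball :: "real \<Rightarrow> real ^ 'd \<Rightarrow> real" where
  "centred_ball r x = indicat_real (periodic_ball r) x
     - (\<integral>y. indicat_real (periodic_ball r :: (real ^ 'd) set) y \<partial>torus_haar)"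

definition grid_discrepancy :: "real \<Rightarrow> nat \<Rightarrow> real ^ 'd \<Rightarrow> real" where
  "grid_discrepancy r M x = (\<Sum>s\<in>torus_grid M. centred_ball r (x - s))"

lemma centred_ball_borel [measurable]: "centred_ball r \<in> borel_measurable borel"
  unfolding centred_ball_def by measurable

lemma integrable_periodic_ball:
  "integrable torus_haar (indicat_real (periodic_ball r :: (real ^ 'd) set))"
  by (rule integrable_torus_bounded[where B = 1]) (auto simp: indicator_def)

lemma centred_ball_bound: "\<bar>centred_ball r x\<bar> \<le> 1"
proof -
  interpret prob_space "torus_haar :: (real ^ 'a) measure" by (rule prob_space_torus_haar)
  have "0 \<le> (\<integral>y. indicat_real (periodic_ball r :: (real ^ 'a) set) y \<partial>torus_haar)" by simp
  moreover have "(\<integral>y. indicat_real (periodic_ball r :: (real ^ 'a) set) y \<partial>torus_haar) \<le> 1"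
    by (rule integral_le_const[OF integrable_periodic_ball]) (auto simp: indicator_def)
  ultimately show ?thesis by (auto simp: centred_ball_def indicator_def)
qed

lemma torus_periodic_centred_ball: "torus_periodic (centred_ball r)"
  by (simp add: torus_periodic_def centred_ball_def indicator_def periodic_ball_add)

lemma grid_discrepancy_borel [measurable]: "grid_discrepancy r M \<in> borel_measurable borel"
  unfolding grid_discrepancy_def
  by (intro borel_measurable_sum measurable_compose[OF _ centred_ball_borel]) simp

lemma grid_discrepancy_bound:
  "\<bar>grid_discrepancy r M (x :: real ^ 'd)\<bar> \<le> real (card (torus_grid M :: (real ^ 'd) set))"
proof -
  have "\<bar>grid_discrepancy r M x\<bar> \<le> (\<Sum>s\<in>(torus_grid M :: (real ^ 'd) set). 1)"
    unfolding grid_discrepancy_def by (rule sum_abs[THEN order_trans]) (intro sum_mono centred_ball_bound)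
  then show ?thesis by simp
qed

lemma torus_periodic_grid_discrepancy: "torus_periodic (grid_discrepancy r M)"
proof -
  have "centred_ball r (x + k - s) = centred_ball r (x - s)" if "k \<in> int_lattice" for x k s :: "real ^ 'a"
    using torus_periodicD[OF torus_periodic_centred_ball that, of r "x - s"] by (simp add: algebra_simps)
  then show ?thesis by (simp add: torus_periodic_def grid_discrepancy_def)
qed

lemma torus_autocorr_grid_discrepancy:
  fixes z :: "real ^ 'd"
  shows "torus_autocorr (grid_discrepancy r M) z
    = (\<Sum>s\<in>torus_grid M. \<Sum>s'\<in>torus_grid M. torus_autocorr (centred_ball r) (z - s' + s))"
proof -
  let ?J = "torus_grid M :: (real ^ 'd) set"
  have int: "integrable torus_haar (\<lambda>x. centred_ball r (x - s) * centred_ball r (x + z - s'))" for s s' :: "real ^ 'd"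
  proof (rule integrable_torus_bounded[where B = "1 * 1"])
    have [measurable]: "(\<lambda>x. centred_ball r (x - s)) \<in> borel_measurable borel"
      "(\<lambda>x. centred_ball r (x + z - s')) \<in> borel_measurable borel"
      by (intro measurable_compose[OF _ centred_ball_borel]; simp)+
    show "(\<lambda>x. centred_ball r (x - s) * centred_ball r (x + z - s')) \<in> borel_measurable borel" by measurable
    show "norm (centred_ball r (x - s) * centred_ball r (x + z - s')) \<le> 1 * 1" for x
      unfolding real_norm_def abs_mult by (intro mult_mono centred_ball_bound) auto
  qed
  have "torus_autocorr (grid_discrepancy r M) z
      = (\<integral>x. (\<Sum>s\<in>?J. \<Sum>s'\<in>?J. centred_ball r (x - s) * centred_ball r (x + z - s')) \<partial>torus_haar)"
    by (simp add: torus_autocorr_def grid_discrepancy_def sum_product)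
  also have "\<dots> = (\<Sum>s\<in>?J. \<Sum>s'\<in>?J. \<integral>x. centred_ball r (x - s) * centred_ball r (x + z - s') \<partial>torus_haar)"
    using int by (simp add: Bochner_Integration.integral_sum Bochner_Integration.integrable_sum)
  also have "\<dots> = (\<Sum>s\<in>?J. \<Sum>s'\<in>?J. torus_autocorr (centred_ball r) (z - s' + s))"
  proof (intro sum.cong refl)
    fix s s' :: "real ^ 'd"
    show "(\<integral>x. centred_ball r (x - s) * centred_ball r (x + z - s') \<partial>torus_haar)
        = torus_autocorr (centred_ball r) (z - s' + s)"
      using torus_autocorr_shift[OF centred_ball_borel torus_periodic_centred_ball, of r "- s" "z - s'"]
      by (simp only: diff_conv_add_uminus minus_minus add.assoc)
  qed
  finally show ?thesis .
qed

lemma fourier_coeff_centred_ball: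
  assumes k: "k \<in> int_lattice"
  shows "fourier_coeff (centred_ball r) k = (if k = 0 then 0 else fourier_coeff (indicat_real (periodic_ball r)) k)"
proof -
  let ?f = "indicat_real (periodic_ball r :: (real ^ 'a) set)"
  let ?\<beta> = "\<integral>y. ?f y \<partial>torus_haar"
  have int: "integrable torus_haar (\<lambda>x. complex_of_real (?f x) * torus_char k x)"
    by (rule integrable_torus_bounded[where B = 1]) (auto simp: indicator_def)
  have intc: "integrable torus_haar (torus_char k)"
    by (rule integrable_torus_bounded[where B = 1]) auto
  have "fourier_coeff (centred_ball r) k
      = (\<integral>x. complex_of_real (?f x) * torus_char k x - of_real ?\<beta> * torus_char k x \<partial>torus_haar)"
    unfolding fourier_coeff_def centred_ball_def by (simp only: of_real_diff left_diff_distrib)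
  also have "\<dots> = fourier_coeff ?f k - of_real ?\<beta> * (\<integral>x. torus_char k x \<partial>torus_haar)"
    using int intc by (simp add: fourier_coeff_def)
  finally have "fourier_coeff (centred_ball r) k = fourier_coeff ?f k - of_real ?\<beta> * (if k = 0 then 1 else 0)"
    by (simp only: integral_torus_char[OF k])
  moreover have "fourier_coeff ?f 0 = of_real ?\<beta>"
    unfolding fourier_coeff_def torus_char_zero mult_1_right by (rule integral_complex_of_real)
  ultimately show ?thesis by auto
qed

lemma fourier_coeff_grid_discrepancy:
  assumes k: "k \<in> int_lattice"
  shows "fourier_coeff (grid_discrepancy r M) k
     = (\<Sum>s\<in>torus_grid M. torus_char k s) * fourier_coeff (centred_ball r) k"
proof -
  have cb: "(\<lambda>x. centred_ball r (x - s)) \<in> borel_measurable borel" for s :: "real ^ 'a"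
    by (intro measurable_compose[OF _ centred_ball_borel]) simp
  have int: "integrable torus_haar (\<lambda>x. complex_of_real (centred_ball r (x - s)) * torus_char k x)" for s
  proof (rule integrable_torus_bounded[where B = 1])
    show "(\<lambda>x. complex_of_real (centred_ball r (x - s)) * torus_char k x) \<in> borel_measurable borel"
      using cb by measurable
  qed (simp add: norm_mult centred_ball_bound)
  have shift: "(\<integral>x. complex_of_real (centred_ball r (x - s)) * torus_char k x \<partial>torus_haar)
      = torus_char k s * fourier_coeff (centred_ball r) k" for s
  proof -
    let ?h = "\<lambda>x. complex_of_real (centred_ball r x) * torus_char k (x + s)"
    have "(\<integral>x. ?h (x + - s) \<partial>torus_haar) = (\<integral>x. ?h x \<partial>torus_haar)"
    proof (rule integral_torus_shift)
      have [measurable]: "(\<lambda>x. torus_char k (x + s)) \<in> borel_measurable borel"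
        by (intro measurable_compose[OF _ torus_char_borel]) simp
      show "?h \<in> borel_measurable borel" by measurable
      show "torus_periodic ?h"
        by (simp add: torus_periodic_def torus_char_add torus_char_lattice[OF k]
            torus_periodicD[OF torus_periodic_centred_ball])
    qed
    also have "(\<integral>x. ?h x \<partial>torus_haar) = torus_char k s * fourier_coeff (centred_ball r) k"
      unfolding fourier_coeff_def integral_mult_right_zero[symmetric] torus_char_add by (simp only: mult_ac)
    finally show ?thesis by simp
  qed
  have "fourier_coeff (grid_discrepancy r M) k
     = (\<integral>x. (\<Sum>s\<in>torus_grid M. complex_of_real (centred_ball r (x - s)) * torus_char k x) \<partial>torus_haar)"
    unfolding fourier_coeff_def grid_discrepancy_def by (simp only: of_real_sum sum_distrib_right)
  also have "\<dots> = (\<Sum>s\<in>torus_grid M. torus_char k s * fourier_coeff (centred_ball r) k)"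
    using int by (simp add: Bochner_Integration.integral_sum shift)
  finally show ?thesis by (simp only: sum_distrib_right)
qed

text \<open>
By Cauchy-Schwarz over the grid points. The purpose is the $L^2$-continuity of translations of the
grid discrepancy for each fixed $M$, so a constant that grows with $M$ does no harm.
\<close>

lemma grid_discrepancy_modulus:
  assumes C: "\<And>h :: real ^ 'd. (\<integral>x. (indicat_real (periodic_ball r) (x + h) - indicat_real (periodic_ball r) x)\<^sup>2 \<partial>torus_haar) \<le> C * norm h"
  shows "(\<integral>x. (grid_discrepancy r M (x + h) - grid_discrepancy r M x)\<^sup>2 \<partial>torus_haar)
         \<le> (real (card (torus_grid M :: (real ^ 'd) set)))\<^sup>2 * C * norm (h :: real ^ 'd)"
proof -
  let ?J = "torus_grid M :: (real ^ 'd) set"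
  let ?N = "real (card ?J)"
  let ?d = "\<lambda>x. (centred_ball r (x + h) - centred_ball r x)\<^sup>2"
  have dm [measurable]: "?d \<in> borel_measurable borel"
  proof -
    have [measurable]: "(\<lambda>x. centred_ball r (x + h)) \<in> borel_measurable borel"
      by (intro measurable_compose[OF _ centred_ball_borel]) simp
    show ?thesis by measurable
  qed
  have dsm: "(\<lambda>x. ?d (x - s)) \<in> borel_measurable borel" for s
    by (rule measurable_compose[OF _ dm]) simp
  have db: "norm (?d x) \<le> 4" for x
  proof -
    have "\<bar>centred_ball r (x + h) - centred_ball r x\<bar> \<le> 2"
      using centred_ball_bound[of r "x + h"] centred_ball_bound[of r x] by linarith
    from power_mono[OF this, of 2] show ?thesis by simp
  qed
  have int: "integrable torus_haar (\<lambda>x. ?d (x - s))" for s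
    by (rule integrable_torus_bounded[OF dsm db])
  have per: "torus_periodic ?d"
  proof -
    have "centred_ball r (x + k + h) = centred_ball r (x + h)" if "k \<in> int_lattice" for x k
      using torus_periodicD[OF torus_periodic_centred_ball that, of r "x + h"] by (simp add: algebra_simps)
    then show ?thesis by (simp add: torus_periodic_def torus_periodicD[OF torus_periodic_centred_ball])
  qed
  have one: "(\<integral>x. ?d (x - s) \<partial>torus_haar) \<le> C * norm h" for s
  proof -
    have "(\<integral>x. ?d (x + - s) \<partial>torus_haar) = (\<integral>x. ?d x \<partial>torus_haar)"
      by (rule integral_torus_shift[OF dm per])
    also have "\<dots> \<le> C * norm h" using C[of h] by (simp add: centred_ball_def)
    finally show ?thesis by simp
  qed
  have "(\<integral>x. (grid_discrepancy r M (x + h) - grid_discrepancy r M x)\<^sup>2 \<partial>torus_haar)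
      \<le> (\<integral>x. (\<Sum>s\<in>?J. ?d (x - s)) * ?N \<partial>torus_haar)"
  proof (rule integral_mono)
    have [measurable]: "(\<lambda>x. grid_discrepancy r M (x + h)) \<in> borel_measurable borel"
      by (intro measurable_compose[OF _ grid_discrepancy_borel]) simp
    show "integrable torus_haar (\<lambda>x. (grid_discrepancy r M (x + h) - grid_discrepancy r M x)\<^sup>2)"
    proof (rule integrable_torus_bounded)
      fix x
      have "\<bar>grid_discrepancy r M (x + h) - grid_discrepancy r M x\<bar> \<le> 2 * ?N"
        using grid_discrepancy_bound[of r M "x + h"] grid_discrepancy_bound[of r M x] by linarith
      from power_mono[OF this, of 2]
      show "norm ((grid_discrepancy r M (x + h) - grid_discrepancy r M x)\<^sup>2) \<le> (2 * ?N)\<^sup>2" by simp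
    qed measurable
    show "integrable torus_haar (\<lambda>x. (\<Sum>s\<in>?J. ?d (x - s)) * ?N)" using int by auto
    show "(grid_discrepancy r M (x + h) - grid_discrepancy r M x)\<^sup>2 \<le> (\<Sum>s\<in>?J. ?d (x - s)) * ?N" for x
    proof -
      have "grid_discrepancy r M (x + h) - grid_discrepancy r M x
          = (\<Sum>s\<in>?J. centred_ball r (x - s + h) - centred_ball r (x - s))"
        unfolding grid_discrepancy_def by (simp add: sum_subtractf algebra_simps)
      then show ?thesis by (simp only: sum_squared_le_sum_of_squares)
    qed
  qed
  also have "\<dots> = (\<Sum>s\<in>?J. \<integral>x. ?d (x - s) \<partial>torus_haar) * ?N"
    using int by (simp add: Bochner_Integration.integral_sum)
  also have "\<dots> \<le> (\<Sum>s\<in>?J. C * norm h) * ?N"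
    by (intro mult_right_mono sum_mono one) auto
  finally show ?thesis by (simp add: power2_eq_square algebra_simps)
qed

text \<open>
Only frequencies $k = M m$ with $m \neq 0$ contribute to the Parseval sum, each at most
$N^2 C |M m|^{-d-1}$. As $N^2 M^{-d-1} = M^{d-1}$, the convergence of the lattice sum gives the
bound.
\<close>

lemma grid_discrepancy_L2:
  assumes r: "0 < r" "r < 1 / 2"
  obtains C where "C > 0"
    "\<And>M. M \<ge> 1 \<Longrightarrow> (\<integral>x. (grid_discrepancy r M (x :: real ^ 'd))\<^sup>2 \<partial>torus_haar) \<le> C * real M ^ (CARD('d) - 1)"
proof -
  obtain C1 where C1: "C1 > 0" "\<And>k :: real ^ 'd. k \<noteq> 0 \<Longrightarrow>
      (cmod (fourier_coeff (indicat_real (periodic_ball r)) k))\<^sup>2 \<le> C1 / norm k ^ Suc CARD('d)"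
    using fourier_coeff_ball_decay[OF r] by blast
  obtain T where T: "T > 0" "\<And>K :: (real ^ 'd) set. finite K \<Longrightarrow> K \<subseteq> int_lattice - {0} \<Longrightarrow>
      (\<Sum>k\<in>K. 1 / norm k ^ Suc CARD('d)) \<le> T"
    using lattice_sum_bounded by blast
  obtain C2 where C2: "C2 > 0" "\<And>h :: real ^ 'd.
      (\<integral>x. (indicat_real (periodic_ball r) (x + h) - indicat_real (periodic_ball r) x)\<^sup>2 \<partial>torus_haar) \<le> C2 * norm h"
    using periodic_ball_modulus[OF r] by blast
  have "(\<integral>x. (grid_discrepancy r M (x :: real ^ 'd))\<^sup>2 \<partial>torus_haar) \<le> (C1 * T) * real M ^ (CARD('d) - 1)"
    if M1: "M \<ge> 1" for M
  proof -
    let ?G = "grid_discrepancy r M :: real ^ 'd \<Rightarrow> real"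
    have M: "M > 0" using M1 by simp
    define N where "N = real (card (torus_grid M :: (real ^ 'd) set))"
    have N: "N = real M ^ CARD('d)" by (simp add: N_def card_torus_grid[OF M])
    have Npos: "N > 0" using M by (simp add: N)
    show ?thesis
    proof (rule parseval_inequality[where B = N])
      show "\<bar>?G x\<bar> \<le> N" for x unfolding N_def by (rule grid_discrepancy_bound)
      fix \<eta> :: real assume \<eta>: "\<eta> > 0"
      have NC: "N\<^sup>2 * C2 > 0" using Npos C2(1) by simp
      show "\<exists>\<delta>>0. \<forall>z. norm z < \<delta> \<longrightarrow> (\<integral>x. (?G (x + z) - ?G x)\<^sup>2 \<partial>torus_haar) \<le> \<eta>"
      proof (intro exI[of _ "\<eta> / (N\<^sup>2 * C2)"] conjI allI impI)
        show "\<eta> / (N\<^sup>2 * C2) > 0" using \<eta> NC by (rule divide_pos_pos)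
        fix z :: "real ^ 'd" assume z: "norm z < \<eta> / (N\<^sup>2 * C2)"
        have "(\<integral>x. (?G (x + z) - ?G x)\<^sup>2 \<partial>torus_haar) \<le> N\<^sup>2 * C2 * norm z"
          unfolding N_def by (rule grid_discrepancy_modulus[OF C2(2)])
        also have "\<dots> \<le> \<eta>" using z NC by (simp only: pos_less_divide_eq[OF NC]) (simp add: mult.commute)
        finally show "(\<integral>x. (?G (x + z) - ?G x)\<^sup>2 \<partial>torus_haar) \<le> \<eta>" .
      qed
    next
      fix K :: "(real ^ 'd) set" assume K: "finite K" "K \<subseteq> int_lattice"
      define K' where "K' = {m \<in> int_lattice - {0}. real M *\<^sub>R m \<in> K}"
      let ?s = "\<lambda>m :: real ^ 'd. real M *\<^sub>R m"
      have inj: "inj_on ?s A" for A using M by (auto simp: inj_on_def)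
      have sK': "?s ` K' \<subseteq> K" by (auto simp: K'_def)
      have fK': "finite K'" by (rule finite_imageD[OF finite_subset[OF sK' K(1)] inj])
      have zero: "(cmod (fourier_coeff ?G k))\<^sup>2 = 0" if k: "k \<in> K - ?s ` K'" for k
      proof -
        have kl: "k \<in> int_lattice" using k K by blast
        have "fourier_coeff ?G k = 0"
        proof (rule ccontr)
          assume "fourier_coeff ?G k \<noteq> 0"
          then have nz: "(\<Sum>s\<in>torus_grid M. torus_char k s) \<noteq> 0" and k0: "k \<noteq> 0"
            by (auto simp: fourier_coeff_grid_discrepancy[OF kl] fourier_coeff_centred_ball[OF kl] split: if_splits)
          have "k = ?s ((1 / real M) *\<^sub>R k)" using M by simp
          moreover from this have "(1 / real M) *\<^sub>R k \<in> K'"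
            using sum_torus_char_grid[OF M kl nz] k k0 M by (auto simp: K'_def)
          ultimately show False using k by blast
        qed
        then show ?thesis by simp
      qed
      have bound: "(cmod (fourier_coeff ?G (?s m)))\<^sup>2 \<le> N\<^sup>2 * C1 / real M ^ Suc CARD('d) * (1 / norm m ^ Suc CARD('d))"
        if m: "m \<in> K'" for m
      proof -
        have ml: "?s m \<in> int_lattice" and m0: "?s m \<noteq> 0" using m K M by (auto simp: K'_def)
        have "cmod (\<Sum>s\<in>(torus_grid M :: (real ^ 'd) set). torus_char (?s m) s) \<le> (\<Sum>s\<in>(torus_grid M :: (real ^ 'd) set). 1)"
          by (rule sum_norm_le) simp
        then have cN: "cmod (\<Sum>s\<in>torus_grid M. torus_char (?s m) s) \<le> N" by (simp add: N_def)
        have "(cmod (fourier_coeff ?G (?s m)))\<^sup>2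
            = (cmod (\<Sum>s\<in>torus_grid M. torus_char (?s m) s))\<^sup>2
               * (cmod (fourier_coeff (indicat_real (periodic_ball r)) (?s m)))\<^sup>2"
          using m0 by (simp add: fourier_coeff_grid_discrepancy[OF ml] fourier_coeff_centred_ball[OF ml]
              norm_mult power_mult_distrib)
        also have "\<dots> \<le> N\<^sup>2 * (C1 / norm (?s m) ^ Suc CARD('d))"
          by (intro mult_mono power_mono cN C1(2) m0) auto
        also have "\<dots> = N\<^sup>2 * C1 / real M ^ Suc CARD('d) * (1 / norm m ^ Suc CARD('d))"
          by (simp add: power_mult_distrib)
        finally show ?thesis .
      qed
      have "(\<Sum>k\<in>K. (cmod (fourier_coeff ?G k))\<^sup>2) = (\<Sum>k\<in>?s ` K'. (cmod (fourier_coeff ?G k))\<^sup>2)"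
        using zero by (intro sum.mono_neutral_right K sK') auto
      also have "\<dots> = (\<Sum>m\<in>K'. (cmod (fourier_coeff ?G (?s m)))\<^sup>2)"
        by (subst sum.reindex[OF inj]) simp
      also have "\<dots> \<le> (\<Sum>m\<in>K'. N\<^sup>2 * C1 / real M ^ Suc CARD('d) * (1 / norm m ^ Suc CARD('d)))"
        by (intro sum_mono bound)
      also have "\<dots> = N\<^sup>2 * C1 / real M ^ Suc CARD('d) * (\<Sum>m\<in>K'. 1 / norm m ^ Suc CARD('d))"
        by (simp only: sum_distrib_left)
      also have "\<dots> \<le> N\<^sup>2 * C1 / real M ^ Suc CARD('d) * T"
        using C1(1) by (intro mult_left_mono T(2) fK') (auto simp: K'_def)
      also have "\<dots> = (C1 * T) * (N\<^sup>2 / real M ^ Suc CARD('d))" by simp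
      also have "N\<^sup>2 / real M ^ Suc CARD('d) = real M ^ (CARD('d) - 1)"
      proof -
        obtain e where e: "CARD('d) = Suc e" using zero_less_card_finite[where 'a = 'd] by (cases "CARD('d)") auto
        show ?thesis using M unfolding N e by (simp add: power2_eq_square)
      qed
      finally show "(\<Sum>k\<in>K. (cmod (fourier_coeff ?G k))\<^sup>2) \<le> (C1 * T) * real M ^ (CARD('d) - 1)" .
    qed (auto intro: torus_periodic_grid_discrepancy)
  qed
  moreover have "C1 * T > 0" using C1 T by simp
  ultimately show ?thesis using that by blast
qed

section \<open>Random points\<close>

lemma integral_PiM_pair:
  fixes g :: "'a \<Rightarrow> 'a \<Rightarrow> real"
  assumes "\<And>i. prob_space (M i)" and I: "finite I" "i \<in> I" "j \<in> I" "i \<noteq> j"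
    and g: "(\<lambda>(x, y). g x y) \<in> borel_measurable (M i \<Otimes>\<^sub>M M j)"
    and B: "\<And>x y. \<bar>g x y\<bar> \<le> B"
  shows "(\<integral>v. g (v i) (v j) \<partial>PiM I M) = (\<integral>y. (\<integral>x. g x y \<partial>M i) \<partial>M j)"
proof -
  interpret product_prob_space M I
    by (rule product_prob_spaceI) (rule assms(1))
  let ?P = "PiM {i, j} M"
  have h: "(\<lambda>v. g (v i) (v j)) \<in> borel_measurable ?P"
  proof -
    have "(\<lambda>v. (v i, v j)) \<in> ?P \<rightarrow>\<^sub>M M i \<Otimes>\<^sub>M M j"
      by (intro measurable_Pair measurable_component_singleton) auto
    from measurable_compose[OF this g] show ?thesis by simp
  qed
  interpret pair: prob_space ?P by (rule prob_space_PiM) (rule assms(1))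
  have int: "integrable (PiM (insert i {j}) M) (\<lambda>v. g (v i) (v j))"
    using h B by (intro pair.integrable_const_bound[where B = B]) auto
  have "(\<integral>v. g (v i) (v j) \<partial>?P) = (\<integral>v. g (v i) (v j) \<partial>distr (PiM I M) ?P (\<lambda>v. restrict v {i, j}))"
    using I by (subst distr_restrict[of "{i, j}" I]) auto
  also have "\<dots> = (\<integral>v. g (restrict v {i, j} i) (restrict v {i, j} j) \<partial>PiM I M)"
    using I by (intro integral_distr h measurable_restrict_subset) auto
  also have "\<dots> = (\<integral>v. g (v i) (v j) \<partial>PiM I M)" by simp
  finally have "(\<integral>v. g (v i) (v j) \<partial>PiM I M) = (\<integral>v. g (v i) (v j) \<partial>?P)" by simp
  also have "\<dots> = (\<integral>v. (\<integral>x. g ((v(i := x)) i) ((v(i := x)) j) \<partial>M i) \<partial>PiM {j} M)"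
    using I int by (intro product_integral_insert) auto
  also have "\<dots> = (\<integral>v. (\<integral>x. g x (v j) \<partial>M i) \<partial>PiM {j} M)" using I(4) by simp
  also have "\<dots> = (\<integral>y. (\<integral>x. g x y \<partial>M i) \<partial>M j)"
  proof (rule product_integral_singleton)
    have "(\<lambda>(y, x). g x y) \<in> borel_measurable (M j \<Otimes>\<^sub>M M i)"
      using measurable_compose[OF measurable_pair_swap' g] by (simp add: split_beta)
    then show "(\<lambda>y. \<integral>x. g x y \<partial>M i) \<in> borel_measurable (M j)"
      by (rule sigma_finite_measure.borel_measurable_lebesgue_integral[OF prob_space_imp_sigma_finite[OF assms(1)]])
  qed
  finally show ?thesis .
qed

text \<open>
By second countability, the complement of the support is covered by countably many null sets, the
images of those basic open sets whose image has measure zero.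
\<close>

lemma AE_torus_support:
  fixes \<mu> :: "(real ^ 'd) measure"
  assumes "prob_space \<mu>" and sets: "sets \<mu> = sets torus_borel"
  shows "AE x in \<mu>. x \<in> torus_support \<mu>"
proof -
  interpret prob_space \<mu> by fact
  have space: "space \<mu> = torus_cube" using sets_eq_imp_space_eq[OF sets] by simp
  obtain \<B> :: "(real ^ 'd) set set" where \<B>: "countable \<B>" "topological_basis \<B>"
    using ex_countable_basis by blast
  define \<N> where "\<N> = {b \<in> \<B>. measure \<mu> (torus_red ` b) = 0}"
  have meas: "torus_red ` b \<in> sets \<mu>" if "open b" for b
    unfolding sets by (rule torus_red_image_sets) (use that in auto)
  have "torus_red ` b \<in> null_sets \<mu>" if "b \<in> \<N>" for b
    using that meas[OF topological_basis_open[OF \<B>(2)]] by (auto simp: \<N>_def null_sets_def emeasure_eq_measure)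
  moreover have "countable \<N>" using \<B>(1) by (auto simp: \<N>_def)
  ultimately have null: "(\<Union>b\<in>\<N>. torus_red ` b) \<in> null_sets \<mu>" by (intro null_sets_UN') auto
  show ?thesis
  proof (rule AE_I'[OF null], safe)
    fix x assume x: "x \<in> space \<mu>" "x \<notin> torus_support \<mu>"
    then have "x \<in> torus_cube" by (simp add: space)
    with x obtain e where e: "e > 0" "\<not> measure \<mu> (torus_red ` ball x e) > 0" by (auto simp: torus_support_def)
    obtain b where b: "b \<in> \<B>" "x \<in> b" "b \<subseteq> ball x e"
      using topological_basisE[OF \<B>(2), of "ball x e" x] e(1) by auto
    have "measure \<mu> (torus_red ` b) \<le> measure \<mu> (torus_red ` ball x e)"
      using b by (intro finite_measure_mono meas image_mono) auto
    then have "measure \<mu> (torus_red ` b) = 0" using e(2) measure_nonneg[of \<mu> "torus_red ` b"] by linarith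
    then have "b \<in> \<N>" using b by (simp add: \<N>_def)
    moreover have "x \<in> torus_red ` b" using b(2) torus_red_id[OF \<open>x \<in> torus_cube\<close>] by (metis image_eqI)
    ultimately show "x \<in> (\<Union>b\<in>\<N>. torus_red ` b)" by blast
  qed
qed

lemma integral_torus_translate_measurable:
  fixes g :: "real ^ 'd \<Rightarrow> real"
  assumes sets: "sets \<mu> = sets torus_borel" and g: "g \<in> borel_measurable borel" and per: "torus_periodic g"
  shows "(\<integral>t. g t \<partial>torus_translate \<mu> s) = (\<integral>t. g (t - s) \<partial>\<mu>)"
  unfolding torus_translate_def
  by (subst integral_distr[OF torus_translate_measurable[OF sets] borel_measurable_torus(1)[OF g]])
     (simp add: torus_periodic_red[OF per])

lemma borel_measurable_integral_difference:
  fixes g :: "real ^ 'd \<Rightarrow> real"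
  assumes "prob_space \<nu>" and sets: "sets \<nu> = sets torus_borel" and g [measurable]: "g \<in> borel_measurable borel"
  shows "(\<lambda>x. \<integral>y. g (y - x) \<partial>\<nu>) \<in> borel_measurable borel"
proof -
  interpret prob_space \<nu> by fact
  have id: "(\<lambda>x. x) \<in> \<nu> \<rightarrow>\<^sub>M (borel :: (real ^ 'd) measure)"
    unfolding measurable_cong_sets[OF sets refl] torus_borel_def by (intro measurable_restrict_space1) simp
  have [measurable]: "snd \<in> (borel :: (real ^ 'd) measure) \<Otimes>\<^sub>M \<nu> \<rightarrow>\<^sub>M (borel :: (real ^ 'd) measure)"
    by (rule measurable_compose[OF measurable_snd id])
  show ?thesis
    by (rule borel_measurable_lebesgue_integral) (simp add: split_beta)
qed

lemma integral_discrepancy_square: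
  fixes v :: "real ^ 'd \<Rightarrow> real ^ 'd"
  assumes r: "0 < r" "r < 1 / 2" and v: "\<And>s. s \<in> J \<Longrightarrow> v s \<in> torus_cube"
  shows "(\<integral>t. (discrepancy r J v t)\<^sup>2 \<partial>torus_haar)
       = (\<Sum>s\<in>J. \<Sum>s'\<in>J. torus_autocorr (centred_ball r) (v s' - v s))"
proof -
  let ?\<beta> = "\<integral>y. indicat_real (periodic_ball r :: (real ^ 'd) set) y \<partial>torus_haar"
  have \<beta>: "?\<beta> = r ^ CARD('d) * measure lborel (cball (0 :: real ^ 'd) 1)"
  proof -
    have "?\<beta> = (\<integral>x. (1 :: real) \<partial>(ball_lebesgue r :: (real ^ 'd) measure))"
      using integral_torus_indicator_ball[OF r(2), of "\<lambda>_ :: real ^ 'd. 1 :: real"] by simp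
    also have "\<dots> = measure lborel (cball (0 :: real ^ 'd) r)"
      by (simp add: ball_lebesgue_def measure_restrict_space)
    also have "\<dots> = r ^ CARD('d) * measure lborel (cball (0 :: real ^ 'd) 1)"
      using r by (simp add: content_cball)
    finally show ?thesis .
  qed
  have D: "discrepancy r J v t = (\<Sum>s\<in>J. centred_ball r (t + v s))" for t
  proof -
    have "(\<Sum>s\<in>J. centred_ball r (t + v s)) = (\<Sum>s\<in>J. indicat_real (torus_shifted_ball r t) (v s)) - real (card J) * ?\<beta>"
      using v by (simp add: centred_ball_def sum_subtractf indicator_torus_shifted_ball[OF r(1)] add.commute)
    then show ?thesis unfolding \<beta> discrepancy_def by (simp add: mult.assoc)
  qed
  have int: "integrable torus_haar (\<lambda>x. centred_ball r (x + a) * centred_ball r (x + b))" for a b :: "real ^ 'd"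
  proof (rule integrable_torus_bounded[where B = "1 * 1"])
    have [measurable]: "(\<lambda>x. centred_ball r (x + a)) \<in> borel_measurable borel" for a :: "real ^ 'd"
      by (intro measurable_compose[OF _ centred_ball_borel]) simp
    show "(\<lambda>x. centred_ball r (x + a) * centred_ball r (x + b)) \<in> borel_measurable borel" by measurable
    show "norm (centred_ball r (x + a) * centred_ball r (x + b)) \<le> 1 * 1" for x
      unfolding real_norm_def abs_mult by (intro mult_mono centred_ball_bound) auto
  qed
  have "(\<integral>t. (discrepancy r J v t)\<^sup>2 \<partial>torus_haar)
      = (\<integral>t. (\<Sum>s\<in>J. \<Sum>s'\<in>J. centred_ball r (t + v s) * centred_ball r (t + v s')) \<partial>torus_haar)"
    unfolding D by (simp add: power2_eq_square sum_product)
  also have "\<dots> = (\<Sum>s\<in>J. \<Sum>s'\<in>J. \<integral>t. centred_ball r (t + v s) * centred_ball r (t + v s') \<partial>torus_haar)"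
    using int by (simp add: Bochner_Integration.integral_sum Bochner_Integration.integrable_sum)
  also have "\<dots> = (\<Sum>s\<in>J. \<Sum>s'\<in>J. torus_autocorr (centred_ball r) (v s' - v s))"
    by (simp only: torus_autocorr_shift[OF centred_ball_borel torus_periodic_centred_ball])
  finally show ?thesis .
qed

text \<open>
The expectation of the squared discrepancy is compared with the sum of $b(s, s')$ over all pairs of
grid points, where $b(s, s')$ is the average of $A(y - s' - (x - s))$ over independent $x, y$ with
distribution $\mu$. The two sums differ in the diagonal terms only. The full sum of the $b(s, s')$
is an average of autocorrelations of the grid discrepancy, each at most the value at $0$.
\<close>

lemma gen_discrepancy_square_le:
  fixes \<mu> :: "(real ^ 'd) measure"
  assumes r: "0 < r" "r < 1 / 2" and M: "M > 0"
    and \<mu>: "prob_space \<mu>" and sets: "sets \<mu> = sets torus_borel"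
    and supp: "torus_support \<mu> \<subseteq> torus_red ` cball a \<epsilon>"
    and C: "C \<ge> 0" "\<And>h :: real ^ 'd. (\<integral>x. (indicat_real (periodic_ball r) (x + h) - indicat_real (periodic_ball r) x)\<^sup>2 \<partial>torus_haar) \<le> C * norm h"
  shows "(gen_discrepancy r \<mu> M)\<^sup>2
      \<le> (\<integral>x. (grid_discrepancy r M (x :: real ^ 'd))\<^sup>2 \<partial>torus_haar) + real (M ^ CARD('d)) * (C * \<epsilon>)"
proof -
  interpret \<mu>: prob_space \<mu> by fact
  let ?J = "torus_grid M :: (real ^ 'd) set"
  let ?P = "PiM ?J (torus_translate \<mu>)"
  let ?A = "torus_autocorr (centred_ball r) :: real ^ 'd \<Rightarrow> real"
  let ?G = "grid_discrepancy r M :: real ^ 'd \<Rightarrow> real"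
  have J: "finite ?J" by (rule finite_torus_grid[OF M])
  have prob: "prob_space (torus_translate \<mu> s)" for s
    unfolding torus_translate_def by (rule \<mu>.prob_space_distr) (rule torus_translate_measurable[OF sets])
  interpret P: prob_space ?P by (rule prob_space_PiM) (rule prob)
  have sets_tr: "sets (torus_translate \<mu> s) = sets torus_borel" for s by (simp add: torus_translate_def)
  have id: "(\<lambda>x. x) \<in> \<mu> \<rightarrow>\<^sub>M (borel :: (real ^ 'd) measure)"
    unfolding measurable_cong_sets[OF sets refl] torus_borel_def by (intro measurable_restrict_space1) simp
  have id': "(\<lambda>x. x) \<in> torus_translate \<mu> s \<rightarrow>\<^sub>M (borel :: (real ^ 'd) measure)" for s
    unfolding measurable_cong_sets[OF sets_tr refl] torus_borel_def by (intro measurable_restrict_space1) simp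
  have A [measurable]: "?A \<in> borel_measurable borel" by (rule torus_autocorr_borel) simp
  have Ab: "\<bar>?A z\<bar> \<le> 1" for z
    using torus_autocorr_bound[OF centred_ball_borel centred_ball_bound, of r z] by simp
  have Aper: "torus_periodic ?A" by (rule torus_periodic_autocorr[OF torus_periodic_centred_ball])
  have coord: "(\<lambda>v. v s) \<in> ?P \<rightarrow>\<^sub>M borel" if "s \<in> ?J" for s
    using measurable_compose[OF measurable_component_singleton[OF that] id'] by simp
  define b where "b s s' = (\<integral>x. (\<integral>y. ?A (y - s' - (x - s)) \<partial>\<mu>) \<partial>\<mu>)" for s s'
  define E where "E s s' = (\<integral>v. ?A (v s' - v s) \<partial>?P)" for s s'
  have Eb: "E s s' = b s s'" if s: "s \<in> ?J" "s' \<in> ?J" "s' \<noteq> s" for s s'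
  proof -
    have "E s s' = (\<integral>x. (\<integral>y. ?A (y - x) \<partial>torus_translate \<mu> s') \<partial>torus_translate \<mu> s)"
      unfolding E_def
    proof (rule integral_PiM_pair[OF prob J s(2,1,3), where g = "\<lambda>y x. ?A (y - x)" and B = 1])
      have [measurable]: "fst \<in> torus_translate \<mu> s' \<Otimes>\<^sub>M torus_translate \<mu> s \<rightarrow>\<^sub>M (borel :: (real ^ 'd) measure)"
        "snd \<in> torus_translate \<mu> s' \<Otimes>\<^sub>M torus_translate \<mu> s \<rightarrow>\<^sub>M (borel :: (real ^ 'd) measure)"
        by (rule measurable_compose[OF measurable_fst id'] measurable_compose[OF measurable_snd id'])+
      show "(\<lambda>(y, x). ?A (y - x)) \<in> borel_measurable (torus_translate \<mu> s' \<Otimes>\<^sub>M torus_translate \<mu> s)"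
        unfolding split_beta by measurable
    qed (rule Ab)
    also have "\<dots> = (\<integral>x. (\<integral>y. ?A (y - (x - s)) \<partial>torus_translate \<mu> s') \<partial>\<mu>)"
    proof (rule integral_torus_translate_measurable[OF sets])
      show "(\<lambda>x. \<integral>y. ?A (y - x) \<partial>torus_translate \<mu> s') \<in> borel_measurable borel"
        by (rule borel_measurable_integral_difference[OF prob sets_tr A])
      show "torus_periodic (\<lambda>x. \<integral>y. ?A (y - x) \<partial>torus_translate \<mu> s')"
        unfolding torus_periodic_def
      proof (intro allI ballI)
        fix x k :: "real ^ 'd" assume "k \<in> int_lattice"
        then have "?A (y - (x + k)) = ?A (y - x)" for y
          using torus_periodicD[OF Aper, of k "y - (x + k)"] by (simp add: algebra_simps)
        then show "(\<integral>y. ?A (y - (x + k)) \<partial>torus_translate \<mu> s') = (\<integral>y. ?A (y - x) \<partial>torus_translate \<mu> s')" by simp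
      qed
    qed
    also have "\<dots> = b s s'"
      unfolding b_def
    proof (rule Bochner_Integration.integral_cong[OF refl])
      fix x
      show "(\<integral>y. ?A (y - (x - s)) \<partial>torus_translate \<mu> s') = (\<integral>y. ?A (y - s' - (x - s)) \<partial>\<mu>)"
      proof (rule integral_torus_translate_measurable[OF sets])
        show "(\<lambda>y. ?A (y - (x - s))) \<in> borel_measurable borel" by measurable
        show "torus_periodic (\<lambda>y. ?A (y - (x - s)))"
          unfolding torus_periodic_def
        proof (intro allI ballI)
          fix y k :: "real ^ 'd" assume "k \<in> int_lattice"
          then show "?A (y + k - (x - s)) = ?A (y - (x - s))"
            using torus_periodicD[OF Aper, of k "y - (x - s)"] by (simp add: algebra_simps)
        qed
      qed
    qed
    finally show ?thesis .
  qed
  have Es: "E s s = ?A 0" for s by (simp add: E_def P.prob_space)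
  have intA: "integrable ?P (\<lambda>v. ?A (v s' - v s))" if "s \<in> ?J" "s' \<in> ?J" for s s'
    using coord[OF that(1)] coord[OF that(2)] Ab
    by (intro P.integrable_const_bound[where B = 1] measurable_compose[OF borel_measurable_diff A]) auto
  have total: "(gen_discrepancy r \<mu> M)\<^sup>2 = (\<Sum>s\<in>?J. \<Sum>s'\<in>?J. E s s')"
  proof -
    have "0 \<le> (\<integral>v. (\<integral>t. (discrepancy r ?J v t)\<^sup>2 \<partial>torus_haar) \<partial>?P)"
      by (intro Bochner_Integration.integral_nonneg) simp
    then have "(gen_discrepancy r \<mu> M)\<^sup>2 = (\<integral>v. (\<integral>t. (discrepancy r ?J v t)\<^sup>2 \<partial>torus_haar) \<partial>?P)"
      unfolding gen_discrepancy_def by (rule real_sqrt_pow2)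
    also have "\<dots> = (\<integral>v. (\<Sum>s\<in>?J. \<Sum>s'\<in>?J. ?A (v s' - v s)) \<partial>?P)"
    proof (rule Bochner_Integration.integral_cong[OF refl])
      fix v assume v: "v \<in> space ?P"
      have "v s \<in> torus_cube" if "s \<in> ?J" for s
        using v that by (auto simp: space_PiM torus_translate_def PiE_iff)
      then show "(\<integral>t. (discrepancy r ?J v t)\<^sup>2 \<partial>torus_haar) = (\<Sum>s\<in>?J. \<Sum>s'\<in>?J. ?A (v s' - v s))"
        by (rule integral_discrepancy_square[OF r])
    qed
    also have "\<dots> = (\<Sum>s\<in>?J. \<Sum>s'\<in>?J. E s s')"
      unfolding E_def using intA by (simp add: Bochner_Integration.integral_sum Bochner_Integration.integrable_sum)
    finally show ?thesis .
  qed
  have int1: "integrable \<mu> (\<lambda>y. g (y - x))"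
    if "g \<in> borel_measurable borel" "\<And>z. \<bar>g z\<bar> \<le> B" for g :: "real ^ 'd \<Rightarrow> real" and B x
  proof (rule \<mu>.integrable_const_bound[where B = B])
    have "(\<lambda>y. y - x) \<in> \<mu> \<rightarrow>\<^sub>M borel" by (rule borel_measurable_diff[OF id]) simp
    from measurable_compose[OF this that(1)] show "(\<lambda>y. g (y - x)) \<in> borel_measurable \<mu>" .
  qed (simp add: that(2))
  have int2: "integrable \<mu> (\<lambda>x. \<integral>y. g (y - x) \<partial>\<mu>)"
    if g: "g \<in> borel_measurable borel" "\<And>z. \<bar>g z\<bar> \<le> B" for g :: "real ^ 'd \<Rightarrow> real" and B
  proof (rule \<mu>.integrable_const_bound[where B = B])
    show "(\<lambda>x. \<integral>y. g (y - x) \<partial>\<mu>) \<in> borel_measurable \<mu>"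
      by (rule measurable_compose[OF id borel_measurable_integral_difference[OF \<mu> sets g(1)]])
    show "AE x in \<mu>. norm (\<integral>y. g (y - x) \<partial>\<mu>) \<le> B"
    proof (rule AE_I2)
      fix x
      have "- B \<le> (\<integral>y. g (y - x) \<partial>\<mu>)" "(\<integral>y. g (y - x) \<partial>\<mu>) \<le> B"
        using g(2) by (auto intro!: \<mu>.integral_ge_const \<mu>.integral_le_const int1[OF g] simp: abs_le_iff minus_le_iff)
      then show "norm (\<integral>y. g (y - x) \<partial>\<mu>) \<le> B" by auto
    qed
  qed
  have grid_part: "(\<Sum>s\<in>?J. \<Sum>s'\<in>?J. b s s') \<le> (\<integral>x. (?G x)\<^sup>2 \<partial>torus_haar)"
  proof -
    have g: "(\<lambda>z. ?A (z - s' + s)) \<in> borel_measurable borel" "\<And>z. \<bar>?A (z - s' + s)\<bar> \<le> 1" for s s'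
      by (measurable, rule Ab)
    have b': "b s s' = (\<integral>x. (\<integral>y. ?A (y - x - s' + s) \<partial>\<mu>) \<partial>\<mu>)" for s s'
      unfolding b_def by (simp add: algebra_simps)
    have "(\<Sum>s\<in>?J. \<Sum>s'\<in>?J. b s s') = (\<integral>x. (\<Sum>s\<in>?J. \<Sum>s'\<in>?J. \<integral>y. ?A (y - x - s' + s) \<partial>\<mu>) \<partial>\<mu>)"
      unfolding b' using int2[OF g] by (simp add: Bochner_Integration.integral_sum Bochner_Integration.integrable_sum)
    also have "\<dots> = (\<integral>x. (\<integral>y. (\<Sum>s\<in>?J. \<Sum>s'\<in>?J. ?A (y - x - s' + s)) \<partial>\<mu>) \<partial>\<mu>)"
      using int1[OF g] by (simp add: Bochner_Integration.integral_sum Bochner_Integration.integrable_sum)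
    also have "\<dots> = (\<integral>x. (\<integral>y. torus_autocorr ?G (y - x) \<partial>\<mu>) \<partial>\<mu>)"
      by (simp only: torus_autocorr_grid_discrepancy)
    also have "\<dots> \<le> torus_autocorr ?G 0"
    proof -
      have G: "torus_autocorr ?G \<in> borel_measurable borel" by (rule torus_autocorr_borel) simp
      note Gb = torus_autocorr_bound[OF grid_discrepancy_borel grid_discrepancy_bound]
      have le: "torus_autocorr ?G z \<le> torus_autocorr ?G 0" for z
        by (rule torus_autocorr_le_zero[OF grid_discrepancy_borel grid_discrepancy_bound torus_periodic_grid_discrepancy])
      have "(\<integral>y. torus_autocorr ?G (y - x) \<partial>\<mu>) \<le> torus_autocorr ?G 0" for x
        by (intro \<mu>.integral_le_const int1[OF G Gb] AE_I2 le)
      then show ?thesis by (rule \<mu>.integral_le_const[OF int2[OF G Gb] AE_I2])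
    qed
    also have "\<dots> = (\<integral>x. (?G x)\<^sup>2 \<partial>torus_haar)" by (simp add: torus_autocorr_def power2_eq_square)
    finally show ?thesis .
  qed
  have diag_part: "?A 0 - b s s \<le> C * \<epsilon>" for s
  proof -
    have near: "AE x in \<mu>. \<exists>y\<in>cball a \<epsilon>. x = torus_red y"
      using AE_torus_support[OF \<mu> sets] by eventually_elim (use supp in auto)
    \<comment> \<open>$A(0) - A(h) \le C |h| / 2$, and two points of the ball are at most $2 \varepsilon$ apart.\<close>
    have step: "?A 0 - C * \<epsilon> \<le> ?A (torus_red y' - torus_red y)" if y: "y \<in> cball a \<epsilon>" "y' \<in> cball a \<epsilon>" for y y'
    proof -
      have "?A (torus_red y' - torus_red y) = ?A (y' - y)"
      proof -
        have "(y' - torus_red y') - (y - torus_red y) \<in> int_lattice"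
          by (intro int_lattice_diff diff_torus_red_in_int_lattice)
        from torus_periodicD[OF Aper this, of "torus_red y' - torus_red y"] show ?thesis by (simp add: algebra_simps)
      qed
      moreover have "2 * (?A 0 - ?A (y' - y)) \<le> C * norm (y' - y)"
        using C(2)[of "y' - y"] torus_autocorr_increment[OF centred_ball_borel centred_ball_bound torus_periodic_centred_ball, of r "y' - y"]
        by (simp add: centred_ball_def)
      moreover have "C * norm (y' - y) \<le> 2 * (C * \<epsilon>)"
        unfolding mult.left_commute[of 2]
      proof (rule mult_left_mono[OF _ C(1)])
        have "norm (y' - y) \<le> dist a y' + dist a y"
          using dist_triangle[of y' y a] by (simp add: dist_norm norm_minus_commute)
        then show "norm (y' - y) \<le> 2 * \<epsilon>" using y by simp
      qed
      ultimately show ?thesis by simp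
    qed
    have "?A 0 - C * \<epsilon> \<le> (\<integral>x. (\<integral>y. ?A (y - x) \<partial>\<mu>) \<partial>\<mu>)"
    proof (rule \<mu>.integral_ge_const[OF int2[OF A Ab]])
      show "AE x in \<mu>. ?A 0 - C * \<epsilon> \<le> (\<integral>y. ?A (y - x) \<partial>\<mu>)"
        using near
      proof eventually_elim
        case (elim x)
        then obtain y0 where y0: "y0 \<in> cball a \<epsilon>" "x = torus_red y0" by blast
        show ?case
        proof (rule \<mu>.integral_ge_const[OF int1[OF A Ab]])
          show "AE y in \<mu>. ?A 0 - C * \<epsilon> \<le> ?A (y - x)"
            using near by eventually_elim (use y0 step in auto)
        qed
      qed
    qed
    also have "\<dots> = b s s" unfolding b_def by simp
    finally show ?thesis by simp
  qed
  have "(\<Sum>s\<in>?J. \<Sum>s'\<in>?J. E s s') = (\<Sum>s\<in>?J. \<Sum>s'\<in>?J. b s s' + (if s' = s then ?A 0 - b s s else 0))"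
    using Eb Es by (intro sum.cong refl) auto
  also have "\<dots> = (\<Sum>s\<in>?J. \<Sum>s'\<in>?J. b s s') + (\<Sum>s\<in>?J. ?A 0 - b s s)"
    using J by (simp add: sum.distrib)
  also have "\<dots> \<le> (\<integral>x. (?G x)\<^sup>2 \<partial>torus_haar) + (\<Sum>s\<in>?J. C * \<epsilon>)"
    by (intro add_mono grid_part sum_mono diag_part)
  finally show ?thesis unfolding total by (simp add: card_torus_grid[OF M])
qed

theorem theorem3:
  fixes r :: real
    and \<mu> :: "nat \<Rightarrow> (real ^ 'd) measure"
    and \<epsilon> :: "nat \<Rightarrow> real"
  assumes "CARD('d) \<ge> 2"
    and "0 < r" and "r < 1 / 2"
    and "\<And>M. M \<ge> 1 \<Longrightarrow> prob_space (\<mu> M)"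
    and "\<And>M. M \<ge> 1 \<Longrightarrow> sets (\<mu> M) = sets torus_borel"
    and "\<And>M. M \<ge> 1 \<Longrightarrow> \<exists>a. torus_support (\<mu> M) \<subseteq> torus_red ` cball a (\<epsilon> M)"
    and "\<exists>C>0. \<forall>M\<ge>1. \<epsilon> M \<le> C / real M"
  shows "\<exists>c>0. \<forall>M\<ge>1.
           (gen_discrepancy r (\<mu> M) M)\<^sup>2 \<le> c * real (M ^ CARD('d)) powr (1 - 1 / real CARD('d))"
proof -
  obtain C where C: "C > 0" "\<And>h :: real ^ 'd.
      (\<integral>x. (indicat_real (periodic_ball r) (x + h) - indicat_real (periodic_ball r) x)\<^sup>2 \<partial>torus_haar) \<le> C * norm h"
    using periodic_ball_modulus[OF assms(2,3)] by blast
  obtain S where S: "S > 0"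
    "\<And>M. M \<ge> 1 \<Longrightarrow> (\<integral>x. (grid_discrepancy r M (x :: real ^ 'd))\<^sup>2 \<partial>torus_haar) \<le> S * real M ^ (CARD('d) - 1)"
    using grid_discrepancy_L2[OF assms(2,3)] by blast
  obtain R where R: "R > 0" "\<And>M. M \<ge> 1 \<Longrightarrow> \<epsilon> M \<le> R / real M" using assms(7) by blast
  have "(gen_discrepancy r (\<mu> M) M)\<^sup>2 \<le> (S + C * R) * real (M ^ CARD('d)) powr (1 - 1 / real CARD('d))"
    if M: "M \<ge> 1" for M
  proof -
    obtain a where a: "torus_support (\<mu> M) \<subseteq> torus_red ` cball a (\<epsilon> M)" using assms(6)[OF M] by blast
    have M0: "M > 0" "real M > 0" using M by simp_all
    have pw: "real (M ^ CARD('d)) = real M * real M ^ (CARD('d) - 1)"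
      using power_minus_mult[of "CARD('d)" "real M"] by (simp add: mult.commute)
    have powr: "real (M ^ CARD('d)) powr (1 - 1 / real CARD('d)) = real M ^ (CARD('d) - 1)"
    proof -
      have "real (M ^ CARD('d)) = real M powr real CARD('d)" using M0 by (simp add: powr_realpow)
      then have "real (M ^ CARD('d)) powr (1 - 1 / real CARD('d)) = real M powr (real CARD('d) * (1 - 1 / real CARD('d)))"
        by (simp only: powr_powr)
      also have "real CARD('d) * (1 - 1 / real CARD('d)) = real (CARD('d) - 1)"
        by (simp add: algebra_simps of_nat_diff)
      finally show ?thesis by (simp only: powr_realpow[OF M0(2)])
    qed
    have "(gen_discrepancy r (\<mu> M) M)\<^sup>2
        \<le> (\<integral>x. (grid_discrepancy r M (x :: real ^ 'd))\<^sup>2 \<partial>torus_haar) + real (M ^ CARD('d)) * (C * \<epsilon> M)"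
      using C by (intro gen_discrepancy_square_le[OF assms(2,3) M0(1) assms(4)[OF M] assms(5)[OF M] a]) auto
    also have "\<dots> \<le> S * real M ^ (CARD('d) - 1) + real (M ^ CARD('d)) * (C * (R / real M))"
      using C R(2)[OF M] by (intro add_mono S(2)[OF M] mult_left_mono) auto
    also have "\<dots> = (S + C * R) * real M ^ (CARD('d) - 1)"
      unfolding pw using M0 by (simp add: field_simps)
    finally show ?thesis by (simp only: powr)
  qed
  moreover have "S + C * R > 0" using S C R by (simp add: add_pos_pos)
  ultimately show ?thesis by blast
qed

end
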